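(* Let $E$ be a complex Banach lattice, let $T \in \mathcal{L}(E)$ be a positive operator with spectral radius $r(T) = 1$ and let $\lambda \in \sigma_{\mathrm{per}}(T)$. If there is a sequence $1 < r_n \downarrow 1$ of real numbers such that $$\|R(r_n \lambda,T)\| \sim \frac{1}{r_n-1} \quad \text{and} \quad \|R(r_n,T)\| = O\Big(\frac{1}{(r_n-1)^2}\Big),$$ then $\lambda^k \in \sigma_{\mathrm{per}}(T)$ for all $k \in \mathbb{Z}$.
   Context: $\mathcal{L}(E)$ is the space of bounded linear operators on $E$. $T$ is positive if $Tx \ge 0$ whenever $x \ge 0$. $\sigma(T)$ is the spectrum and $r(T)$ the spectral radius of $T$; the peripheral spectrum is $\sigma_{\mathrm{per}}(T) := \{\lambda \in \sigma(T) : |\lambda| = r(T)\}$. $R(\mu,T) := (\mu - T)^{-1}$ denotes the resolvent. For sequences $(a_n),(b_n)$ of non-negative real numbers, $a_n \sim b_n$ means $a_n = O(b_n)$ and $b_n = O(a_n)$ as $n\to\infty$. The notation $1 < r_n \downarrow 1$ means that all $r_n>1$ and $(r_n)$ decreases to $1$. *)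

theory Defs
  imports "HOL-Analysis.Analysis" "HOL-Library.Lattice_Algebras" "HOL-Library.Landau_Symbols"
begin

section \<open>Real Banach lattices\<close>

class banach_lattice = banach + ordered_real_vector + lattice_ab_group_add_abs +
  assumes norm_mono_abs: "\<bar>x\<bar> \<le> \<bar>y\<bar> \<Longrightarrow> norm x \<le> norm y"

instance real :: banach_lattice
  by standard (auto simp: sup_real_def)

lemma norm_abs_banach_lattice [simp]: "norm \<bar>x\<bar> = norm (x :: 'a::banach_lattice)"
  by (intro antisym norm_mono_abs) auto

lemma norm_mono_nonneg:
  fixes x y :: "'a::banach_lattice"
  assumes "0 \<le> x" "x \<le> y"
  shows "norm x \<le> norm y"
  using assms by (intro norm_mono_abs) (metis abs_of_nonneg order_trans)

lemma norm_le_of_abs_le: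
  fixes x y :: "'a::banach_lattice"
  assumes "\<bar>x\<bar> \<le> y"
  shows "norm x \<le> norm y"
  using norm_mono_nonneg[OF abs_ge_zero assms] by simp

lemma nonneg_LIMSEQ:
  fixes a :: "'a::banach_lattice"
  assumes lim: "X \<longlonglongrightarrow> a" and nn: "\<And>n. 0 \<le> X n"
  shows "0 \<le> a"
proof -
  let ?p = "sup (- a) 0"
  have bd: "norm ?p \<le> norm (X n - a)" for n
  proof -
    have "- a \<le> X n - a"
      using nn[of n] by simp
    also have "\<dots> \<le> \<bar>X n - a\<bar>"
      by (rule abs_ge_self)
    finally have "?p \<le> \<bar>X n - a\<bar>" by simp
    then have "norm ?p \<le> norm \<bar>X n - a\<bar>"
      by (intro norm_mono_nonneg) auto
    then show ?thesis by simp
  qed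
  have "(\<lambda>n. norm (X n - a)) \<longlonglongrightarrow> 0"
    using lim by (simp add: LIM_zero tendsto_norm_zero)
  then have "norm ?p \<le> 0"
    by (rule LIMSEQ_le_const) (use bd in auto)
  then have "?p = 0" by simp
  then have "- a \<le> 0" by (metis sup.cobounded1)
  then show ?thesis by simp
qed

lemma le_LIMSEQ_banach_lattice:
  fixes a b :: "'a::banach_lattice"
  assumes "X \<longlonglongrightarrow> a" "Y \<longlonglongrightarrow> b" "\<And>n. X n \<le> Y n"
  shows "a \<le> b"
proof -
  have "(\<lambda>n. Y n - X n) \<longlonglongrightarrow> b - a"
    by (intro tendsto_intros assms)
  then have "0 \<le> b - a"
    by (rule nonneg_LIMSEQ) (simp add: assms)
  then show ?thesis by simp
qed

lemma abs_scaleR_banach_lattice_le: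
  fixes x :: "'a::banach_lattice"
  shows "a *\<^sub>R x \<le> \<bar>a\<bar> *\<^sub>R \<bar>x\<bar>"
proof (cases "0 \<le> a")
  case True
  then show ?thesis by (simp add: scaleR_left_mono abs_ge_self)
next
  case False
  then have "a *\<^sub>R x = (- a) *\<^sub>R (- x)" by simp
  also have "\<dots> \<le> (- a) *\<^sub>R \<bar>x\<bar>"
    using False by (intro scaleR_left_mono) (auto intro: abs_ge_minus_self)
  finally show ?thesis using False by simp
qed

section \<open>The complexification of a real Banach lattice\<close>

datatype 'a complexification = Complexify (re_part: 'a) (im_part: 'a)

text \<open>
  For \<open>z = x + iy\<close>, the modulus is the supremum of \<open>(cos \<theta>) x + (sin \<theta>) y\<close> over real \<open>\<theta>\<close>, and
  the norm of \<open>z\<close> is the norm of its modulus. The supremum exists although a Banach lattice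
  need not be order complete, see \<open>ex_lub_rot\<close> below.
\<close>

definition rot :: "'a::real_vector complexification \<Rightarrow> real \<Rightarrow> 'a"
  where "rot z t = cos t *\<^sub>R re_part z + sin t *\<^sub>R im_part z"

definition modulus :: "'a::banach_lattice complexification \<Rightarrow> 'a"
  where "modulus z = (LEAST m. \<forall>t. rot z t \<le> m)"

lemma rot_diff_le:
  fixes z :: "'a::banach_lattice complexification"
  assumes "\<bar>t - s\<bar> \<le> e"
  shows "rot z t \<le> rot z s + e *\<^sub>R (\<bar>re_part z\<bar> + \<bar>im_part z\<bar>)"
proof -
  let ?x = "re_part z" and ?y = "im_part z"
  have c: "\<bar>cos t - cos s\<bar> \<le> e"
  proof -
    have "norm (cos t - cos s) \<le> 1 * norm (t - s)"
      by (rule field_differentiable_bound[where S = UNIV and f' = "\<lambda>x. - sin x"])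
        (auto intro!: derivative_eq_intros)
    then show ?thesis using assms by simp
  qed
  have s: "\<bar>sin t - sin s\<bar> \<le> e"
  proof -
    have "norm (sin t - sin s) \<le> 1 * norm (t - s)"
      by (rule field_differentiable_bound[where S = UNIV and f' = cos])
        (auto intro!: derivative_eq_intros)
    then show ?thesis using assms by simp
  qed
  have "rot z t - rot z s = (cos t - cos s) *\<^sub>R ?x + (sin t - sin s) *\<^sub>R ?y"
    by (simp add: rot_def algebra_simps)
  also have "\<dots> \<le> \<bar>cos t - cos s\<bar> *\<^sub>R \<bar>?x\<bar> + \<bar>sin t - sin s\<bar> *\<^sub>R \<bar>?y\<bar>"
    by (intro add_mono abs_scaleR_banach_lattice_le)
  also have "\<dots> \<le> e *\<^sub>R \<bar>?x\<bar> + e *\<^sub>R \<bar>?y\<bar>"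
    by (intro add_mono scaleR_right_mono c s) auto
  finally show ?thesis
    by (simp add: algebra_simps)
qed

lemma ex_lub_rot:
  fixes z :: "'a::banach_lattice complexification"
  shows "\<exists>m. (\<forall>t. rot z t \<le> m) \<and> (\<forall>b. (\<forall>t. rot z t \<le> b) \<longrightarrow> m \<le> b)"
proof -
  define u where "u = \<bar>re_part z\<bar> + \<bar>im_part z\<bar>"
  define F where "F n = (\<lambda>k. real k / real (Suc n)) ` {..7 * Suc n}" for n
  define S where "S n = Sup_fin (rot z ` F n)" for n
  have u0: "0 \<le> u" by (simp add: u_def)
  have fin: "finite (rot z ` F n)" "rot z ` F n \<noteq> {}" for n
    by (auto simp: F_def)
  have S_ub: "S n \<le> b" if "\<forall>t. rot z t \<le> b" for n b
    unfolding S_def using that fin[of n] by (intro Sup_fin.boundedI) auto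
  have near: "rot z t \<le> S n + (1 / real (Suc n)) *\<^sub>R u" for t n
  proof -
    obtain t' where t': "0 \<le> t'" "t' < 2 * pi" "cos t = cos t'" "sin t = sin t'"
      by (rule sincos_total_2pi[of "cos t" "sin t"]) (simp, blast)
    have rot_t': "rot z t = rot z t'"
      using t' by (simp add: rot_def)
    define k where "k = nat \<lfloor>t' * real (Suc n)\<rfloor>"
    have fl: "real k = of_int \<lfloor>t' * real (Suc n)\<rfloor>"
      using t' by (simp add: k_def)
    have k1: "real k \<le> t' * real (Suc n)" "t' * real (Suc n) < real k + 1"
      unfolding fl by linarith+
    have "t' * real (Suc n) \<le> 7 * real (Suc n)"
      using t' pi_less_4 pi_approx by (intro mult_right_mono) auto
    then have "real k \<le> real (7 * Suc n)" using k1 by simp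
    then have "k \<le> 7 * Suc n" by linarith
    then have mem: "rot z (real k / real (Suc n)) \<in> rot z ` F n"
      by (auto simp: F_def)
    have "\<bar>t' - real k / real (Suc n)\<bar> \<le> 1 / real (Suc n)"
    proof -
      have "t' - real k / real (Suc n) = (t' * real (Suc n) - real k) / real (Suc n)"
        by (simp add: divide_simps del: of_nat_Suc)
      moreover have "\<bar>t' * real (Suc n) - real k\<bar> \<le> 1"
        using k1 by linarith
      ultimately show ?thesis
        by (simp add: divide_right_mono del: of_nat_Suc)
    qed
    from rot_diff_le[OF this, of z]
    have "rot z t' \<le> rot z (real k / real (Suc n)) + (1 / real (Suc n)) *\<^sub>R u"
      by (simp add: u_def)
    also have "\<dots> \<le> S n + (1 / real (Suc n)) *\<^sub>R u"
      unfolding S_def by (intro add_right_mono Sup_fin.coboundedI fin mem)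
    finally show ?thesis using rot_t' by simp
  qed
  have S_le: "S m \<le> S n + (1 / real (Suc n)) *\<^sub>R u" for m n
    using near[where n = n] by (intro S_ub) blast
  have S_dist: "dist (S m) (S n) \<le> (1 / real (Suc (min m n))) * norm u" for m n
  proof -
    let ?e = "1 / real (Suc (min m n))"
    have e: "(1 / real (Suc m)) *\<^sub>R u \<le> ?e *\<^sub>R u" "(1 / real (Suc n)) *\<^sub>R u \<le> ?e *\<^sub>R u"
      using u0 by (auto intro!: scaleR_right_mono simp: field_simps)
    have "S m - S n \<le> ?e *\<^sub>R u" "- (S m - S n) \<le> ?e *\<^sub>R u"
      using order_trans[OF S_le[of m n] add_left_mono[OF e(2)]]
        order_trans[OF S_le[of n m] add_left_mono[OF e(1)]]
      by (auto simp: algebra_simps)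
    then have "\<bar>S m - S n\<bar> \<le> ?e *\<^sub>R u"
      by (rule abs_leI)
    from norm_le_of_abs_le[OF this] show ?thesis
      by (simp add: dist_norm)
  qed
  have lim0: "(\<lambda>n. 1 / real (Suc n)) \<longlonglongrightarrow> 0"
    using LIMSEQ_inverse_real_of_nat by (simp add: inverse_eq_divide)
  have "Cauchy S"
  proof (rule metric_CauchyI)
    fix e :: real assume "0 < e"
    have "(\<lambda>n. (1 / real (Suc n)) * norm u) \<longlonglongrightarrow> 0"
      using tendsto_mult_right[OF lim0, of "norm u"] by simp
    from order_tendstoD(2)[OF this \<open>0 < e\<close>]
    obtain N where N: "\<And>n. n \<ge> N \<Longrightarrow> (1 / real (Suc n)) * norm u < e"
      by (auto simp: eventually_sequentially)
    then show "\<exists>M. \<forall>m\<ge>M. \<forall>n\<ge>M. dist (S m) (S n) < e"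
      using S_dist by (meson le_less_trans min.boundedI)
  qed
  then obtain s where s: "S \<longlonglongrightarrow> s"
    using Cauchy_convergent convergent_def by blast
  have "rot z t \<le> s" for t
  proof (rule le_LIMSEQ_banach_lattice)
    show "(\<lambda>n. rot z t) \<longlonglongrightarrow> rot z t" by simp
    show "(\<lambda>n. S n + (1 / real (Suc n)) *\<^sub>R u) \<longlonglongrightarrow> s"
      using tendsto_add[OF s tendsto_scaleR[OF lim0 tendsto_const[of u]]] by simp
  qed (rule near)
  moreover have "s \<le> b" if "\<forall>t. rot z t \<le> b" for b
    using S_ub[OF that] by (intro le_LIMSEQ_banach_lattice[OF s tendsto_const]) auto
  ultimately show ?thesis by blast
qed

lemma modulus_props:
  fixes z :: "'a::banach_lattice complexification"
  shows rot_le_modulus: "rot z t \<le> modulus z"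
    and modulus_least: "(\<And>t. rot z t \<le> b) \<Longrightarrow> modulus z \<le> b"
proof -
  obtain m where m: "\<forall>t. rot z t \<le> m" "\<forall>b. (\<forall>t. rot z t \<le> b) \<longrightarrow> m \<le> b"
    using ex_lub_rot by blast
  have "modulus z = m"
    unfolding modulus_def by (rule Least_equality) (use m in auto)
  then show "rot z t \<le> modulus z" "(\<And>t. rot z t \<le> b) \<Longrightarrow> modulus z \<le> b"
    using m by auto
qed

lemma modulus_nonneg: "0 \<le> modulus (z :: 'a::banach_lattice complexification)"
proof -
  have "rot z 0 + rot z pi \<le> modulus z + modulus z"
    by (intro add_mono rot_le_modulus)
  then show ?thesis by (simp add: rot_def)
qed

lemma abs_parts_le_modulus:
  fixes z :: "'a::banach_lattice complexification"
  shows "\<bar>re_part z\<bar> \<le> modulus z" "\<bar>im_part z\<bar> \<le> modulus z"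
  using rot_le_modulus[of z 0] rot_le_modulus[of z pi]
    rot_le_modulus[of z "pi / 2"] rot_le_modulus[of z "- (pi / 2)"]
  by (auto intro!: abs_leI simp: rot_def)

lemma modulus_le_abs_parts:
  "modulus z \<le> \<bar>re_part z\<bar> + \<bar>im_part (z :: 'a::banach_lattice complexification)\<bar>"
proof (rule modulus_least)
  fix t
  have "rot z t \<le> \<bar>cos t\<bar> *\<^sub>R \<bar>re_part z\<bar> + \<bar>sin t\<bar> *\<^sub>R \<bar>im_part z\<bar>"
    unfolding rot_def by (intro add_mono abs_scaleR_banach_lattice_le)
  also have "\<dots> \<le> 1 *\<^sub>R \<bar>re_part z\<bar> + 1 *\<^sub>R \<bar>im_part z\<bar>"
    by (intro add_mono scaleR_right_mono) auto
  finally show "rot z t \<le> \<bar>re_part z\<bar> + \<bar>im_part z\<bar>" by simp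
qed

instantiation complexification :: (real_vector) real_vector
begin

definition "0 = Complexify 0 0"
definition "z + w = Complexify (re_part z + re_part w) (im_part z + im_part w)"
definition "- z = Complexify (- re_part z) (- im_part z)"
definition "z - w = Complexify (re_part z - re_part w) (im_part z - im_part w)"
definition "a *\<^sub>R z = Complexify (a *\<^sub>R re_part z) (a *\<^sub>R im_part z)"

instance
  by standard
    (rule complexification.expand; simp add: zero_complexification_def plus_complexification_def
      uminus_complexification_def minus_complexification_def scaleR_complexification_def
      algebra_simps)+

end

lemma complexification_parts [simp]:
  "re_part 0 = 0" "im_part 0 = 0"
  "re_part (z + w) = re_part z + re_part w" "im_part (z + w) = im_part z + im_part w"
  "re_part (- z) = - re_part z" "im_part (- z) = - im_part z"
  "re_part (z - w) = re_part z - re_part w" "im_part (z - w) = im_part z - im_part w"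
  "re_part (a *\<^sub>R z) = a *\<^sub>R re_part z" "im_part (a *\<^sub>R z) = a *\<^sub>R im_part z"
  by (simp_all add: zero_complexification_def plus_complexification_def
      uminus_complexification_def minus_complexification_def scaleR_complexification_def)

definition scaleC :: "complex \<Rightarrow> 'a::real_vector complexification \<Rightarrow> 'a complexification"
    (infixr "*\<^sub>C" 75)
  where "c *\<^sub>C z = Complexify (Re c *\<^sub>R re_part z - Im c *\<^sub>R im_part z)
                          (Re c *\<^sub>R im_part z + Im c *\<^sub>R re_part z)"

lemma scaleC_parts [simp]:
  "re_part (c *\<^sub>C z) = Re c *\<^sub>R re_part z - Im c *\<^sub>R im_part z"
  "im_part (c *\<^sub>C z) = Re c *\<^sub>R im_part z + Im c *\<^sub>R re_part z"
  by (simp_all add: scaleC_def)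

lemma scaleC_of_real: "complex_of_real a *\<^sub>C z = a *\<^sub>R z"
  by (rule complexification.expand) simp

lemma scaleC_vector_space:
  "c *\<^sub>C (z + w) = c *\<^sub>C z + c *\<^sub>C w" "(c + d) *\<^sub>C z = c *\<^sub>C z + d *\<^sub>C z"
  "c *\<^sub>C d *\<^sub>C z = (c * d) *\<^sub>C z" "1 *\<^sub>C z = z"
  by (rule complexification.expand; simp add: algebra_simps)+

lemma modulus_scaleC_le:
  fixes z :: "'a::banach_lattice complexification"
  shows "modulus (c *\<^sub>C z) \<le> cmod c *\<^sub>R modulus z"
proof (rule modulus_least)
  fix t
  have c: "Re c = cmod c * cos (Arg c)" "Im c = cmod c * sin (Arg c)"
    by (metis Re_rcis rcis_cmod_Arg, metis Im_rcis rcis_cmod_Arg)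
  have "rot (c *\<^sub>C z) t = cmod c *\<^sub>R rot z (t - Arg c)"
    by (simp add: rot_def c cos_diff sin_diff algebra_simps)
  also have "\<dots> \<le> cmod c *\<^sub>R modulus z"
    by (intro scaleR_left_mono rot_le_modulus) auto
  finally show "rot (c *\<^sub>C z) t \<le> cmod c *\<^sub>R modulus z" .
qed

lemma modulus_scaleC:
  fixes z :: "'a::banach_lattice complexification"
  shows "modulus (c *\<^sub>C z) = cmod c *\<^sub>R modulus z"
proof (cases "c = 0")
  case True
  have "modulus (c *\<^sub>C z) \<le> 0" using modulus_scaleC_le[of c z] True by simp
  then show ?thesis using modulus_nonneg[of "c *\<^sub>C z"] True by simp
next
  case False
  have "modulus z = modulus (inverse c *\<^sub>C c *\<^sub>C z)"
    using False by (simp add: scaleC_vector_space)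
  also have "\<dots> \<le> cmod (inverse c) *\<^sub>R modulus (c *\<^sub>C z)"
    by (rule modulus_scaleC_le)
  finally have "cmod c *\<^sub>R modulus z \<le> cmod c *\<^sub>R cmod (inverse c) *\<^sub>R modulus (c *\<^sub>C z)"
    by (intro scaleR_left_mono) auto
  then show ?thesis
    using False by (intro antisym modulus_scaleC_le) (auto simp: norm_inverse)
qed

instantiation complexification :: (banach_lattice) real_normed_vector
begin

definition "norm z = norm (modulus z)" for z :: "'a complexification"
definition "sgn z = inverse (norm z) *\<^sub>R z" for z :: "'a complexification"
definition "dist z w = norm (z - w)" for z w :: "'a complexification"
definition "uniformity = (INF e\<in>{0<..}. principal {(z :: 'a complexification, w). dist z w < e})"
definition "open U = (\<forall>x\<in>U. \<forall>\<^sub>F (x', y) in uniformity. x' = x \<longrightarrow> y \<in> U)"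
  for U :: "'a complexification set"

instance
proof
  fix z w :: "'a complexification" and a :: real
  show "(norm z = 0) = (z = 0)"
  proof
    assume "norm z = 0"
    then have "modulus z = 0" by (simp add: norm_complexification_def)
    then have "re_part z = 0" "im_part z = 0"
      using abs_parts_le_modulus[of z] by (simp_all)
    then show "z = 0" by (simp add: complexification.expand)
  next
    assume "z = 0"
    then show "norm z = 0"
      using modulus_le_abs_parts[of z] modulus_nonneg[of z]
      by (simp add: norm_complexification_def)
  qed
  have "modulus (z + w) \<le> modulus z + modulus w"
  proof (rule modulus_least)
    fix t
    have "rot (z + w) t = rot z t + rot w t"
      by (simp add: rot_def algebra_simps)
    then show "rot (z + w) t \<le> modulus z + modulus w"
      by (simp add: add_mono rot_le_modulus)
  qed
  then have "norm (z + w) \<le> norm (modulus z + modulus w)"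
    unfolding norm_complexification_def by (intro norm_mono_nonneg modulus_nonneg)
  also have "\<dots> \<le> norm z + norm w"
    unfolding norm_complexification_def by (rule norm_triangle_ineq)
  finally show "norm (z + w) \<le> norm z + norm w" .
  show "norm (a *\<^sub>R z) = \<bar>a\<bar> * norm z"
    unfolding norm_complexification_def scaleC_of_real[symmetric] modulus_scaleC by simp
qed (simp_all add: sgn_complexification_def dist_complexification_def
      uniformity_complexification_def open_complexification_def)

end

lemma norm_scaleC: "norm (c *\<^sub>C z) = cmod c * norm (z :: 'a::banach_lattice complexification)"
  by (simp add: norm_complexification_def modulus_scaleC)

lemma norm_parts_le:
  fixes z :: "'a::banach_lattice complexification"
  shows "norm (re_part z) \<le> norm z" "norm (im_part z) \<le> norm z"
  unfolding norm_complexification_def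
  by (intro norm_le_of_abs_le abs_parts_le_modulus)+

lemma norm_le_parts:
  fixes z :: "'a::banach_lattice complexification"
  shows "norm z \<le> norm (re_part z) + norm (im_part z)"
proof -
  have "norm z \<le> norm (\<bar>re_part z\<bar> + \<bar>im_part z\<bar>)"
    unfolding norm_complexification_def
    by (intro norm_mono_nonneg modulus_nonneg modulus_le_abs_parts)
  also have "\<dots> \<le> norm (re_part z) + norm (im_part z)"
    by (rule order_trans[OF norm_triangle_ineq]) simp
  finally show ?thesis .
qed

instance complexification :: (banach_lattice) banach
proof
  fix X :: "nat \<Rightarrow> 'a complexification"
  assume "Cauchy X"
  then have C: "\<forall>e>0. \<exists>M. \<forall>m\<ge>M. \<forall>n\<ge>M. norm (X m - X n) < e"
    by (simp add: Cauchy_iff)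
  have "norm (re_part (X m) - re_part (X n)) \<le> norm (X m - X n)"
    "norm (im_part (X m) - im_part (X n)) \<le> norm (X m - X n)" for m n
    using norm_parts_le[of "X m - X n"] by simp_all
  with C have "Cauchy (\<lambda>n. re_part (X n))" "Cauchy (\<lambda>n. im_part (X n))"
    unfolding Cauchy_iff by (meson le_less_trans)+
  then obtain x y where xy: "(\<lambda>n. re_part (X n)) \<longlonglongrightarrow> x" "(\<lambda>n. im_part (X n)) \<longlonglongrightarrow> y"
    using Cauchy_convergent convergent_def by metis
  have "(\<lambda>n. norm (re_part (X n) - x) + norm (im_part (X n) - y)) \<longlonglongrightarrow> 0"
    using tendsto_add[OF tendsto_norm_zero[OF LIM_zero[OF xy(1)]]
        tendsto_norm_zero[OF LIM_zero[OF xy(2)]]] by simp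
  then have "(\<lambda>n. norm (X n - Complexify x y)) \<longlonglongrightarrow> 0"
    by (rule tendsto_sandwich[rotated 3, where f = "\<lambda>_. 0"])
      (use norm_le_parts[of "X _ - Complexify x y"] in \<open>auto intro!: always_eventually\<close>)
  then have "X \<longlonglongrightarrow> Complexify x y"
    by (simp add: tendsto_norm_zero_iff LIM_zero_iff)
  then show "convergent X" by (auto simp: convergent_def)
qed

text \<open>
  As for the complex numbers in \<open>HOL-Library.Complex_Order\<close>, \<open>z \<ge> 0\<close> means that \<open>z\<close> is a positive
  element of the underlying real Banach lattice.
\<close>

instantiation complexification :: (order) order
begin

definition "z \<le> w \<longleftrightarrow> re_part z \<le> re_part w \<and> im_part z = im_part w"
definition "z < w \<longleftrightarrow> re_part z < re_part w \<and> im_part z = im_part w"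

instance
  by standard (auto simp: less_eq_complexification_def less_complexification_def
      complexification.expand)

end

section \<open>Operators on the complexification\<close>

type_synonym 'a operator = "'a complexification \<Rightarrow> 'a complexification"

definition bounded_clinear :: "'a::banach_lattice operator \<Rightarrow> bool"
  where "bounded_clinear T \<longleftrightarrow> bounded_linear T \<and> (\<forall>c z. T (c *\<^sub>C z) = c *\<^sub>C T z)"

definition positive_operator :: "'a::banach_lattice operator \<Rightarrow> bool"
  where "positive_operator T \<longleftrightarrow> (\<forall>z\<ge>0. T z \<ge> 0)"

definition spectrum :: "'a::banach_lattice operator \<Rightarrow> complex set"
  where "spectrum T = {\<mu>. \<nexists>S. bounded_clinear S \<and>
    (\<forall>z. S (\<mu> *\<^sub>C z - T z) = z) \<and> (\<forall>z. \<mu> *\<^sub>C S z - T (S z) = z)}"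

text \<open>
  The inverse is the genuine one off the spectrum and an arbitrary function otherwise. The supremum
  below is a genuine one for bounded \<open>T\<close> with nonempty spectrum; the spectrum is empty only
  on the zero space. Operator norms are \<open>onorm\<close>.
\<close>

definition resolvent :: "complex \<Rightarrow> 'a::banach_lattice operator \<Rightarrow> 'a operator"
  where "resolvent \<mu> T = inv (\<lambda>z. \<mu> *\<^sub>C z - T z)"

definition spectral_radius :: "'a::banach_lattice operator \<Rightarrow> real"
  where "spectral_radius T = (SUP \<mu>\<in>spectrum T. cmod \<mu>)"

definition peripheral_spectrum :: "'a::banach_lattice operator \<Rightarrow> complex set"
  where "peripheral_spectrum T = {\<mu> \<in> spectrum T. cmod \<mu> = spectral_radius T}"

end

theory Submission
  imports Defs
begin

text \<open>
  Suppose that \<open>\<mu> = \<lambda>\<^sup>k\<close> is not in the spectrum of \<open>T\<close>, and let \<open>z\<close> be a normalised approximate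
  eigenvector, \<open>T z \<approx> \<lambda> z\<close>, with an error that may be chosen as small as needed. Think of
  vectors as functions and put \<open>v = |z| (sgn z)\<^sup>k\<close>, so that \<open>|v| = |z|\<close>. If \<open>T\<close> is an integral
  operator with positive kernel, then \<open>(T z) (s) \<approx> \<lambda> z (s)\<close> says that the phase
  \<open>w = sgn (z (t)) / (\<lambda> sgn (z (s)))\<close> has real part close to 1 in the mean, with total defect
  \<open>T |z| - |z|\<close>. Since \<open>w\<^sup>k = 1 + k (w - 1) + O(1 - Re w)\<close> on the unit circle, the linear term
  is controlled by the eigenvalue equation and the rest by the defect:
  \<open>|T v - \<mu> v| \<le> c (T |z| - |z| + small)\<close>, with the first power of the defect
  (\<open>phase_power_defect_le\<close>). In an abstract Banach lattice there are no points, but each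
  principal ideal carries enough real-valued lattice homomorphisms, here called characters, to
  check inequalities pointwise (\<open>le_if_characters_le\<close>); the vector \<open>v\<close> is built as a limit of
  finite infima of real-linear expressions in \<open>|z|\<close> and \<open>z\<close> (\<open>ex_phase_power\<close>).

  Write \<open>g\<close> for the defect \<open>T |z| - |z| + small\<close>. As \<open>\<mu>\<close> is in the resolvent set, \<open>v\<close> equals
  \<open>R(t\<mu>) (\<mu> v - T v)\<close> up to an error \<open>d\<close> whose norm tends to 0 as \<open>t\<close> decreases to 1, and
  \<open>|R(t\<mu>) x| \<le> R(t) |x|\<close>, so \<open>|z| \<le> c R(t) g + d\<close>. This is to be contradicted by measuring both
  sides. Let \<open>\<kappa>(u)\<close> be the supremum of \<open>\<parallel>A x\<parallel>\<close> over real \<open>x\<close> with \<open>|x| \<le> u\<close>, where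
  \<open>A = (l - 1) R(l\<lambda>)\<close>; it is a bounded lattice seminorm by the upper bound on \<open>R(r\<^sub>n\<lambda>)\<close>, and
  \<open>\<kappa>(|z|)\<close> stays away from 0 because \<open>A z\<close> is close to a unimodular multiple of \<open>z\<close>. Let
  \<open>\<omega>(u) = (r - 1) \<kappa>(R(r) u)\<close>. For \<open>l\<close> much closer to 1 than \<open>r\<close>, \<open>A\<close> nearly intertwines \<open>T\<close> with
  \<open>\<lambda>\<close>, whence \<open>\<kappa> \<le> 2 \<omega>\<close> up to a small error. The point of \<open>\<omega>\<close> is that it makes the defect small:
  \<open>R(r) (T |z| - |z|) \<le> (r - 1) R(r) |z|\<close> gives \<open>\<omega>(g) \<le> (r - 1) \<omega>(|z|) + small\<close>, and the
  resolvent identity gives \<open>\<omega>(R(t) g) \<le> \<omega>(g) / (t - r)\<close>.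

  The inequality \<open>|z| \<le> c R(t) g + d\<close> is used twice. Under \<open>\<omega>\<close>, with the bound
  \<open>\<omega>(u) = O(\<parallel>u\<parallel> / (r - 1))\<close> that comes from \<open>\<parallel>R(r\<^sub>n)\<parallel> = O(1/(r\<^sub>n - 1)\<^sup>2)\<close>, it shows that
  \<open>(r - 1) \<omega>(|z|)\<close> is as small as desired, and therefore that \<open>\<omega>(g)\<close> is. Under \<open>\<kappa>\<close>, with
  \<open>\<kappa> \<le> 2 \<omega>\<close>, it then forces \<open>\<kappa>(|z|)\<close> to be small, a contradiction. The lemma \<open>key_estimate\<close>
  contains both steps for fixed parameters, and the theorem sends the parameters to their
  limits one after the other.
\<close>

section \<open>Real-valued lattice homomorphisms on principal ideals\<close>

definition principal_ideal :: "'a::banach_lattice \<Rightarrow> 'a set"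
  where "principal_ideal u = {x. \<exists>c\<ge>0. \<bar>x\<bar> \<le> c *\<^sub>R u}"

definition lattice_ideal :: "'a::banach_lattice set \<Rightarrow> bool"
  where "lattice_ideal J \<longleftrightarrow> J \<noteq> {} \<and> (\<forall>x\<in>J. \<forall>y\<in>J. x + y \<in> J) \<and>
    (\<forall>x\<in>J. \<forall>y. \<bar>y\<bar> \<le> \<bar>x\<bar> \<longrightarrow> y \<in> J)"

text \<open>
  Only the values of \<open>\<phi>\<close> on the principal ideal of \<open>u\<close> matter: on the whole of a Banach lattice, for
  example \<open>L\<^sup>1[0,1]\<close>, there may be no nonzero real-valued lattice homomorphism at all.
\<close>

definition character :: "'a::banach_lattice \<Rightarrow> ('a \<Rightarrow> real) \<Rightarrow> bool"
  where "character u \<phi> \<longleftrightarrow> 0 \<le> u \<and> \<phi> u = 1 \<and>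
    (\<forall>x\<in>principal_ideal u. \<forall>y\<in>principal_ideal u. \<phi> (x + y) = \<phi> x + \<phi> y) \<and>
    (\<forall>x\<in>principal_ideal u. \<forall>c. \<phi> (c *\<^sub>R x) = c * \<phi> x) \<and>
    (\<forall>x\<in>principal_ideal u. \<forall>y\<in>principal_ideal u. \<phi> (sup x y) = max (\<phi> x) (\<phi> y))"

lemma scaleR_inf_distrib:
  fixes x y :: "'a::banach_lattice"
  assumes "0 < c"
  shows "c *\<^sub>R inf x y = inf (c *\<^sub>R x) (c *\<^sub>R y)"
proof (rule antisym)
  show "c *\<^sub>R inf x y \<le> inf (c *\<^sub>R x) (c *\<^sub>R y)"
    using assms by (auto intro: scaleR_left_mono)
  have "inverse c *\<^sub>R inf (c *\<^sub>R x) (c *\<^sub>R y) \<le> inverse c *\<^sub>R (c *\<^sub>R x)"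
    "inverse c *\<^sub>R inf (c *\<^sub>R x) (c *\<^sub>R y) \<le> inverse c *\<^sub>R (c *\<^sub>R y)"
    using assms by (intro scaleR_left_mono; simp)+
  then have "inverse c *\<^sub>R inf (c *\<^sub>R x) (c *\<^sub>R y) \<le> inf x y"
    using assms by simp
  then have "c *\<^sub>R (inverse c *\<^sub>R inf (c *\<^sub>R x) (c *\<^sub>R y)) \<le> c *\<^sub>R inf x y"
    using assms by (intro scaleR_left_mono) auto
  then show "inf (c *\<^sub>R x) (c *\<^sub>R y) \<le> c *\<^sub>R inf x y"
    using assms by simp
qed

lemma scaleR_sup_distrib:
  fixes x y :: "'a::banach_lattice"
  assumes "0 < c"
  shows "c *\<^sub>R sup x y = sup (c *\<^sub>R x) (c *\<^sub>R y)"
  unfolding sup_eq_neg_inf using scaleR_inf_distrib[OF assms, of "-x" "-y"]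
  by (simp only: scaleR_minus_right)

lemma abs_scaleR_lattice:
  fixes x :: "'a::banach_lattice"
  shows "\<bar>c *\<^sub>R x\<bar> = \<bar>c\<bar> *\<^sub>R \<bar>x\<bar>"
proof -
  have pos: "\<bar>c *\<^sub>R x\<bar> = c *\<^sub>R \<bar>x\<bar>" if "0 < c" for c and x :: 'a
    using scaleR_sup_distrib[OF that, of x "- x"] by (simp add: abs_lattice)
  consider "c = 0" | "c > 0" | "c < 0" by linarith
  then show ?thesis
    using pos[of c x] pos[of "- c" x] by cases auto
qed

lemma disjoint_pos_neg:
  fixes a :: "'a::banach_lattice"
  shows "inf (sup a 0) (sup (- a) 0) = 0"
proof -
  have e: "sup a 0 = a + sup (-a) 0"
    by (simp add: add_sup_distrib_left sup.commute)
  have n: "inf a 0 = - sup (-a) 0"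
    using neg_sup_eq_inf[of "- a" 0] by simp
  have "inf (sup a 0) (sup (-a) 0) = inf (a + sup (-a) 0) (0 + sup (-a) 0)"
    by (simp only: e add_0)
  also have "\<dots> = inf a 0 + sup (-a) 0"
    by (rule add_inf_distrib_right[symmetric])
  also have "\<dots> = 0" by (simp only: n left_minus)
  finally show ?thesis .
qed

lemma archimedean_le:
  fixes x u :: "'a::banach_lattice"
  assumes "\<And>e. 0 < e \<Longrightarrow> x \<le> e *\<^sub>R u"
  shows "x \<le> 0"
proof (rule le_LIMSEQ_banach_lattice)
  show "(\<lambda>n. x) \<longlonglongrightarrow> x" by simp
  have "(\<lambda>n. inverse (real (Suc n)) *\<^sub>R u) \<longlonglongrightarrow> 0 *\<^sub>R u"
    by (intro tendsto_intros LIMSEQ_inverse_real_of_nat)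
  then show "(\<lambda>n. inverse (real (Suc n)) *\<^sub>R u) \<longlonglongrightarrow> 0" by simp
qed (rule assms, simp)

lemma principal_idealI: "\<bar>x\<bar> \<le> u \<Longrightarrow> x \<in> principal_ideal u"
  unfolding principal_ideal_def by (auto intro: exI[of _ 1])

lemma principal_ideal_self: "0 \<le> u \<Longrightarrow> u \<in> principal_ideal u"
  by (rule principal_idealI) simp

lemma principal_ideal_add:
  assumes "x \<in> principal_ideal u" "y \<in> principal_ideal u"
  shows "x + y \<in> principal_ideal u"
proof -
  obtain c d where c: "c \<ge> 0" "d \<ge> 0" "\<bar>x\<bar> \<le> c *\<^sub>R u" "\<bar>y\<bar> \<le> d *\<^sub>R u"
    using assms by (auto simp: principal_ideal_def)
  then have "\<bar>x + y\<bar> \<le> (c + d) *\<^sub>R u"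
    using order_trans[OF abs_triangle_ineq add_mono[OF c(3,4)]] by (simp add: scaleR_add_left)
  then show ?thesis using c by (auto simp: principal_ideal_def intro: exI[of _ "c + d"])
qed

lemma principal_ideal_scaleR:
  assumes "x \<in> principal_ideal u"
  shows "a *\<^sub>R x \<in> principal_ideal u"
proof -
  obtain c where c: "c \<ge> 0" "\<bar>x\<bar> \<le> c *\<^sub>R u"
    using assms by (auto simp: principal_ideal_def)
  then have "\<bar>a *\<^sub>R x\<bar> \<le> (\<bar>a\<bar> * c) *\<^sub>R u"
    using scaleR_left_mono[OF c(2), of "\<bar>a\<bar>"] by (simp add: abs_scaleR_lattice)
  then show ?thesis using c by (auto simp: principal_ideal_def intro: exI[of _ "\<bar>a\<bar> * c"])
qed

lemma principal_ideal_uminus: "x \<in> principal_ideal u \<Longrightarrow> - x \<in> principal_ideal u"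
  by (auto simp: principal_ideal_def)

lemma principal_ideal_diff:
  "x \<in> principal_ideal u \<Longrightarrow> y \<in> principal_ideal u \<Longrightarrow> x - y \<in> principal_ideal u"
  using principal_ideal_add[of x u "- y"] by (simp add: principal_ideal_uminus)

lemma principal_ideal_solid:
  "x \<in> principal_ideal u \<Longrightarrow> \<bar>y\<bar> \<le> \<bar>x\<bar> \<Longrightarrow> y \<in> principal_ideal u"
  by (auto simp: principal_ideal_def intro: order_trans)

lemma abs_sup_le_add:
  fixes x y :: "'a::banach_lattice"
  shows "\<bar>sup x y\<bar> \<le> \<bar>x\<bar> + \<bar>y\<bar>"
proof (rule abs_leI)
  show "sup x y \<le> \<bar>x\<bar> + \<bar>y\<bar>"
    by (intro sup_least) (auto intro: order_trans[OF abs_ge_self])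
  have "- sup x y \<le> - x" by simp
  also have "\<dots> \<le> \<bar>x\<bar> + \<bar>y\<bar>" by (rule order_trans[OF abs_ge_minus_self]) simp
  finally show "- sup x y \<le> \<bar>x\<bar> + \<bar>y\<bar>" .
qed

lemma principal_ideal_sup:
  assumes "x \<in> principal_ideal u" "y \<in> principal_ideal u"
  shows "sup x y \<in> principal_ideal u"
proof (rule principal_ideal_solid)
  have "\<bar>x\<bar> \<in> principal_ideal u" "\<bar>y\<bar> \<in> principal_ideal u"
    using assms by (auto intro: principal_ideal_solid)
  then show "\<bar>x\<bar> + \<bar>y\<bar> \<in> principal_ideal u" by (rule principal_ideal_add)
  show "\<bar>sup x y\<bar> \<le> \<bar>\<bar>x\<bar> + \<bar>y\<bar>\<bar>"
    using abs_sup_le_add[of x y] by (simp add: abs_of_nonneg)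
qed

lemma principal_ideal_inf:
  "x \<in> principal_ideal u \<Longrightarrow> y \<in> principal_ideal u \<Longrightarrow> inf x y \<in> principal_ideal u"
  by (subst inf_eq_neg_sup) (intro principal_ideal_uminus principal_ideal_sup)

lemma lattice_ideal_principal: "0 \<le> u \<Longrightarrow> lattice_ideal (principal_ideal u)"
  unfolding lattice_ideal_def
  using principal_ideal_self principal_ideal_add principal_ideal_solid by blast

lemma lattice_ideal_zero: "lattice_ideal J \<Longrightarrow> 0 \<in> J"
  unfolding lattice_ideal_def by (metis abs_ge_zero abs_zero ex_in_conv)

lemma lattice_ideal_add: "lattice_ideal J \<Longrightarrow> x \<in> J \<Longrightarrow> y \<in> J \<Longrightarrow> x + y \<in> J"
  unfolding lattice_ideal_def by blast

lemma lattice_ideal_solid: "lattice_ideal J \<Longrightarrow> x \<in> J \<Longrightarrow> \<bar>y\<bar> \<le> \<bar>x\<bar> \<Longrightarrow> y \<in> J"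
  unfolding lattice_ideal_def by blast

lemma lattice_ideal_nonneg_le: "lattice_ideal J \<Longrightarrow> x \<in> J \<Longrightarrow> 0 \<le> y \<Longrightarrow> y \<le> x \<Longrightarrow> y \<in> J"
  by (erule lattice_ideal_solid) (auto intro: order_trans)

lemma lattice_ideal_scaleR:
  assumes "lattice_ideal J" "x \<in> J"
  shows "a *\<^sub>R x \<in> J"
proof -
  obtain n :: nat where n: "\<bar>a\<bar> \<le> real n" using real_arch_simple by blast
  have "real n *\<^sub>R x \<in> J" for n
    by (induction n) (auto simp: scaleR_add_left assms lattice_ideal_zero[OF assms(1)]
        intro!: lattice_ideal_add)
  moreover have "\<bar>a *\<^sub>R x\<bar> \<le> \<bar>real n *\<^sub>R x\<bar>"
    using n by (auto simp: abs_scaleR_lattice intro!: scaleR_right_mono)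
  ultimately show ?thesis using lattice_ideal_solid[OF assms(1)] by blast
qed

text \<open>
  Zorn's lemma provides an ideal that is maximal among those that miss \<open>u\<close>. It is prime: if
  neither \<open>x\<close> nor \<open>y\<close> belonged to it, then \<open>u\<close> would be dominated, modulo the ideal, by multiples
  of \<open>x\<close> and of \<open>y\<close>, hence by a multiple of their infimum.
\<close>

lemma ex_prime_ideal:
  fixes u :: "'a::banach_lattice"
  assumes I: "lattice_ideal I" "u \<notin> I" and u: "0 \<le> u"
  obtains J where "lattice_ideal J" "I \<subseteq> J" "u \<notin> J"
    "\<And>x y. 0 \<le> x \<Longrightarrow> 0 \<le> y \<Longrightarrow> inf x y = 0 \<Longrightarrow> x \<in> J \<or> y \<in> J"
proof -
  let ?A = "{J. lattice_ideal J \<and> I \<subseteq> J \<and> u \<notin> J}"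
  have "\<exists>J\<in>?A. \<forall>K\<in>?A. J \<subseteq> K \<longrightarrow> K = J"
  proof (rule subset_Zorn_nonempty)
    show "?A \<noteq> {}" using I by auto
    fix C assume C: "C \<noteq> {}" "subset.chain ?A C"
    have CA: "\<And>J. J \<in> C \<Longrightarrow> lattice_ideal J \<and> I \<subseteq> J \<and> u \<notin> J"
      using C(2) by (auto simp: subset.chain_def)
    have tot: "J \<subseteq> K \<or> K \<subseteq> J" if "J \<in> C" "K \<in> C" for J K
      using C(2) that by (auto simp: subset.chain_def)
    have "lattice_ideal (\<Union>C)"
      unfolding lattice_ideal_def
    proof (intro conjI ballI allI impI)
      show "\<Union>C \<noteq> {}"
        using C(1) CA lattice_ideal_zero by blast
    next
      fix x y assume "x \<in> \<Union>C" "y \<in> \<Union>C"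
      then obtain J where "J \<in> C" "x \<in> J" "y \<in> J" using tot by blast
      then show "x + y \<in> \<Union>C" using CA lattice_ideal_add by blast
    next
      fix x y :: 'a assume "x \<in> \<Union>C" "\<bar>y\<bar> \<le> \<bar>x\<bar>"
      then show "y \<in> \<Union>C" using CA lattice_ideal_solid by blast
    qed
    then show "\<Union>C \<in> ?A" using CA C(1) by blast
  qed
  then obtain J where JA: "J \<in> ?A" and Jmax: "\<forall>K\<in>?A. J \<subseteq> K \<longrightarrow> K = J" by (rule bexE)
  have J: "lattice_ideal J" "I \<subseteq> J" "u \<notin> J" using JA by simp_all
  have max: "K = J" if "lattice_ideal K" "I \<subseteq> K" "u \<notin> K" "J \<subseteq> K" for K
    using Jmax that by simp
  have dom: "\<exists>j\<in>J. \<exists>c\<ge>0. u \<le> j + c *\<^sub>R x" if x: "0 \<le> x" "x \<notin> J" for x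
  proof (rule ccontr)
    assume neg: "\<not> ?thesis"
    let ?K = "{y. \<exists>j\<in>J. \<exists>c\<ge>0. \<bar>y\<bar> \<le> j + c *\<^sub>R x}"
    have "lattice_ideal ?K"
      unfolding lattice_ideal_def
    proof (intro conjI ballI allI impI)
      have "0 \<in> ?K" using lattice_ideal_zero[OF J(1)] by (auto intro!: bexI[of _ 0] exI[of _ 0])
      then show "?K \<noteq> {}" by blast
    next
      fix y y' assume "y \<in> ?K" "y' \<in> ?K"
      then obtain j c j' c' where *: "j \<in> J" "0 \<le> c" "\<bar>y\<bar> \<le> j + c *\<^sub>R x"
        "j' \<in> J" "0 \<le> c'" "\<bar>y'\<bar> \<le> j' + c' *\<^sub>R x" by blast
      have "\<bar>y + y'\<bar> \<le> (j + j') + (c + c') *\<^sub>R x"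
        using order_trans[OF abs_triangle_ineq add_mono[OF *(3,6)]]
        by (simp add: algebra_simps)
      then show "y + y' \<in> ?K" using * lattice_ideal_add[OF J(1)] by (auto intro!: bexI[of _ "j + j'"])
          (metis add_nonneg_nonneg)
    qed (auto intro: order_trans)
    moreover have sub: "J \<subseteq> ?K"
    proof
      fix y assume "y \<in> J"
      then have "\<bar>y\<bar> \<in> J" using lattice_ideal_solid[OF J(1), of y "\<bar>y\<bar>"] by simp
      then show "y \<in> ?K" by (auto intro!: bexI[of _ "\<bar>y\<bar>"] exI[of _ 0])
    qed
    moreover have "u \<notin> ?K" using neg u by (auto simp: abs_of_nonneg)
    moreover have "x \<in> ?K" using x lattice_ideal_zero[OF J(1)]
      by (auto simp: abs_of_nonneg intro!: bexI[of _ 0] exI[of _ 1])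
    ultimately show False using max[of ?K] x J(2) by blast
  qed
  have "x \<in> J \<or> y \<in> J" if xy: "0 \<le> x" "0 \<le> y" "inf x y = 0" for x y
  proof (rule ccontr)
    assume "\<not> ?thesis"
    then obtain j c j' c' where *: "j \<in> J" "0 \<le> c" "u \<le> j + c *\<^sub>R x"
        "j' \<in> J" "0 \<le> c'" "u \<le> j' + c' *\<^sub>R y"
      using dom[of x] dom[of y] xy by blast
    define k where "k = \<bar>j\<bar> + \<bar>j'\<bar>"
    have "\<bar>j\<bar> \<in> J" "\<bar>j'\<bar> \<in> J"
      using * lattice_ideal_solid[OF J(1), of j "\<bar>j\<bar>"] lattice_ideal_solid[OF J(1), of j' "\<bar>j'\<bar>"] by auto
    then have k: "k \<in> J" unfolding k_def by (rule lattice_ideal_add[OF J(1)])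
    define b where "b = c + c' + 1"
    have b: "b > 0" "c \<le> b" "c' \<le> b" using * by (auto simp: b_def)
    have jk: "j \<le> k" "j' \<le> k"
      unfolding k_def by (auto intro: order_trans[OF abs_ge_self])
    have "u \<le> k + b *\<^sub>R x"
      using *(3) by (rule order_trans) (intro add_mono jk scaleR_right_mono b xy)
    moreover have "u \<le> k + b *\<^sub>R y"
      using *(6) by (rule order_trans) (intro add_mono jk scaleR_right_mono b xy)
    ultimately have "u \<le> inf (k + b *\<^sub>R x) (k + b *\<^sub>R y)" by simp
    also have "\<dots> = k + b *\<^sub>R inf x y"
      by (simp add: scaleR_inf_distrib[OF b(1)] add_inf_distrib_left)
    finally have "u \<le> k" using xy by simp
    then show False using lattice_ideal_nonneg_le[OF J(1) k u] J(3) by blast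
  qed
  then show thesis using that J by blast
qed

text \<open>
  A prime ideal decides for each \<open>x\<close> and each real \<open>a\<close> whether \<open>x\<close> lies above (\<open>N a x\<close>) or below
  (\<open>M a x\<close>) the multiple \<open>a u\<close>. These decisions form a Dedekind cut, and the real number that it
  defines depends on \<open>x\<close> as a lattice homomorphism.
\<close>

lemma character_of_prime_ideal:
  fixes u :: "'a::banach_lattice"
  assumes J: "lattice_ideal J" "u \<notin> J" and u: "0 \<le> u"
    and prime: "\<And>x y. 0 \<le> x \<Longrightarrow> 0 \<le> y \<Longrightarrow> inf x y = 0 \<Longrightarrow> x \<in> J \<or> y \<in> J"
  obtains \<phi> where "character u \<phi>"
    "\<And>a x. x \<in> principal_ideal u \<Longrightarrow> sup (a *\<^sub>R u - x) 0 \<in> J \<Longrightarrow> a \<le> \<phi> x"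
proof -
  define N where "N a x \<longleftrightarrow> sup (a *\<^sub>R u - x) 0 \<in> J" for a x
  define M where "M a x \<longleftrightarrow> sup (x - a *\<^sub>R u) 0 \<in> J" for a x
  have le: "y \<in> J" if "x \<in> J" "0 \<le> y" "y \<le> x" for x y
    using lattice_ideal_nonneg_le[OF J(1)] that by blast
  have NM: "N a x \<or> M a x" for a x
    using prime[of "sup (a *\<^sub>R u - x) 0" "sup (x - a *\<^sub>R u) 0"] disjoint_pos_neg[of "a *\<^sub>R u - x"]
    by (simp add: N_def M_def)
  have cut: "a \<le> b" if "N a x" "M b x" for a b x
  proof (rule ccontr)
    assume ab: "\<not> a \<le> b"
    have "(a - b) *\<^sub>R u = (a *\<^sub>R u - x) + (x - b *\<^sub>R u)" by (simp add: algebra_simps)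
    also have "\<dots> \<le> sup (a *\<^sub>R u - x) 0 + sup (x - b *\<^sub>R u) 0" by (intro add_mono) auto
    finally have "(a - b) *\<^sub>R u \<le> sup (a *\<^sub>R u - x) 0 + sup (x - b *\<^sub>R u) 0" .
    moreover have "sup (a *\<^sub>R u - x) 0 + sup (x - b *\<^sub>R u) 0 \<in> J"
      using that unfolding N_def M_def by (intro lattice_ideal_add[OF J(1)])
    moreover have "0 \<le> (a - b) *\<^sub>R u" using ab u by (intro scaleR_nonneg_nonneg) auto
    ultimately have "(a - b) *\<^sub>R u \<in> J" using le by blast
    then have "inverse (a - b) *\<^sub>R (a - b) *\<^sub>R u \<in> J" by (rule lattice_ideal_scaleR[OF J(1)])
    then show False using ab J(2) by simp
  qed
  define \<phi> where "\<phi> x = Sup {a. N a x}" for x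
  have Nne: "N (- c) x" "M c x" if "\<bar>x\<bar> \<le> c *\<^sub>R u" for c x
  proof -
    have "x \<le> c *\<^sub>R u" "- x \<le> c *\<^sub>R u"
      using that abs_ge_self[of x] abs_ge_minus_self[of x] by (auto intro: order_trans)
    then have "(- c) *\<^sub>R u - x \<le> 0" "x - c *\<^sub>R u \<le> 0"
      by (auto simp: algebra_simps minus_le_iff)
    then have "sup ((- c) *\<^sub>R u - x) 0 = 0" "sup (x - c *\<^sub>R u) 0 = 0" by (auto intro: sup_absorb2)
    then show "N (- c) x" "M c x"
      using lattice_ideal_zero[OF J(1)] unfolding N_def M_def by auto
  qed
  have bdd: "bdd_above {a. N a x}" "{a. N a x} \<noteq> {}" if "x \<in> principal_ideal u" for x
  proof -
    obtain c where c: "\<bar>x\<bar> \<le> c *\<^sub>R u" using \<open>x \<in> _\<close> by (auto simp: principal_ideal_def)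
    show "bdd_above {a. N a x}" using cut[OF _ Nne(2)[OF c]] by (auto simp: bdd_above_def)
    show "{a. N a x} \<noteq> {}" using Nne(1)[OF c] by blast
  qed
  have N_le: "a \<le> \<phi> x" if "x \<in> principal_ideal u" "N a x" for a x
    unfolding \<phi>_def using bdd that by (intro cSup_upper) auto
  have M_ge: "\<phi> x \<le> a" if "x \<in> principal_ideal u" "M a x" for a x
    unfolding \<phi>_def using bdd that cut by (intro cSup_least) auto
  have N_lt: "N a x" if "x \<in> principal_ideal u" "a < \<phi> x" for a x
    using NM[of a x] M_ge[OF that(1), of a] that by linarith
  have M_gt: "M a x" if "x \<in> principal_ideal u" "\<phi> x < a" for a x
    using NM[of a x] N_le[OF that(1), of a] that by linarith
  have N_add: "N (a + b) (x + y)" if "N a x" "N b y" for a b x y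
    unfolding N_def
  proof (rule le)
    show "sup (a *\<^sub>R u - x) 0 + sup (b *\<^sub>R u - y) 0 \<in> J"
      using that lattice_ideal_add[OF J(1)] by (simp add: N_def)
    have "(a + b) *\<^sub>R u - (x + y) = (a *\<^sub>R u - x) + (b *\<^sub>R u - y)" by (simp add: algebra_simps)
    also have "\<dots> \<le> sup (a *\<^sub>R u - x) 0 + sup (b *\<^sub>R u - y) 0" by (intro add_mono) auto
    finally show "sup ((a + b) *\<^sub>R u - (x + y)) 0 \<le> sup (a *\<^sub>R u - x) 0 + sup (b *\<^sub>R u - y) 0"
      by (simp add: add_nonneg_nonneg)
  qed simp
  have M_N: "M a x \<longleftrightarrow> N (- a) (- x)" for a x
    by (simp add: M_def N_def)
  have \<phi>_uminus: "\<phi> (- x) = - \<phi> x" if "x \<in> principal_ideal u" for x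
  proof (rule antisym)
    have x: "- x \<in> principal_ideal u" using that by (rule principal_ideal_uminus)
    show "\<phi> (- x) \<le> - \<phi> x"
    proof (rule dense_ge)
      fix a assume "- \<phi> x < a"
      then have "N (- a) x" using N_lt that by simp
      then have "M a (- x)" by (simp add: M_N)
      then show "\<phi> (- x) \<le> a" by (rule M_ge[OF x])
    qed
    show "- \<phi> x \<le> \<phi> (- x)"
    proof (rule dense_le)
      fix a assume "a < - \<phi> x"
      then have "M (- a) x" using M_gt that by simp
      then have "N a (- x)" by (simp add: M_N)
      then show "a \<le> \<phi> (- x)" by (rule N_le[OF x])
    qed
  qed
  have superadd: "\<phi> x + \<phi> y \<le> \<phi> (x + y)" if "x \<in> principal_ideal u" "y \<in> principal_ideal u" for x y
  proof (rule field_le_epsilon)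
    fix e :: real assume "0 < e"
    then have "N (\<phi> x - e/2) x" "N (\<phi> y - e/2) y" using N_lt that by auto
    from N_le[OF principal_ideal_add[OF that] N_add[OF this]]
    show "\<phi> x + \<phi> y \<le> \<phi> (x + y) + e" by simp
  qed
  have add: "\<phi> (x + y) = \<phi> x + \<phi> y" if "x \<in> principal_ideal u" "y \<in> principal_ideal u" for x y
  proof (rule antisym)
    show "\<phi> (x + y) \<le> \<phi> x + \<phi> y"
      using superadd[of "- x" "- y"] that principal_ideal_add[OF that]
        \<phi>_uminus[of x] \<phi>_uminus[of y] \<phi>_uminus[of "x + y"]
      by (simp add: principal_ideal_uminus)
  qed (rule superadd[OF that])
  have N_scale: "N (c * a) (c *\<^sub>R x)" if "N a x" "0 < c" for a c x
  proof -
    have "sup ((c * a) *\<^sub>R u - c *\<^sub>R x) 0 = c *\<^sub>R sup (a *\<^sub>R u - x) 0"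
      using scaleR_sup_distrib[OF that(2), of "a *\<^sub>R u - x" 0] by (simp add: algebra_simps)
    then show ?thesis using that lattice_ideal_scaleR[OF J(1)] by (simp add: N_def)
  qed
  have scale_ge: "c * \<phi> x \<le> \<phi> (c *\<^sub>R x)" if "x \<in> principal_ideal u" "0 < c" for c x
  proof (rule dense_le)
    fix a assume "a < c * \<phi> x"
    then have "a / c < \<phi> x" using that by (simp add: divide_less_eq mult.commute)
    from N_scale[OF N_lt[OF that(1) this] that(2)] have "N a (c *\<^sub>R x)" using that by simp
    then show "a \<le> \<phi> (c *\<^sub>R x)" by (rule N_le[OF principal_ideal_scaleR[OF that(1)]])
  qed
  have scale_pos: "\<phi> (c *\<^sub>R x) = c * \<phi> x" if "x \<in> principal_ideal u" "0 < c" for c x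
    using scale_ge[OF that] scale_ge[of "- x" c] that \<phi>_uminus[of x] \<phi>_uminus[of "c *\<^sub>R x"]
    by (simp add: principal_ideal_uminus principal_ideal_scaleR)
  have scale: "\<phi> (c *\<^sub>R x) = c * \<phi> x" if x: "x \<in> principal_ideal u" for c x
  proof -
    have "\<phi> 0 = 0" using add[of x "- x"] x \<phi>_uminus[OF x] by (simp add: principal_ideal_uminus)
    moreover have "\<phi> (c *\<^sub>R x) = c * \<phi> x" if "c < 0"
      using scale_pos[of "- x" "- c"] that x \<phi>_uminus[OF x] by (simp add: principal_ideal_uminus)
    ultimately show ?thesis using scale_pos[OF x] by (cases c "0::real" rule: linorder_cases) auto
  qed
  have sup: "\<phi> (sup x y) = max (\<phi> x) (\<phi> y)" if xy: "x \<in> principal_ideal u" "y \<in> principal_ideal u" for x y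
  proof (rule antisym)
    have s: "sup x y \<in> principal_ideal u" using xy by (rule principal_ideal_sup)
    show "\<phi> (sup x y) \<le> max (\<phi> x) (\<phi> y)"
    proof (rule dense_ge)
      fix a assume "max (\<phi> x) (\<phi> y) < a"
      then have *: "M a x" "M a y" using M_gt xy by auto
      have "M a (sup x y)"
        unfolding M_def
      proof (rule le)
        show "sup (x - a *\<^sub>R u) 0 + sup (y - a *\<^sub>R u) 0 \<in> J"
          using * lattice_ideal_add[OF J(1)] by (simp add: M_def)
        have "x - a *\<^sub>R u \<le> sup (x - a *\<^sub>R u) 0 + sup (y - a *\<^sub>R u) 0"
          using add_mono[of "x - a *\<^sub>R u" "sup (x - a *\<^sub>R u) 0" 0 "sup (y - a *\<^sub>R u) 0"] by simp
        moreover have "y - a *\<^sub>R u \<le> sup (x - a *\<^sub>R u) 0 + sup (y - a *\<^sub>R u) 0"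
          using add_mono[of 0 "sup (x - a *\<^sub>R u) 0" "y - a *\<^sub>R u" "sup (y - a *\<^sub>R u) 0"] by simp
        ultimately have "sup x y \<le> a *\<^sub>R u + (sup (x - a *\<^sub>R u) 0 + sup (y - a *\<^sub>R u) 0)"
          by (simp add: diff_le_eq add.commute)
        then show "sup (sup x y - a *\<^sub>R u) 0 \<le> sup (x - a *\<^sub>R u) 0 + sup (y - a *\<^sub>R u) 0"
          by (simp add: diff_le_eq add.commute)
      qed simp
      then show "\<phi> (sup x y) \<le> a" by (rule M_ge[OF s])
    qed
    have mono: "N a (sup x y)" if "N a x \<or> N a y" for a
    proof -
      have *: "a *\<^sub>R u - sup x y \<le> a *\<^sub>R u - x" "a *\<^sub>R u - sup x y \<le> a *\<^sub>R u - y"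
        by (intro diff_left_mono sup_ge1 sup_ge2)+
      then have "sup (a *\<^sub>R u - sup x y) 0 \<le> sup (a *\<^sub>R u - x) 0"
        "sup (a *\<^sub>R u - sup x y) 0 \<le> sup (a *\<^sub>R u - y) 0"
        using sup_mono[OF *(1) order_refl] sup_mono[OF *(2) order_refl] by simp_all
      then show ?thesis using that le unfolding N_def by (meson sup_ge2)
    qed
    show "max (\<phi> x) (\<phi> y) \<le> \<phi> (sup x y)"
    proof (rule dense_le)
      fix a assume "a < max (\<phi> x) (\<phi> y)"
      then have "N a x \<or> N a y" using N_lt xy by (auto simp: less_max_iff_disj)
      from N_le[OF s mono[OF this]] show "a \<le> \<phi> (sup x y)" .
    qed
  qed
  have "\<phi> u = 1"
  proof (rule antisym)
    have "M 1 u" "N 1 u" using lattice_ideal_zero[OF J(1)] by (auto simp: M_def N_def)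
    then show "\<phi> u \<le> 1" "1 \<le> \<phi> u"
      using M_ge N_le principal_ideal_self[OF u] by auto
  qed
  then have "character u \<phi>"
    unfolding character_def using add scale sup u by blast
  then show thesis using that N_le unfolding N_def by blast
qed

text \<open>
  If \<open>w\<close> is not below 0 then, by the Archimedean property, it is not below some \<open>e u\<close>. Any prime
  ideal that contains the positive part of \<open>e u - w\<close> and misses \<open>u\<close> gives a character whose
  value at \<open>w\<close> is at least \<open>e\<close>.
\<close>

lemma characters_detect_order:
  fixes u w :: "'a::banach_lattice"
  assumes u: "0 \<le> u" and w: "w \<in> principal_ideal u"
    and pos: "\<And>\<phi>. character u \<phi> \<Longrightarrow> \<phi> w \<le> 0"
  shows "w \<le> 0"
proof (rule ccontr)
  assume "\<not> w \<le> 0"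
  then obtain e where e: "0 < e" "\<not> w \<le> e *\<^sub>R u"
    using archimedean_le by blast
  define a where "a = sup (w - e *\<^sub>R u) 0"
  define b where "b = sup (e *\<^sub>R u - w) 0"
  have ab: "0 \<le> a" "0 \<le> b" "inf a b = 0"
    using disjoint_pos_neg[of "w - e *\<^sub>R u"] by (auto simp: a_def b_def)
  have "u \<notin> principal_ideal b"
  proof
    assume "u \<in> principal_ideal b"
    then obtain c where c: "0 \<le> c" "u \<le> c *\<^sub>R b"
      using u by (auto simp: principal_ideal_def abs_of_nonneg)
    obtain K where K: "0 \<le> K" "\<bar>w\<bar> \<le> K *\<^sub>R u" using w by (auto simp: principal_ideal_def)
    have "w - e *\<^sub>R u \<le> w" using e u by (simp add: scaleR_nonneg_nonneg)
    also have "w \<le> K *\<^sub>R u" using K order_trans[OF abs_ge_self] by blast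
    also have "\<dots> \<le> K *\<^sub>R (c *\<^sub>R b)" using K c by (intro scaleR_left_mono)
    also have "\<dots> \<le> (K * c + 1) *\<^sub>R b" using ab by (simp add: scaleR_add_left)
    finally have "a \<le> (K * c + 1) *\<^sub>R b"
      using ab K c by (simp add: a_def scaleR_nonneg_nonneg)
    moreover have "a \<le> (K * c + 1) *\<^sub>R a"
      using ab K c by (simp add: scaleR_add_left scaleR_nonneg_nonneg)
    ultimately have "a \<le> (K * c + 1) *\<^sub>R inf a b"
      using K c by (subst scaleR_inf_distrib) (auto intro: add_nonneg_pos)
    then have "a \<le> 0" using ab by simp
    then have "w - e *\<^sub>R u \<le> 0" unfolding a_def using order_trans[OF sup_ge1] by blast
    then show False using e by simp
  qed
  from ex_prime_ideal[OF lattice_ideal_principal[OF ab(2)] this u]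
  obtain J where J: "lattice_ideal J" "principal_ideal b \<subseteq> J" "u \<notin> J"
    "\<And>x y. 0 \<le> x \<Longrightarrow> 0 \<le> y \<Longrightarrow> inf x y = 0 \<Longrightarrow> x \<in> J \<or> y \<in> J" by blast
  obtain \<phi> where "character u \<phi>"
    "\<And>a x. x \<in> principal_ideal u \<Longrightarrow> sup (a *\<^sub>R u - x) 0 \<in> J \<Longrightarrow> a \<le> \<phi> x"
    using character_of_prime_ideal[OF J(1,3) u J(4)] by blast
  moreover have "sup (e *\<^sub>R u - w) 0 \<in> J"
    using J(2) principal_ideal_self[OF ab(2)] by (auto simp: b_def)
  ultimately show False using pos w e by (meson not_less order_trans)
qed

lemma le_if_characters_le:
  fixes u x y :: "'a::banach_lattice"
  assumes "0 \<le> u" "x \<in> principal_ideal u" "y \<in> principal_ideal u"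
    and "\<And>\<phi>. character u \<phi> \<Longrightarrow> \<phi> x \<le> \<phi> y"
  shows "x \<le> y"
proof -
  have "x - y \<le> 0"
  proof (rule characters_detect_order[OF assms(1)])
    show "x - y \<in> principal_ideal u" using assms by (simp add: principal_ideal_diff)
    fix \<phi> :: "'a \<Rightarrow> real" assume c: "character u \<phi>"
    have "\<phi> (x + (- 1) *\<^sub>R y) = \<phi> x + (- 1) * \<phi> y"
      using c assms principal_ideal_scaleR[OF assms(3), of "-1"] unfolding character_def by metis
    then show "\<phi> (x - y) \<le> 0" using assms(4)[OF c] by simp
  qed
  then show ?thesis by simp
qed

section \<open>Evaluating the complexification by characters\<close>

lemma characterD:
  assumes "character u \<phi>"
  shows character_add: "x \<in> principal_ideal u \<Longrightarrow> y \<in> principal_ideal u \<Longrightarrow> \<phi> (x + y) = \<phi> x + \<phi> y"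
    and character_scaleR: "x \<in> principal_ideal u \<Longrightarrow> \<phi> (c *\<^sub>R x) = c * \<phi> x"
    and character_sup: "x \<in> principal_ideal u \<Longrightarrow> y \<in> principal_ideal u \<Longrightarrow> \<phi> (sup x y) = max (\<phi> x) (\<phi> y)"
    and character_uminus: "x \<in> principal_ideal u \<Longrightarrow> \<phi> (- x) = - \<phi> x"
    and character_diff: "x \<in> principal_ideal u \<Longrightarrow> y \<in> principal_ideal u \<Longrightarrow> \<phi> (x - y) = \<phi> x - \<phi> y"
    and character_inf: "x \<in> principal_ideal u \<Longrightarrow> y \<in> principal_ideal u \<Longrightarrow> \<phi> (inf x y) = min (\<phi> x) (\<phi> y)"
    and character_mono: "x \<in> principal_ideal u \<Longrightarrow> y \<in> principal_ideal u \<Longrightarrow> x \<le> y \<Longrightarrow> \<phi> x \<le> \<phi> y"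
    and character_abs: "x \<in> principal_ideal u \<Longrightarrow> \<phi> \<bar>x\<bar> = \<bar>\<phi> x\<bar>"
proof -
  show add: "\<phi> (x + y) = \<phi> x + \<phi> y" if "x \<in> principal_ideal u" "y \<in> principal_ideal u" for x y
    using assms that by (simp add: character_def)
  show scale: "\<phi> (c *\<^sub>R x) = c * \<phi> x" if "x \<in> principal_ideal u" for c x
    using assms that by (simp add: character_def)
  show sup: "\<phi> (sup x y) = max (\<phi> x) (\<phi> y)" if "x \<in> principal_ideal u" "y \<in> principal_ideal u" for x y
    using assms that by (simp add: character_def)
  show um: "\<phi> (- x) = - \<phi> x" if "x \<in> principal_ideal u" for x
    using scale[OF that, of "-1"] by simp
  show "\<phi> (x - y) = \<phi> x - \<phi> y" if "x \<in> principal_ideal u" "y \<in> principal_ideal u" for x y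
    using add[of x "- y"] um[of y] that by (simp add: principal_ideal_uminus)
  show "\<phi> (inf x y) = min (\<phi> x) (\<phi> y)" if "x \<in> principal_ideal u" "y \<in> principal_ideal u" for x y
  proof -
    have "\<phi> (inf x y) = - \<phi> (sup (- x) (- y))"
      unfolding inf_eq_neg_sup using that
      by (intro um principal_ideal_sup principal_ideal_uminus)
    then show ?thesis using that by (simp add: sup um principal_ideal_uminus min_def max_def)
  qed
  show "\<phi> x \<le> \<phi> y" if "x \<in> principal_ideal u" "y \<in> principal_ideal u" "x \<le> y" for x y
    using sup[OF that(1,2)] that(3) by (simp add: sup_absorb2)
  show "\<phi> \<bar>x\<bar> = \<bar>\<phi> x\<bar>" if "x \<in> principal_ideal u" for x
    using sup[of x "- x"] um[OF that] that by (simp add: abs_lattice principal_ideal_uminus sup_max)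
qed

lemma in_principal_ideal_if_le_modulus:
  assumes "modulus z \<in> principal_ideal u" "\<bar>w\<bar> \<le> K *\<^sub>R modulus z"
  shows "w \<in> principal_ideal u"
proof (rule principal_ideal_solid)
  show "K *\<^sub>R modulus z \<in> principal_ideal u" using assms(1) by (rule principal_ideal_scaleR)
  show "\<bar>w\<bar> \<le> \<bar>K *\<^sub>R modulus z\<bar>" using assms(2) abs_ge_self order_trans by blast
qed

lemma parts_in_principal_ideal:
  assumes "modulus z \<in> principal_ideal u"
  shows "re_part z \<in> principal_ideal u" "im_part z \<in> principal_ideal u"
  using abs_parts_le_modulus[of z] by (auto intro!: in_principal_ideal_if_le_modulus[OF assms, of _ 1])

lemma modulus_in_principal_ideal:
  assumes "re_part z \<in> principal_ideal u" "im_part z \<in> principal_ideal u"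
  shows "modulus z \<in> principal_ideal u"
proof (rule principal_ideal_solid)
  show "\<bar>re_part z\<bar> + \<bar>im_part z\<bar> \<in> principal_ideal u"
    using assms by (intro principal_ideal_add) (auto intro: principal_ideal_solid)
  show "\<bar>modulus z\<bar> \<le> \<bar>\<bar>re_part z\<bar> + \<bar>im_part z\<bar>\<bar>"
    using modulus_le_abs_parts[of z] by (simp add: abs_of_nonneg modulus_nonneg)
qed

definition complex_value :: "('a::banach_lattice \<Rightarrow> real) \<Rightarrow> 'a complexification \<Rightarrow> complex"
  where "complex_value \<phi> z = Complex (\<phi> (re_part z)) (\<phi> (im_part z))"

lemma complex_value_add:
  assumes "character u \<phi>" "modulus z \<in> principal_ideal u" "modulus w \<in> principal_ideal u"
  shows "complex_value \<phi> (z + w) = complex_value \<phi> z + complex_value \<phi> w"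
  using assms by (simp add: complex_value_def complex_eq_iff parts_in_principal_ideal character_add)

lemma complex_value_diff:
  assumes "character u \<phi>" "modulus z \<in> principal_ideal u" "modulus w \<in> principal_ideal u"
  shows "complex_value \<phi> (z - w) = complex_value \<phi> z - complex_value \<phi> w"
  using assms by (simp add: complex_value_def complex_eq_iff parts_in_principal_ideal character_diff)

lemma complex_value_scaleC:
  assumes "character u \<phi>" "modulus z \<in> principal_ideal u"
  shows "complex_value \<phi> (c *\<^sub>C z) = c * complex_value \<phi> z"
  using assms
  by (simp add: complex_value_def complex_eq_iff parts_in_principal_ideal character_add
      character_diff character_scaleR principal_ideal_scaleR)

lemma rot_eq_re_part: "rot z t = re_part (cis (- t) *\<^sub>C z)"
  by (simp add: rot_def)

text \<open>
  Infima and suprema over the whole circle are not preserved by characters for lattice reasons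
  alone; a finite net reduces them to finite ones up to an error relative to the modulus.
\<close>

lemma circle_net:
  assumes "0 < e"
  obtains D where "finite D" "D \<noteq> {}" "\<And>c. c \<in> D \<Longrightarrow> cmod c = 1"
    "\<And>w. cmod w = 1 \<Longrightarrow> \<exists>c\<in>D. cmod (w - c) \<le> e"
proof -
  have "compact (sphere (0::complex) 1)" by simp
  then obtain D where D: "finite D" "D \<subseteq> sphere 0 1" "sphere (0::complex) 1 \<subseteq> (\<Union>c\<in>D. ball c e)"
    using compactE_image[of "sphere (0::complex) 1" "sphere 0 1" "\<lambda>c. ball c e"] assms
    by (metis UN_I centre_in_ball open_ball subsetI)
  have "D \<noteq> {}" using D(3) by force
  moreover have "\<exists>c\<in>D. cmod (w - c) \<le> e" if w: "cmod w = 1" for w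
  proof -
    have "w \<in> sphere 0 1" using w by simp
    then obtain c where "c \<in> D" "dist c w < e" using D(3) by auto
    then show ?thesis by (auto simp: dist_norm norm_minus_commute intro!: bexI[of _ c])
  qed
  moreover have "cmod c = 1" if "c \<in> D" for c using D(2) that by auto
  ultimately show thesis using that[of D] D(1) by blast
qed

lemma re_part_scaleC_le: "re_part (c *\<^sub>C z) \<le> cmod c *\<^sub>R modulus z"
  using abs_parts_le_modulus(1)[of "c *\<^sub>C z"] abs_ge_self order_trans
  unfolding modulus_scaleC by blast

lemma character_modulus:
  fixes z :: "'a::banach_lattice complexification"
  assumes \<phi>: "character u \<phi>" and z: "modulus z \<in> principal_ideal u"
  shows "\<phi> (modulus z) = cmod (complex_value \<phi> z)"
proof (rule antisym)
  let ?\<zeta> = "complex_value \<phi> z"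
  have rc: "re_part (c *\<^sub>C z) \<in> principal_ideal u" for c
    by (rule parts_in_principal_ideal) (simp add: modulus_scaleC z principal_ideal_scaleR)
  have val: "\<phi> (re_part (c *\<^sub>C z)) = Re (c * ?\<zeta>)" for c
    using complex_value_scaleC[OF \<phi> z, of c] by (metis complex_value_def complex.sel(1))
  have "cmod ?\<zeta> = Re (cis (- Arg ?\<zeta>) * ?\<zeta>)"
  proof -
    have "cis (- Arg ?\<zeta>) * ?\<zeta> = of_real (cmod ?\<zeta>) * (cis (- Arg ?\<zeta>) * cis (Arg ?\<zeta>))"
      using rcis_cmod_Arg[of ?\<zeta>] by (simp add: rcis_def algebra_simps)
    then show ?thesis by (simp add: cis_mult)
  qed
  also have "\<dots> = \<phi> (rot z (Arg ?\<zeta>))" by (simp only: val rot_eq_re_part)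
  also have "\<dots> \<le> \<phi> (modulus z)"
    by (rule character_mono[OF \<phi> _ z rot_le_modulus]) (simp only: rot_eq_re_part rc)
  finally show "cmod ?\<zeta> \<le> \<phi> (modulus z)" .
  show "\<phi> (modulus z) \<le> cmod ?\<zeta>"
  proof (rule ccontr)
    assume neg: "\<not> \<phi> (modulus z) \<le> cmod ?\<zeta>"
    define e where "e = (\<phi> (modulus z) - cmod ?\<zeta>) / (2 * \<phi> (modulus z))"
    have pos: "0 < \<phi> (modulus z)" using neg by (smt (verit) norm_ge_zero)
    then have e: "0 < e" using neg by (simp add: e_def)
    obtain D where D: "finite D" "D \<noteq> {}" "\<And>c. c \<in> D \<Longrightarrow> cmod c = 1"
      "\<And>w. cmod w = 1 \<Longrightarrow> \<exists>c\<in>D. cmod (w - c) \<le> e"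
      using circle_net[OF e] by blast
    let ?S = "\<lambda>D. Sup_fin ((\<lambda>c. re_part (c *\<^sub>C z)) ` D)"
    \<comment> \<open>A character commutes with the finite supremum over \<open>D\<close>, which is within \<open>e |z|\<close> of \<open>|z|\<close>.\<close>
    have "modulus z \<le> ?S D + e *\<^sub>R modulus z"
    proof (rule modulus_least)
      fix t
      obtain c where c: "c \<in> D" "cmod (cis (- t) - c) \<le> e" using D(4)[of "cis (- t)"] by auto
      have "rot z t = re_part (c *\<^sub>C z) + re_part ((cis (- t) - c) *\<^sub>C z)"
        by (simp add: rot_def algebra_simps)
      also have "\<dots> \<le> ?S D + e *\<^sub>R modulus z"
      proof (rule add_mono)
        show "re_part (c *\<^sub>C z) \<le> ?S D" using D c by (intro Sup_fin.coboundedI) auto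
        show "re_part ((cis (- t) - c) *\<^sub>C z) \<le> e *\<^sub>R modulus z"
          by (rule order_trans[OF re_part_scaleC_le]) (intro scaleR_right_mono c modulus_nonneg)
      qed
      finally show "rot z t \<le> ?S D + e *\<^sub>R modulus z" .
    qed
    moreover have "?S D \<in> principal_ideal u \<and> \<phi> (?S D) \<le> cmod ?\<zeta>"
      using D(1-3)
    proof (induction D rule: finite_ne_induct)
      case (singleton c)
      then show ?case using complex_Re_le_cmod[of "c * ?\<zeta>"] by (simp only: image_insert image_empty Sup_fin.singleton val rc norm_mult) simp
    next
      case (insert c D)
      have "Re (c * ?\<zeta>) \<le> cmod ?\<zeta>"
        using complex_Re_le_cmod[of "c * ?\<zeta>"] insert.prems[of c] by (simp only: norm_mult insertI1 mult_1)
      moreover have "?S (insert c D) = sup (re_part (c *\<^sub>C z)) (?S D)"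
        using insert.hyps by (simp only: image_insert) (subst Sup_fin.insert; simp)
      moreover have "?S D \<in> principal_ideal u" "\<phi> (?S D) \<le> cmod ?\<zeta>"
        using insert.IH insert.prems by blast+
      ultimately show ?case
        by (simp only: principal_ideal_sup rc character_sup[OF \<phi>] val max.bounded_iff simp_thms)
    qed
    ultimately have "\<phi> (modulus z) \<le> cmod ?\<zeta> + e * \<phi> (modulus z)"
      using character_mono[OF \<phi> z, of "?S D + e *\<^sub>R modulus z"]
      by (simp add: principal_ideal_add principal_ideal_scaleR z character_add[OF \<phi>] character_scaleR[OF \<phi>])
    then show False using neg pos by (simp add: e_def field_simps)
  qed
qed

section \<open>Homogeneous functions of a vector\<close>

text \<open>
  The vector \<open>w\<close> is the value at \<open>z\<close> of the positively homogeneous function \<open>h\<close>, in the sense of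
  the Krivine functional calculus. The first conjunct places \<open>w\<close> in every principal ideal that
  contains the modulus of \<open>z\<close>.
\<close>

definition represents :: "'a::banach_lattice complexification \<Rightarrow> 'a \<Rightarrow> (complex \<Rightarrow> real) \<Rightarrow> bool"
  where "represents z w h \<longleftrightarrow> (\<exists>K. \<bar>w\<bar> \<le> K *\<^sub>R modulus z) \<and>
    (\<forall>u \<phi>. character u \<phi> \<longrightarrow> modulus z \<in> principal_ideal u \<longrightarrow> \<phi> w = h (complex_value \<phi> z))"

lemma represents_in_ideal:
  "represents z w h \<Longrightarrow> modulus z \<in> principal_ideal u \<Longrightarrow> w \<in> principal_ideal u"
  unfolding represents_def using in_principal_ideal_if_le_modulus by blast

lemma represents_value:
  "represents z w h \<Longrightarrow> modulus z \<in> principal_ideal u \<Longrightarrow> character u \<phi> \<Longrightarrow> \<phi> w = h (complex_value \<phi> z)"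
  unfolding represents_def by blast

lemma represents_linear:
  "represents z (a *\<^sub>R modulus z + re_part (b *\<^sub>C z)) (\<lambda>\<zeta>. a * cmod \<zeta> + Re (b * \<zeta>))"
  unfolding represents_def
proof (intro conjI exI allI impI)
  have "\<bar>re_part (b *\<^sub>C z)\<bar> \<le> cmod b *\<^sub>R modulus z"
    using abs_parts_le_modulus(1)[of "b *\<^sub>C z"] unfolding modulus_scaleC .
  then have "\<bar>a *\<^sub>R modulus z + re_part (b *\<^sub>C z)\<bar> \<le> \<bar>a\<bar> *\<^sub>R modulus z + cmod b *\<^sub>R modulus z"
    by (intro order_trans[OF abs_triangle_ineq] add_mono)
      (simp_all add: abs_scaleR_lattice abs_of_nonneg modulus_nonneg)
  then show "\<bar>a *\<^sub>R modulus z + re_part (b *\<^sub>C z)\<bar> \<le> (\<bar>a\<bar> + cmod b) *\<^sub>R modulus z"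
    by (simp add: scaleR_add_left)
next
  fix u \<phi> assume \<phi>: "character u \<phi>" and z: "modulus z \<in> principal_ideal u"
  have bz: "re_part (b *\<^sub>C z) \<in> principal_ideal u"
    by (rule parts_in_principal_ideal) (simp add: modulus_scaleC z principal_ideal_scaleR)
  have val: "\<phi> (re_part (b *\<^sub>C z)) = Re (b * complex_value \<phi> z)"
    using complex_value_scaleC[OF \<phi> z, of b] by (metis complex_value_def complex.sel(1))
  show "\<phi> (a *\<^sub>R modulus z + re_part (b *\<^sub>C z)) =
      a * cmod (complex_value \<phi> z) + Re (b * complex_value \<phi> z)"
    by (simp only: character_add[OF \<phi>] character_scaleR[OF \<phi>] character_modulus[OF \<phi> z] z bz val
        principal_ideal_scaleR)
qed

lemma represents_inf:
  assumes "represents z w h" "represents z w' h'"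
  shows "represents z (inf w w') (\<lambda>\<zeta>. min (h \<zeta>) (h' \<zeta>))"
  unfolding represents_def
proof (intro conjI allI impI)
  have m: "modulus z \<in> principal_ideal (modulus z)" by (simp add: principal_ideal_self modulus_nonneg)
  have "inf w w' \<in> principal_ideal (modulus z)"
    using assms by (intro principal_ideal_inf represents_in_ideal[OF _ m])
  then show "\<exists>K. \<bar>inf w w'\<bar> \<le> K *\<^sub>R modulus z" by (auto simp: principal_ideal_def)
next
  fix u \<phi> assume *: "character u \<phi>" "modulus z \<in> principal_ideal u"
  show "\<phi> (inf w w') = min (h (complex_value \<phi> z)) (h' (complex_value \<phi> z))"
    using * assms by (simp add: character_inf represents_in_ideal represents_value)
qed

lemma represents_Min:
  assumes "finite D" "D \<noteq> {}" "\<And>c. c \<in> D \<Longrightarrow> \<exists>w. represents z w (h c)"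
  shows "\<exists>w. represents z w (\<lambda>\<zeta>. Min ((\<lambda>c. h c \<zeta>) ` D))"
  using assms
proof (induction D rule: finite_ne_induct)
  case (singleton c)
  then show ?case by simp
next
  case (insert c D)
  then obtain w w' where "represents z w (h c)" "represents z w' (\<lambda>\<zeta>. Min ((\<lambda>c. h c \<zeta>) ` D))" by blast
  from represents_inf[OF this] show ?case using insert.hyps by auto
qed

text \<open>
  Characters turn an error estimate between functions into an order estimate relative to the
  modulus of \<open>z\<close>, hence into a norm estimate, so approximations form a Cauchy sequence.
\<close>

lemma represents_limit:
  fixes z :: "'a::banach_lattice complexification"
  assumes "\<And>e. 0 < e \<Longrightarrow> \<exists>w h'. represents z w h' \<and> (\<forall>\<zeta>. \<bar>h' \<zeta> - h \<zeta>\<bar> \<le> e * cmod \<zeta>)"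
  shows "\<exists>w. represents z w h"
proof -
  define \<epsilon> where "\<epsilon> n = inverse (real (Suc n))" for n
  have \<epsilon>: "0 < \<epsilon> n" for n by (simp add: \<epsilon>_def)
  have \<epsilon>0: "\<epsilon> \<longlonglongrightarrow> 0" unfolding \<epsilon>_def by (rule LIMSEQ_inverse_real_of_nat)
  have "\<exists>w h'. represents z w h' \<and> (\<forall>\<zeta>. \<bar>h' \<zeta> - h \<zeta>\<bar> \<le> \<epsilon> n * cmod \<zeta>)" for n
    using assms \<epsilon> by blast
  then obtain w H where w: "\<And>n. represents z (w n) (H n)"
    and H: "\<And>n \<zeta>. \<bar>H n \<zeta> - h \<zeta>\<bar> \<le> \<epsilon> n * cmod \<zeta>" by metis
  let ?m = "modulus z"
  have m0: "0 \<le> ?m" by (rule modulus_nonneg)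
  have m: "?m \<in> principal_ideal ?m" by (rule principal_ideal_self[OF m0])
  have wm: "w n \<in> principal_ideal ?m" for n by (rule represents_in_ideal[OF w m])
  have le: "w n - w k \<le> (\<epsilon> n + \<epsilon> k) *\<^sub>R ?m" for n k
  proof (rule le_if_characters_le[OF m0])
    show "w n - w k \<in> principal_ideal ?m" using wm by (intro principal_ideal_diff)
    show "(\<epsilon> n + \<epsilon> k) *\<^sub>R ?m \<in> principal_ideal ?m" using m by (rule principal_ideal_scaleR)
    fix \<phi> :: "'a \<Rightarrow> real" assume \<phi>: "character ?m \<phi>"
    show "\<phi> (w n - w k) \<le> \<phi> ((\<epsilon> n + \<epsilon> k) *\<^sub>R ?m)"
      using H[of n "complex_value \<phi> z"] H[of k "complex_value \<phi> z"]
      by (simp only: character_diff[OF \<phi>] wm character_scaleR[OF \<phi>] m represents_value[OF w m \<phi>]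
          character_modulus[OF \<phi> m]) (simp add: distrib_right abs_le_iff)
  qed
  have dist: "norm (w n - w k) \<le> (\<epsilon> n + \<epsilon> k) * norm ?m" for n k
  proof -
    have "\<bar>w n - w k\<bar> \<le> (\<epsilon> n + \<epsilon> k) *\<^sub>R ?m"
      using le[of n k] le[of k n] by (intro abs_leI) (auto simp: add.commute)
    from norm_le_of_abs_le[OF this] show ?thesis
      using \<epsilon>[of n] \<epsilon>[of k] by simp
  qed
  have "Cauchy w"
  proof (rule metric_CauchyI)
    fix e :: real assume "0 < e"
    have "(\<lambda>n. \<epsilon> n * norm ?m) \<longlonglongrightarrow> 0 * norm ?m" by (intro tendsto_intros \<epsilon>0)
    then have "\<forall>\<^sub>F n in sequentially. \<epsilon> n * norm ?m < e / 2"
      using \<open>0 < e\<close> by (intro order_tendstoD(2)) auto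
    then obtain N where N: "\<And>n. N \<le> n \<Longrightarrow> \<epsilon> n * norm ?m < e / 2"
      by (auto simp: eventually_sequentially)
    show "\<exists>M. \<forall>n\<ge>M. \<forall>k\<ge>M. dist (w n) (w k) < e"
    proof (intro exI allI impI)
      fix n k assume "N \<le> n" "N \<le> k"
      then show "dist (w n) (w k) < e"
        using dist[of n k] N[of n] N[of k] by (simp add: dist_norm algebra_simps)
    qed
  qed
  then obtain x where x: "w \<longlonglongrightarrow> x"
    using Cauchy_convergent convergent_def by blast
  have lim: "(\<lambda>k. (\<epsilon> n + \<epsilon> k) *\<^sub>R ?m) \<longlonglongrightarrow> (\<epsilon> n + 0) *\<^sub>R ?m" for n
    by (intro tendsto_intros \<epsilon>0)
  have "x - w n \<le> \<epsilon> n *\<^sub>R ?m" for n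
    using le_LIMSEQ_banach_lattice[OF tendsto_diff[OF x tendsto_const] lim[of n]] le[of _ n]
    by (simp add: add.commute)
  moreover have "w n - x \<le> \<epsilon> n *\<^sub>R ?m" for n
    using le_LIMSEQ_banach_lattice[OF tendsto_diff[OF tendsto_const x] lim[of n]] le[of n]
    by simp
  ultimately have near: "\<bar>x - w n\<bar> \<le> \<epsilon> n *\<^sub>R ?m" for n
    by (intro abs_leI) auto
  have xm: "x \<in> principal_ideal ?m"
  proof -
    have "x - w 0 \<in> principal_ideal ?m" by (rule in_principal_ideal_if_le_modulus[OF m near])
    from principal_ideal_add[OF this wm[of 0]] show ?thesis by simp
  qed
  have "represents z x h"
    unfolding represents_def
  proof (intro conjI allI impI)
    show "\<exists>K. \<bar>x\<bar> \<le> K *\<^sub>R ?m" using xm by (auto simp: principal_ideal_def)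
  next
    fix u \<phi> assume \<phi>: "character u \<phi>" and z: "?m \<in> principal_ideal u"
    have xu: "x \<in> principal_ideal u" and wu: "w n \<in> principal_ideal u" for n
      using xm in_principal_ideal_if_le_modulus[OF z] represents_in_ideal[OF w z] by (auto simp: principal_ideal_def)
    let ?\<zeta> = "complex_value \<phi> z"
    have "\<bar>\<phi> x - h ?\<zeta>\<bar> \<le> 2 * \<epsilon> n * cmod ?\<zeta>" for n
    proof -
      have "x - w n \<in> principal_ideal u" using xu wu by (rule principal_ideal_diff)
      then have "\<bar>\<phi> (x - w n)\<bar> \<le> \<epsilon> n * cmod ?\<zeta>"
        using character_mono[OF \<phi> _ _ near[of n]] z
        by (simp add: character_abs[OF \<phi>] principal_ideal_scaleR character_scaleR[OF \<phi>]
            character_modulus[OF \<phi>] principal_ideal_solid)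
      then show ?thesis using H[of n ?\<zeta>] xu wu
        by (simp add: character_diff[OF \<phi>] represents_value[OF w z \<phi>] abs_le_iff)
    qed
    moreover have "(\<lambda>n. 2 * \<epsilon> n * cmod ?\<zeta>) \<longlonglongrightarrow> 2 * 0 * cmod ?\<zeta>"
      by (intro tendsto_intros \<epsilon>0)
    ultimately have "\<bar>\<phi> x - h ?\<zeta>\<bar> \<le> 2 * 0 * cmod ?\<zeta>"
      by (intro LIMSEQ_le_const) auto
    then show "\<phi> x = h ?\<zeta>" by simp
  qed
  then show ?thesis ..
qed

section \<open>Powers of the phase\<close>

definition phase_power :: "int \<Rightarrow> complex \<Rightarrow> complex"
  where "phase_power k \<zeta> = of_real (cmod \<zeta>) * sgn \<zeta> powi k"

lemma norm_phase_power: "cmod (phase_power k \<zeta>) = cmod \<zeta>"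
  by (cases "\<zeta> = 0") (auto simp: phase_power_def norm_mult norm_power_int norm_sgn)

definition taylor_bound :: "int \<Rightarrow> real"
  where "taylor_bound k = real_of_int (k\<^sup>2 + \<bar>k\<bar>)"

lemma unimodular_power_taylor:
  fixes w :: complex
  assumes w: "cmod w = 1"
  shows "cmod (w ^ n - 1 - of_nat n * (w - 1)) \<le> (real n)\<^sup>2 * (cmod (w - 1))\<^sup>2"
proof (induction n)
  case (Suc n)
  have lin: "cmod (w ^ n - 1) \<le> real n * cmod (w - 1)" for n
  proof (induction n)
    case (Suc n)
    have "w ^ Suc n - 1 = w * (w ^ n - 1) + (w - 1)" by (simp add: algebra_simps)
    also have "cmod \<dots> \<le> cmod (w ^ n - 1) + cmod (w - 1)"
      by (rule order_trans[OF norm_triangle_ineq]) (simp add: norm_mult w)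
    finally show ?case using Suc by (simp add: algebra_simps)
  qed simp
  have "w ^ Suc n - 1 - of_nat (Suc n) * (w - 1)
      = (w ^ n - 1 - of_nat n * (w - 1)) + (w - 1) * (w ^ n - 1)" by (simp add: algebra_simps)
  also have "cmod \<dots> \<le> (real n)\<^sup>2 * (cmod (w - 1))\<^sup>2 + cmod (w - 1) * (real n * cmod (w - 1))"
    by (intro order_trans[OF norm_triangle_ineq] add_mono Suc)
      (simp add: norm_mult mult_left_mono lin)
  also have "\<dots> = ((real n)\<^sup>2 + real n) * (cmod (w - 1))\<^sup>2"
    by (simp add: power2_eq_square algebra_simps)
  also have "\<dots> \<le> (real (Suc n))\<^sup>2 * (cmod (w - 1))\<^sup>2"
    by (intro mult_right_mono) (auto simp: power2_eq_square algebra_simps)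
  finally show ?case .
qed simp

lemma unimodular_norm_diff:
  assumes "cmod w = 1"
  shows "(cmod (w - 1))\<^sup>2 = 2 - 2 * Re w"
proof -
  have "(cmod (w - 1))\<^sup>2 = (cmod w)\<^sup>2 + 1 - 2 * Re w"
    by (simp only: cmod_power2) (simp add: power2_eq_square algebra_simps)
  then show ?thesis using assms by simp
qed

text \<open>
  The error is linear in \<open>1 - Re w\<close> because \<open>|w - 1|\<^sup>2 = 2 - 2 Re w\<close> on the circle. For negative
  exponents the inverse of \<open>w\<close> is its conjugate, and \<open>w + cnj w - 2\<close> is of the same order.
\<close>

lemma unimodular_powi_taylor:
  assumes w: "cmod w = 1"
  shows "cmod (w powi k - 1 - of_int k * (w - 1)) \<le> taylor_bound k * (2 - 2 * Re w)"
proof (cases "0 \<le> k")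
  case True
  define n where "n = nat k"
  have k: "k = int n" using True by (simp add: n_def)
  have "cmod (w powi k - 1 - of_int k * (w - 1)) \<le> (real n)\<^sup>2 * (cmod (w - 1))\<^sup>2"
    using unimodular_power_taylor[OF w, of n] by (simp add: k)
  also have "\<dots> \<le> taylor_bound k * (cmod (w - 1))\<^sup>2"
    by (intro mult_right_mono) (auto simp: taylor_bound_def k)
  finally show ?thesis by (simp add: unimodular_norm_diff[OF w])
next
  case False
  define n where "n = nat (- k)"
  have k: "k = - int n" using False by (simp add: n_def)
  have cn: "inverse w = cnj w" using w
    by (metis complex_norm_square div_by_1 inverse_unique mult.commute of_real_1 power_one)
  have wc: "cmod (cnj w) = 1" using w by simp
  have s: "of_int k * (w - 1) = - of_nat n * (w - 1)" by (simp add: k)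
  have sumw: "(cnj w - 1) + (w - 1) = - of_real ((cmod (w - 1))\<^sup>2)"
    by (simp add: unimodular_norm_diff[OF w] complex_eq_iff)
  have "w powi k - 1 - of_int k * (w - 1) =
      (cnj w ^ n - 1 - of_nat n * (cnj w - 1)) + of_nat n * ((cnj w - 1) + (w - 1))"
    by (simp add: k power_int_minus power_inverse[symmetric] cn algebra_simps)
  also have "cmod \<dots> \<le> (real n)\<^sup>2 * (cmod (w - 1))\<^sup>2 + real n * (cmod (w - 1))\<^sup>2"
  proof (intro order_trans[OF norm_triangle_ineq] add_mono)
    have "cmod (cnj w - 1) = cmod (w - 1)" by (metis complex_cnj_diff complex_cnj_one complex_mod_cnj)
    then show "cmod (cnj w ^ n - 1 - of_nat n * (cnj w - 1)) \<le> (real n)\<^sup>2 * (cmod (w - 1))\<^sup>2"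
      using unimodular_power_taylor[OF wc, of n] by simp
    show "cmod (of_nat n * ((cnj w - 1) + (w - 1))) \<le> real n * (cmod (w - 1))\<^sup>2"
      unfolding sumw by (simp add: norm_mult norm_power)
  qed
  also have "\<dots> = taylor_bound k * (cmod (w - 1))\<^sup>2"
    by (simp add: taylor_bound_def k algebra_simps)
  finally show ?thesis by (simp add: unimodular_norm_diff[OF w])
qed

text \<open>
  The preceding estimate for \<open>w = sgn \<zeta> / c\<close>: at each direction \<open>c\<close>, the function \<open>phase_power k\<close>
  has a tangent that is real-linear in \<open>|\<zeta>|\<close> and \<open>\<zeta>\<close>, up to a multiple of \<open>|\<zeta>| - Re (\<zeta> / c)\<close>. That
  error bound is itself real-linear in \<open>|\<zeta>|\<close> and \<open>\<zeta>\<close>, so it survives the application of an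
  operator.
\<close>

lemma phase_power_tangent:
  assumes c: "cmod c = 1"
  shows "cmod (phase_power k \<zeta> - c powi k * ((1 - of_int k) * of_real (cmod \<zeta>) + of_int k * (\<zeta> / c)))
    \<le> 2 * taylor_bound k * (cmod \<zeta> - Re (\<zeta> / c))"
proof (cases "\<zeta> = 0")
  case True
  then show ?thesis by (simp add: phase_power_def)
next
  case False
  define w where "w = sgn \<zeta> / c"
  have c0: "c \<noteq> 0" using c by auto
  have w: "cmod w = 1" using False c by (simp add: w_def norm_divide norm_sgn)
  have \<zeta>: "\<zeta> / c = of_real (cmod \<zeta>) * w"
    using False by (simp add: w_def sgn_eq)
  have "phase_power k \<zeta> = of_real (cmod \<zeta>) * (c powi k * w powi k)"
    using c0 by (simp add: phase_power_def w_def power_int_divide_distrib)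
  then have "phase_power k \<zeta> - c powi k * ((1 - of_int k) * of_real (cmod \<zeta>) + of_int k * (\<zeta> / c))
      = of_real (cmod \<zeta>) * c powi k * (w powi k - 1 - of_int k * (w - 1))"
    by (simp add: \<zeta> algebra_simps)
  then have "cmod (phase_power k \<zeta> - c powi k * ((1 - of_int k) * of_real (cmod \<zeta>) + of_int k * (\<zeta> / c)))
      = cmod \<zeta> * cmod (w powi k - 1 - of_int k * (w - 1))"
    by (simp only: norm_mult norm_power_int c) simp
  also have "\<dots> \<le> cmod \<zeta> * (taylor_bound k * (2 - 2 * Re w))"
    by (intro mult_left_mono unimodular_powi_taylor w) simp
  also have "\<dots> = 2 * taylor_bound k * (cmod \<zeta> - Re (\<zeta> / c))"
    by (simp add: \<zeta> algebra_simps)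
  finally show ?thesis .
qed

lemma modulus_add_in_principal_ideal:
  assumes "modulus z \<in> principal_ideal u" "modulus w \<in> principal_ideal u"
  shows "modulus (z + w) \<in> principal_ideal u"
  using assms by (intro modulus_in_principal_ideal)
    (simp_all add: parts_in_principal_ideal principal_ideal_add)

lemma modulus_diff_in_principal_ideal:
  assumes "modulus z \<in> principal_ideal u" "modulus w \<in> principal_ideal u"
  shows "modulus (z - w) \<in> principal_ideal u"
  using assms by (intro modulus_in_principal_ideal)
    (simp_all add: parts_in_principal_ideal principal_ideal_diff)

text \<open>
  Coefficients of \<open>|\<zeta>|\<close> and of \<open>\<zeta>\<close> in the upper tangent of \<open>Re (d phase_power k \<zeta>)\<close> in the
  direction \<open>c\<close>: the tangent of \<open>phase_power_tangent\<close> plus its error bound.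
\<close>

definition tangent_modulus_coeff :: "int \<Rightarrow> complex \<Rightarrow> complex \<Rightarrow> real"
  where "tangent_modulus_coeff k d c = Re (d * c powi k * (1 - of_int k)) + 2 * taylor_bound k"

definition tangent_linear_coeff :: "int \<Rightarrow> complex \<Rightarrow> complex \<Rightarrow> complex"
  where "tangent_linear_coeff k d c = (d * c powi k * of_int k - of_real (2 * taylor_bound k)) / c"

lemma taylor_bound_nonneg: "0 \<le> taylor_bound k"
  by (simp add: taylor_bound_def)

lemma tangent_eq:
  "tangent_modulus_coeff k d c * p + Re (tangent_linear_coeff k d c * \<tau>) =
    Re (d * (c powi k * ((1 - of_int k) * of_real p + of_int k * (\<tau> / c))))
      + 2 * taylor_bound k * (p - Re (\<tau> / c))"
proof -
  have "tangent_linear_coeff k d c * \<tau> =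
      d * c powi k * of_int k * (\<tau> / c) - of_real (2 * taylor_bound k) * (\<tau> / c)"
    by (simp add: tangent_linear_coeff_def diff_divide_distrib algebra_simps)
  then have *: "Re (tangent_linear_coeff k d c * \<tau>) =
      Re (d * c powi k * of_int k * (\<tau> / c)) - 2 * taylor_bound k * Re (\<tau> / c)"
    by (simp only: minus_complex.sel Re_complex_of_real times_complex.sel Im_complex_of_real)
  have "Re (d * c powi k * (1 - of_int k)) * p = Re (d * c powi k * (1 - of_int k) * of_real p)"
    by simp
  moreover have "d * (c powi k * ((1 - of_int k) * of_real p + of_int k * (\<tau> / c))) =
      d * c powi k * (1 - of_int k) * of_real p + d * c powi k * of_int k * (\<tau> / c)"
    by (simp add: algebra_simps)
  ultimately show ?thesis
    by (simp only: tangent_modulus_coeff_def * plus_complex.sel distrib_right right_diff_distrib)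
qed

lemma phase_power_le_tangent:
  assumes "cmod d = 1" "cmod c = 1"
  shows "Re (d * phase_power k \<zeta>) \<le> tangent_modulus_coeff k d c * cmod \<zeta> + Re (tangent_linear_coeff k d c * \<zeta>)"
    and "tangent_modulus_coeff k d c * cmod \<zeta> + Re (tangent_linear_coeff k d c * \<zeta>) \<le>
      Re (d * phase_power k \<zeta>) + 4 * taylor_bound k * (cmod \<zeta> - Re (\<zeta> / c))"
proof -
  define L where "L = c powi k * ((1 - of_int k) * of_real (cmod \<zeta>) + of_int k * (\<zeta> / c))"
  have "\<bar>Re (d * (phase_power k \<zeta> - L))\<bar> \<le> cmod (phase_power k \<zeta> - L)"
    using abs_Re_le_cmod[of "d * (phase_power k \<zeta> - L)"] assms by (simp add: norm_mult)
  also have "\<dots> \<le> 2 * taylor_bound k * (cmod \<zeta> - Re (\<zeta> / c))"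
    unfolding L_def by (rule phase_power_tangent[OF assms(2)])
  finally have "\<bar>Re (d * phase_power k \<zeta>) - Re (d * L)\<bar> \<le> 2 * taylor_bound k * (cmod \<zeta> - Re (\<zeta> / c))"
    by (simp only: right_diff_distrib minus_complex.sel)
  then show "Re (d * phase_power k \<zeta>) \<le> tangent_modulus_coeff k d c * cmod \<zeta> + Re (tangent_linear_coeff k d c * \<zeta>)"
    and "tangent_modulus_coeff k d c * cmod \<zeta> + Re (tangent_linear_coeff k d c * \<zeta>) \<le>
      Re (d * phase_power k \<zeta>) + 4 * taylor_bound k * (cmod \<zeta> - Re (\<zeta> / c))"
    unfolding tangent_eq L_def[symmetric] by linarith+
qed

lemma phase_defect:
  assumes c: "cmod c = 1" and near: "cmod (sgn \<zeta> - c) \<le> e" and \<zeta>: "\<zeta> \<noteq> 0"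
  shows "cmod \<zeta> - Re (\<zeta> / c) \<le> cmod \<zeta> * (e\<^sup>2 / 2)"
proof -
  define w where "w = sgn \<zeta> / c"
  have c0: "c \<noteq> 0" using c by auto
  have w: "cmod w = 1" using \<zeta> c by (simp add: w_def norm_divide norm_sgn)
  have "w - 1 = (sgn \<zeta> - c) / c" using c0 by (simp add: w_def diff_divide_distrib)
  then have "cmod (w - 1) \<le> e" using near c by (simp add: norm_divide)
  then have "(cmod (w - 1))\<^sup>2 \<le> e\<^sup>2" by (intro power_mono) auto
  then have "1 - Re w \<le> e\<^sup>2 / 2" by (simp add: unimodular_norm_diff[OF w])
  then have "cmod \<zeta> * (1 - Re w) \<le> cmod \<zeta> * (e\<^sup>2 / 2)" by (intro mult_left_mono) auto
  moreover have "\<zeta> / c = of_real (cmod \<zeta>) * w" using \<zeta> by (simp add: w_def sgn_eq)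
  ultimately show ?thesis by (simp add: algebra_simps)
qed

text \<open>
  The function is the infimum of its upper tangents. Finitely many directions suffice up to an
  error \<open>e |\<zeta>|\<close>, and finite infima of real-linear expressions exist in every vector lattice.
\<close>

lemma ex_represents_phase_power:
  fixes z :: "'a::banach_lattice complexification"
  assumes d: "cmod d = 1"
  shows "\<exists>w. represents z w (\<lambda>\<zeta>. Re (d * phase_power k \<zeta>))"
proof (rule represents_limit)
  fix e :: real assume e: "0 < e"
  let ?L = "\<lambda>c \<zeta>. tangent_modulus_coeff k d c * cmod \<zeta> + Re (tangent_linear_coeff k d c * \<zeta>)"
  let ?B = "taylor_bound k"
  define e' where "e' = sqrt (e / (2 * ?B + 1))"
  have B: "0 < 2 * ?B + 1" using taylor_bound_nonneg[of k] by simp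
  have e': "0 < e'" and e'2: "4 * ?B * (e'\<^sup>2 / 2) \<le> e"
    using e B taylor_bound_nonneg[of k] by (simp_all add: e'_def field_simps)
  obtain D where D: "finite D" "D \<noteq> {}" "\<And>c. c \<in> D \<Longrightarrow> cmod c = 1"
    "\<And>w. cmod w = 1 \<Longrightarrow> \<exists>c\<in>D. cmod (w - c) \<le> e'"
    using circle_net[OF e'] by blast
  have "\<exists>w. represents z w (?L c)" for c
    using represents_linear by blast
  then obtain w where w: "represents z w (\<lambda>\<zeta>. Min ((\<lambda>c. ?L c \<zeta>) ` D))"
    using represents_Min[OF D(1,2), of z ?L] by blast
  have "\<bar>Min ((\<lambda>c. ?L c \<zeta>) ` D) - Re (d * phase_power k \<zeta>)\<bar> \<le> e * cmod \<zeta>" for \<zeta>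
  proof -
    have lower: "Re (d * phase_power k \<zeta>) \<le> Min ((\<lambda>c. ?L c \<zeta>) ` D)"
      using D phase_power_le_tangent(1)[OF d] by (intro Min.boundedI) auto
    have "Min ((\<lambda>c. ?L c \<zeta>) ` D) \<le> Re (d * phase_power k \<zeta>) + e * cmod \<zeta>"
    proof (cases "\<zeta> = 0")
      case True
      have "Min ((\<lambda>c. ?L c \<zeta>) ` D) \<in> (\<lambda>c. ?L c \<zeta>) ` D" using D by (intro Min_in) auto
      then show ?thesis using True by (auto simp: phase_power_def)
    next
      case False
      then obtain c where c: "c \<in> D" "cmod (sgn \<zeta> - c) \<le> e'"
        using D(4)[of "sgn \<zeta>"] by (auto simp: norm_sgn)
      have "Min ((\<lambda>c. ?L c \<zeta>) ` D) \<le> ?L c \<zeta>" using D c by (intro Min_le) auto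
      also have "\<dots> \<le> Re (d * phase_power k \<zeta>) + 4 * ?B * (cmod \<zeta> - Re (\<zeta> / c))"
        by (rule phase_power_le_tangent(2)[OF d D(3)[OF c(1)]])
      also have "\<dots> \<le> Re (d * phase_power k \<zeta>) + 4 * ?B * (cmod \<zeta> * (e'\<^sup>2 / 2))"
        using phase_defect[OF D(3)[OF c(1)] c(2) False] taylor_bound_nonneg[of k]
        by (intro add_left_mono mult_left_mono) auto
      also have "\<dots> \<le> Re (d * phase_power k \<zeta>) + e * cmod \<zeta>"
        using mult_right_mono[OF e'2, of "cmod \<zeta>"] by (simp add: algebra_simps)
      finally show ?thesis .
    qed
    then show ?thesis using lower by linarith
  qed
  then show "\<exists>w h'. represents z w h' \<and> (\<forall>\<zeta>. \<bar>h' \<zeta> - Re (d * phase_power k \<zeta>)\<bar> \<le> e * cmod \<zeta>)"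
    using w by blast
qed

definition is_phase_power :: "int \<Rightarrow> 'a::banach_lattice complexification \<Rightarrow> 'a complexification \<Rightarrow> bool"
  where "is_phase_power k z v \<longleftrightarrow> represents z (re_part v) (\<lambda>\<zeta>. Re (phase_power k \<zeta>)) \<and>
    represents z (im_part v) (\<lambda>\<zeta>. Im (phase_power k \<zeta>))"

lemma ex_phase_power: "\<exists>v. is_phase_power k z v"
proof -
  obtain x y where "represents z x (\<lambda>\<zeta>. Re (1 * phase_power k \<zeta>))"
    "represents z y (\<lambda>\<zeta>. Re (- \<i> * phase_power k \<zeta>))"
    using ex_represents_phase_power[of 1 z k] ex_represents_phase_power[of "- \<i>" z k] by auto
  then have "is_phase_power k z (Complexify x y)" by (simp add: is_phase_power_def)
  then show ?thesis ..
qed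

lemma phase_power_in_ideal:
  assumes "is_phase_power k z v" "modulus z \<in> principal_ideal u"
  shows "modulus v \<in> principal_ideal u"
  using assms unfolding is_phase_power_def
  by (meson modulus_in_principal_ideal represents_in_ideal)

lemma phase_power_value:
  assumes "is_phase_power k z v" "modulus z \<in> principal_ideal u" "character u \<phi>"
  shows "complex_value \<phi> v = phase_power k (complex_value \<phi> z)"
proof -
  have "\<phi> (re_part v) = Re (phase_power k (complex_value \<phi> z))"
    "\<phi> (im_part v) = Im (phase_power k (complex_value \<phi> z))"
    using assms represents_value unfolding is_phase_power_def by blast+
  then show ?thesis by (simp add: complex_value_def[of _ v] complex_eq_iff)
qed

lemma modulus_phase_power:
  fixes z :: "'a::banach_lattice complexification"
  assumes v: "is_phase_power k z v"
  shows "modulus v = modulus z"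
proof -
  have m: "modulus z \<in> principal_ideal (modulus z)"
    by (rule principal_ideal_self[OF modulus_nonneg])
  have mv: "modulus v \<in> principal_ideal (modulus z)" by (rule phase_power_in_ideal[OF v m])
  have eq: "\<phi> (modulus v) = \<phi> (modulus z)" if "character (modulus z) \<phi>" for \<phi>
    using that m mv v by (simp add: character_modulus phase_power_value norm_phase_power)
  show ?thesis
    using m mv eq[THEN eq_refl] eq[symmetric, THEN eq_refl] by (intro antisym le_if_characters_le[OF modulus_nonneg[of z]]) (assumption | simp)+
qed

definition complexify_map :: "('a::real_vector \<Rightarrow> 'a) \<Rightarrow> 'a complexification \<Rightarrow> 'a complexification"
  where "complexify_map P z = Complexify (P (re_part z)) (P (im_part z))"

lemma complexify_map_scaleC:
  assumes "linear P"
  shows "complexify_map P (c *\<^sub>C z) = c *\<^sub>C complexify_map P z"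
  by (rule complexification.expand)
    (simp add: complexify_map_def linear_diff[OF assms] linear_add[OF assms] linear_scale[OF assms])

lemma complexify_map_re_part: "re_part (complexify_map P z) = P (re_part z)"
  by (simp add: complexify_map_def)

lemma positive_linear_mono:
  fixes P :: "'a::banach_lattice \<Rightarrow> 'a"
  assumes "linear P" "\<And>x. 0 \<le> x \<Longrightarrow> 0 \<le> P x" "x \<le> y"
  shows "P x \<le> P y"
  using assms(2)[of "y - x"] assms(3) by (simp add: linear_diff[OF assms(1)])

lemma modulus_complexify_map_le:
  fixes P :: "'a::banach_lattice \<Rightarrow> 'a"
  assumes P: "linear P" "\<And>x. 0 \<le> x \<Longrightarrow> 0 \<le> P x"
  shows "modulus (complexify_map P z) \<le> P (modulus z)"
proof (rule modulus_least)
  fix t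
  have "rot (complexify_map P z) t = P (rot z t)"
    by (simp only: rot_eq_re_part complexify_map_scaleC[OF P(1), symmetric] complexify_map_re_part)
  also have "\<dots> \<le> P (modulus z)" by (rule positive_linear_mono[OF P rot_le_modulus])
  finally show "rot (complexify_map P z) t \<le> P (modulus z)" .
qed

definition phase_constant :: "int \<Rightarrow> real"
  where "phase_constant k = 2 * taylor_bound k + \<bar>1 - of_int k\<bar> + \<bar>of_int k\<bar>"

lemma phase_constant_nonneg: "0 \<le> phase_constant k"
  by (simp add: phase_constant_def taylor_bound_nonneg)

text \<open>
  The inequality \<open>phase_power_defect_le\<close> at a single point, where \<open>\<zeta>\<close>, \<open>\<eta>\<close>, \<open>X\<close> and \<open>p\<close> are the
  values of \<open>z\<close>, \<open>T z - \<lambda> z\<close>, \<open>T v\<close> and \<open>T |z|\<close>. The assumption \<open>tangent\<close> is what positivity of \<open>T\<close>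
  gives for each direction separately; the good direction \<open>c\<close> is the phase of \<open>\<lambda> \<zeta>\<close>, for which
  the tangent is exact at \<open>\<lambda> \<zeta>\<close>.
\<close>

lemma tangent_estimate:
  fixes \<zeta> \<eta> X d lam :: complex and p :: real
  assumes lam: "cmod lam = 1" and d: "cmod d = 1" and p: "cmod \<zeta> - cmod \<eta> \<le> p"
    and tangent: "\<And>c. cmod c = 1 \<Longrightarrow>
      Re (d * X) \<le> tangent_modulus_coeff k d c * p + Re (tangent_linear_coeff k d c * (lam * \<zeta> + \<eta>))"
  shows "Re (d * (X - lam powi k * phase_power k \<zeta>)) \<le> phase_constant k * (p - cmod \<zeta> + 2 * cmod \<eta>)"
proof -
  define c where "c = (if \<zeta> = 0 then 1 else lam * sgn \<zeta>)"
  have c: "cmod c = 1" using lam by (simp add: c_def norm_mult norm_sgn)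
  have c0: "c \<noteq> 0" using c by auto
  have lam0: "lam \<noteq> 0" using lam by auto
  have \<zeta>c: "lam * \<zeta> / c = of_real (cmod \<zeta>)"
    using lam0 by (auto simp: c_def sgn_eq field_simps)
  have F: "lam powi k * phase_power k \<zeta> = c powi k * of_real (cmod \<zeta>)"
    by (simp add: c_def phase_power_def power_int_mult_distrib)
  define s where "s = cmod \<zeta>"
  have ps: "\<bar>p - s\<bar> \<le> p - s + 2 * cmod \<eta>" using p by (simp add: s_def abs_le_iff)
  have \<tau>: "(lam * \<zeta> + \<eta>) / c = of_real s + \<eta> / c"
    by (simp add: add_divide_distrib \<zeta>c s_def)
  have "Re (d * X) \<le> Re (d * (c powi k * ((1 - of_int k) * of_real p + of_int k * (of_real s + \<eta> / c))))
      + 2 * taylor_bound k * (p - Re (of_real s + \<eta> / c))"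
    using tangent[OF c] unfolding tangent_eq \<tau> .
  also have "d * (c powi k * ((1 - of_int k) * of_real p + of_int k * (of_real s + \<eta> / c))) =
      d * (lam powi k * phase_power k \<zeta>) + d * c powi k * (of_real ((1 - of_int k) * (p - s)) + of_int k * (\<eta> / c))"
    unfolding F by (simp add: s_def algebra_simps)
  finally have "Re (d * (X - lam powi k * phase_power k \<zeta>)) \<le>
      Re (d * c powi k * (of_real ((1 - of_int k) * (p - s)) + of_int k * (\<eta> / c)))
      + 2 * taylor_bound k * (p - Re (of_real s + \<eta> / c))"
    by (simp only: right_diff_distrib minus_complex.sel plus_complex.sel)
  also have "\<dots> \<le> (\<bar>1 - of_int k\<bar> * \<bar>p - s\<bar> + \<bar>of_int k\<bar> * cmod \<eta>)
      + 2 * taylor_bound k * (p - s + 2 * cmod \<eta>)"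
  proof (intro add_mono mult_left_mono)
    have "Re (d * c powi k * (of_real ((1 - of_int k) * (p - s)) + of_int k * (\<eta> / c))) \<le>
      cmod (of_real ((1 - of_int k) * (p - s)) + of_int k * (\<eta> / c))"
      using complex_Re_le_cmod[of "d * c powi k * (of_real ((1 - of_int k) * (p - s)) + of_int k * (\<eta> / c))"]
      by (simp only: norm_mult norm_power_int d c power_int_1_left mult_1)
    also have "\<dots> \<le> cmod (of_real ((1 - of_int k) * (p - s))) + cmod (of_int k * (\<eta> / c))"
      by (rule norm_triangle_ineq)
    also have "\<dots> = \<bar>1 - of_int k\<bar> * \<bar>p - s\<bar> + \<bar>of_int k\<bar> * cmod \<eta>"
      by (simp only: norm_of_real abs_mult norm_mult norm_of_int norm_divide c div_by_1)
    finally show "Re (d * c powi k * (of_real ((1 - of_int k) * (p - s)) + of_int k * (\<eta> / c))) \<le>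
      \<bar>1 - of_int k\<bar> * \<bar>p - s\<bar> + \<bar>of_int k\<bar> * cmod \<eta>" .
    have "- Re (\<eta> / c) \<le> cmod \<eta>"
      using abs_Re_le_cmod[of "\<eta> / c"] by (simp add: norm_divide c)
    then show "p - Re (of_real s + \<eta> / c) \<le> p - s + 2 * cmod \<eta>" 
      using norm_ge_zero[of \<eta>] by (simp only: plus_complex.sel Re_complex_of_real)
  qed (simp add: taylor_bound_nonneg)
  also have "\<dots> \<le> (\<bar>1 - of_int k\<bar> * (p - s + 2 * cmod \<eta>) + \<bar>of_int k\<bar> * (p - s + 2 * cmod \<eta>))
      + 2 * taylor_bound k * (p - s + 2 * cmod \<eta>)"
    using ps p by (intro add_mono mult_left_mono order_refl) (auto simp: s_def)
  also have "\<dots> = phase_constant k * (p - s + 2 * cmod \<eta>)"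
    by (simp add: phase_constant_def algebra_simps)
  finally show ?thesis by (simp add: s_def)
qed

lemma phase_power_tangent_in_lattice:
  fixes z :: "'a::banach_lattice complexification"
  assumes v: "is_phase_power k z v" and d: "cmod d = 1" and c: "cmod c = 1"
  shows "re_part (d *\<^sub>C v) \<le>
    tangent_modulus_coeff k d c *\<^sub>R modulus z + re_part (tangent_linear_coeff k d c *\<^sub>C z)"
    (is "_ \<le> ?L")
proof (rule le_if_characters_le[OF modulus_nonneg[of z]])
  have m: "modulus z \<in> principal_ideal (modulus z)"
    by (rule principal_ideal_self[OF modulus_nonneg])
  have L: "represents z ?L (\<lambda>\<zeta>. tangent_modulus_coeff k d c * cmod \<zeta> + Re (tangent_linear_coeff k d c * \<zeta>))"
    by (rule represents_linear)
  show "?L \<in> principal_ideal (modulus z)" by (rule represents_in_ideal[OF L m])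
  show "re_part (d *\<^sub>C v) \<in> principal_ideal (modulus z)"
    by (rule parts_in_principal_ideal)
      (simp add: modulus_scaleC principal_ideal_scaleR phase_power_in_ideal[OF v m])
  fix \<phi> :: "'a \<Rightarrow> real" assume \<phi>: "character (modulus z) \<phi>"
  have "\<phi> (re_part (d *\<^sub>C v)) = Re (d * phase_power k (complex_value \<phi> z))"
    using complex_value_scaleC[OF \<phi> phase_power_in_ideal[OF v m], of d] phase_power_value[OF v m \<phi>]
    by (metis complex_value_def complex.sel(1))
  then show "\<phi> (re_part (d *\<^sub>C v)) \<le> \<phi> ?L"
    using phase_power_le_tangent(1)[OF d c] represents_value[OF L m \<phi>] by simp
qed

text \<open>
  A positive operator preserves the inequalities between \<open>v\<close> and its upper tangents at \<open>z\<close>. After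
  its application the best tangent can be chosen anew at every character, which is why the
  argument works without any representation of the operator.
\<close>

lemma phase_power_defect_le:
  fixes P :: "'a::banach_lattice \<Rightarrow> 'a" and z :: "'a complexification"
  assumes P: "linear P" "\<And>x. 0 \<le> x \<Longrightarrow> 0 \<le> P x"
    and lam: "cmod lam = 1" and v: "is_phase_power k z v"
  defines "T \<equiv> complexify_map P"
  shows "modulus (T v - lam powi k *\<^sub>C v) \<le>
    phase_constant k *\<^sub>R (P (modulus z) - modulus z + 2 *\<^sub>R modulus (T z - lam *\<^sub>C z))"
    (is "modulus ?f \<le> phase_constant k *\<^sub>R ?g")
proof -
  define e where "e = T z - lam *\<^sub>C z"
  define u where "u = modulus z + modulus e + modulus (T v) + P (modulus z)"
  have nn: "0 \<le> modulus z" "0 \<le> modulus e" "0 \<le> modulus (T v)" "0 \<le> P (modulus z)"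
    by (simp_all add: modulus_nonneg P)
  have u0: "0 \<le> u" unfolding u_def using nn by (intro add_nonneg_nonneg)
  have "modulus z \<le> u" "modulus e \<le> u" "modulus (T v) \<le> u" "P (modulus z) \<le> u"
    unfolding u_def using nn by (simp_all add: add_increasing add_increasing2)
  then have in_u: "modulus z \<in> principal_ideal u" "modulus e \<in> principal_ideal u"
    "modulus (T v) \<in> principal_ideal u" "P (modulus z) \<in> principal_ideal u"
    using nn by (auto intro!: principal_idealI simp: abs_of_nonneg)
  have v_u: "modulus v \<in> principal_ideal u" by (rule phase_power_in_ideal[OF v in_u(1)])
  have lz_u: "modulus (c *\<^sub>C z) \<in> principal_ideal u" "modulus (c *\<^sub>C v) \<in> principal_ideal u" for c
    by (simp_all add: modulus_scaleC in_u v_u principal_ideal_scaleR)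
  have Tz: "T z = lam *\<^sub>C z + e" by (simp add: e_def)
  have Tz_u: "modulus (T z) \<in> principal_ideal u"
    unfolding Tz by (intro modulus_add_in_principal_ideal lz_u in_u)
  have f_u: "modulus ?f \<in> principal_ideal u"
    by (intro modulus_diff_in_principal_ideal lz_u in_u)
  have g_u: "?g \<in> principal_ideal u"
    unfolding e_def[symmetric]
    using in_u by (intro principal_ideal_add principal_ideal_diff principal_ideal_scaleR)
  show ?thesis
  proof (rule le_if_characters_le[OF u0 f_u principal_ideal_scaleR[OF g_u]])
    fix \<phi> :: "'a \<Rightarrow> real" assume \<phi>: "character u \<phi>"
    let ?\<zeta> = "complex_value \<phi> z" and ?\<eta> = "complex_value \<phi> e" and ?X = "complex_value \<phi> (T v)"
    define p where "p = \<phi> (P (modulus z))"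
    have \<tau>: "complex_value \<phi> (T z) = lam * ?\<zeta> + ?\<eta>"
      unfolding Tz by (simp add: complex_value_add[OF \<phi> lz_u(1) in_u(2)] complex_value_scaleC[OF \<phi> in_u(1)])
    have F: "complex_value \<phi> ?f = ?X - lam powi k * phase_power k ?\<zeta>"
      by (simp add: complex_value_diff[OF \<phi> in_u(3) lz_u(2)] complex_value_scaleC[OF \<phi> v_u]
          phase_power_value[OF v in_u(1) \<phi>])
    have "cmod (lam * ?\<zeta> + ?\<eta>) \<le> p"
      using character_mono[OF \<phi> Tz_u in_u(4)] modulus_complexify_map_le[OF P, of z]
      unfolding T_def[symmetric] character_modulus[OF \<phi> Tz_u] \<tau> p_def .
    moreover have "cmod ?\<zeta> - cmod ?\<eta> \<le> cmod (lam * ?\<zeta> + ?\<eta>)"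
      using norm_diff_ineq[of "lam * ?\<zeta>" ?\<eta>] lam by (simp add: norm_mult)
    ultimately have p: "cmod ?\<zeta> - cmod ?\<eta> \<le> p" by linarith
    have tangent: "Re (d * ?X) \<le> tangent_modulus_coeff k d c * p
        + Re (tangent_linear_coeff k d c * (lam * ?\<zeta> + ?\<eta>))" if d: "cmod d = 1" and c: "cmod c = 1" for d c
    proof -
      let ?a = "tangent_modulus_coeff k d c" and ?b = "tangent_linear_coeff k d c"
      have "P (re_part (d *\<^sub>C v)) \<le> P (?a *\<^sub>R modulus z + re_part (?b *\<^sub>C z))"
        by (intro positive_linear_mono[OF P] phase_power_tangent_in_lattice v d c)
      moreover have "P (re_part (c *\<^sub>C w)) = re_part (c *\<^sub>C T w)" for c w
        unfolding T_def complexify_map_scaleC[OF P(1), symmetric] complexify_map_re_part ..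
      ultimately have le: "re_part (d *\<^sub>C T v) \<le> ?a *\<^sub>R P (modulus z) + re_part (?b *\<^sub>C T z)"
        by (simp only: linear_add[OF P(1)] linear_scale[OF P(1)])
      have mem: "re_part (c *\<^sub>C w) \<in> principal_ideal u" if "modulus w \<in> principal_ideal u" for c w
        by (rule parts_in_principal_ideal) (simp add: modulus_scaleC that principal_ideal_scaleR)
      have val: "\<phi> (re_part (c *\<^sub>C w)) = Re (c * complex_value \<phi> w)" if "modulus w \<in> principal_ideal u" for c w
        using complex_value_scaleC[OF \<phi> that, of c] by (metis complex_value_def complex.sel(1))
      have "\<phi> (re_part (d *\<^sub>C T v)) \<le> \<phi> (?a *\<^sub>R P (modulus z) + re_part (?b *\<^sub>C T z))"
        by (intro character_mono[OF \<phi> _ _ le] mem in_u Tz_u principal_ideal_add principal_ideal_scaleR)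
      also have "\<dots> = ?a * p + Re (?b * complex_value \<phi> (T z))"
        by (simp only: character_add[OF \<phi>] character_scaleR[OF \<phi>] mem in_u Tz_u principal_ideal_scaleR val p_def)
      finally show ?thesis by (simp only: val in_u \<tau>)
    qed
    define d where "d = cis (- Arg (complex_value \<phi> ?f))"
    have d: "cmod d = 1" by (simp add: d_def)
    have "d * complex_value \<phi> ?f = of_real (cmod (complex_value \<phi> ?f)) * (d * cis (Arg (complex_value \<phi> ?f)))"
      using rcis_cmod_Arg[of "complex_value \<phi> ?f"] by (simp add: rcis_def algebra_simps)
    then have "cmod (complex_value \<phi> ?f) = Re (d * complex_value \<phi> ?f)"
      by (simp add: d_def cis_mult)
    also have "\<dots> \<le> phase_constant k * (p - cmod ?\<zeta> + 2 * cmod ?\<eta>)"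
      unfolding F by (rule tangent_estimate[OF lam d p tangent[OF d]])
    also have "\<dots> = \<phi> (phase_constant k *\<^sub>R ?g)"
      unfolding e_def[symmetric]
      using in_u by (simp only: character_scaleR[OF \<phi>] character_add[OF \<phi>] character_diff[OF \<phi>] p_def
          principal_ideal_add principal_ideal_diff principal_ideal_scaleR character_modulus[OF \<phi>])
    finally show "\<phi> (modulus ?f) \<le> \<phi> (phase_constant k *\<^sub>R ?g)"
      by (simp only: character_modulus[OF \<phi> f_u])
  qed
qed

section \<open>Resolvents of positive operators\<close>

lemma bounded_clinearD:
  assumes "bounded_clinear T"
  shows "bounded_linear T" "linear T" "T (c *\<^sub>C z) = c *\<^sub>C T z" "T (z + w) = T z + T w"
    "T (z - w) = T z - T w" "T (a *\<^sub>R z) = a *\<^sub>R T z" "norm (T z) \<le> onorm T * norm z"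
  using assms by (auto simp: bounded_clinear_def bounded_linear.linear linear_add linear_diff
      linear_scale onorm)

lemma norm_modulus: "norm (modulus z) = norm z"
  by (simp add: norm_complexification_def)

lemma modulus_add_le: "modulus (z + w) \<le> modulus z + modulus w"
proof (rule modulus_least)
  fix t
  have "rot (z + w) t = rot z t + rot w t" by (simp add: rot_def algebra_simps)
  then show "rot (z + w) t \<le> modulus z + modulus w" by (simp add: add_mono rot_le_modulus)
qed

lemma modulus_minus_commute: "modulus (z - w) = modulus (w - z)"
proof -
  have "z - w = (- 1) *\<^sub>C (w - z)" by (rule complexification.expand) simp
  then have "modulus (z - w) = cmod (- 1) *\<^sub>R modulus (w - z)" by (simp only: modulus_scaleC)
  then show ?thesis by simp
qed

definition embed_real :: "'a::real_vector \<Rightarrow> 'a complexification"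
  where "embed_real x = Complexify x 0"

lemma embed_real_parts [simp]: "re_part (embed_real x) = x" "im_part (embed_real x) = 0"
  by (simp_all add: embed_real_def)

lemma modulus_embed_real: "modulus (embed_real x) = \<bar>x\<bar>"
  using modulus_le_abs_parts[of "embed_real x"] abs_parts_le_modulus(1)[of "embed_real x"] by (intro antisym) simp_all

lemma norm_embed_real: "norm (embed_real x) = norm x"
  by (simp add: norm_complexification_def modulus_embed_real)

lemma bounded_linear_embed_real: "bounded_linear (embed_real :: 'a::banach_lattice \<Rightarrow> _)"
proof (rule bounded_linear_intro[where K = 1])
  show "embed_real (x + y) = embed_real x + embed_real y" for x y :: 'a by (rule complexification.expand) simp
  show "embed_real (c *\<^sub>R x) = c *\<^sub>R embed_real x" for c and x :: 'a by (rule complexification.expand) simp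
  show "norm (embed_real x) \<le> norm x * 1" for x :: 'a by (simp add: norm_embed_real)
qed

lemma embed_real_decomposition: "z = embed_real (re_part z) + \<i> *\<^sub>C embed_real (im_part z)"
  by (rule complexification.expand) simp

lemma bounded_linear_re_part: "bounded_linear (re_part :: 'a::banach_lattice complexification \<Rightarrow> 'a)"
  by (rule bounded_linear_intro[where K = 1]) (simp_all add: norm_parts_le)

definition real_restriction :: "'a::real_vector operator \<Rightarrow> 'a \<Rightarrow> 'a"
  where "real_restriction T x = re_part (T (embed_real x))"

lemma bounded_linear_real_restriction:
  assumes "bounded_clinear T"
  shows "bounded_linear (real_restriction T)"
proof -
  have "bounded_linear (\<lambda>x. re_part (T (embed_real x)))"
    using bounded_linear_compose[OF bounded_linear_re_part
        bounded_linear_compose[OF bounded_clinearD(1)[OF assms] bounded_linear_embed_real]] .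
  then show ?thesis by (simp add: real_restriction_def[abs_def])
qed

lemma norm_real_restriction_le:
  assumes "bounded_clinear T"
  shows "norm (real_restriction T x) \<le> onorm T * norm x"
  using norm_parts_le(1)[of "T (embed_real x)"] bounded_clinearD(7)[OF assms, of "embed_real x"]
  by (simp add: real_restriction_def norm_embed_real)

lemma real_restriction_nonneg:
  assumes "positive_operator T" "0 \<le> x"
  shows "0 \<le> real_restriction T x" "im_part (T (embed_real x)) = 0"
proof -
  have "0 \<le> T (embed_real x)"
    using assms by (simp add: positive_operator_def less_eq_complexification_def)
  then show "0 \<le> real_restriction T x" "im_part (T (embed_real x)) = 0"
    by (simp_all add: less_eq_complexification_def real_restriction_def)
qed

text \<open>
  Positivity makes the operator real, since every real vector is a difference of positive ones.
\<close>

lemma positive_operator_eq_complexify_map: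
  fixes T :: "'a::banach_lattice operator"
  assumes T: "bounded_clinear T" "positive_operator T"
  shows "T z = complexify_map (real_restriction T) z"
proof -
  have im: "im_part (T (embed_real x)) = 0" for x :: 'a
  proof -
    have "x + sup (- x) 0 = sup x 0"
      by (simp add: add_sup_distrib_left sup.commute)
    then have "x = sup x 0 - sup (- x) 0" by (simp only: eq_diff_eq)
    then have "embed_real x = embed_real (sup x 0) - embed_real (sup (- x) 0)"
      by (metis linear_diff[OF bounded_linear.linear[OF bounded_linear_embed_real]])
    then have "T (embed_real x) = T (embed_real (sup x 0)) - T (embed_real (sup (- x) 0))"
      by (simp add: bounded_clinearD(5)[OF T(1)])
    then show ?thesis using real_restriction_nonneg(2)[OF T(2)] by simp
  qed
  have "T z = T (embed_real (re_part z)) + \<i> *\<^sub>C T (embed_real (im_part z))"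
    by (metis embed_real_decomposition bounded_clinearD(3,4)[OF T(1)])
  then show ?thesis
    by (intro complexification.expand) (simp add: complexify_map_def real_restriction_def im)
qed

lemma resolvent_exists:
  assumes T: "bounded_clinear T" and \<mu>: "\<mu> \<notin> spectrum T"
  shows bounded_clinear_resolvent: "bounded_clinear (resolvent \<mu> T)"
    and resolvent_left: "resolvent \<mu> T (\<mu> *\<^sub>C z - T z) = z"
    and resolvent_right: "\<mu> *\<^sub>C resolvent \<mu> T z - T (resolvent \<mu> T z) = z"
proof -
  obtain S where S: "bounded_clinear S" "\<And>z. S (\<mu> *\<^sub>C z - T z) = z" "\<And>z. \<mu> *\<^sub>C S z - T (S z) = z"
    using \<mu> by (auto simp: spectrum_def)
  have "resolvent \<mu> T = S"
    unfolding resolvent_def using S by (intro inv_unique_comp) (auto simp: fun_eq_iff)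
  then show "bounded_clinear (resolvent \<mu> T)" "resolvent \<mu> T (\<mu> *\<^sub>C z - T z) = z"
    "\<mu> *\<^sub>C resolvent \<mu> T z - T (resolvent \<mu> T z) = z" using S by auto
qed

lemma norm_resolvent_le:
  assumes "bounded_clinear T" "\<mu> \<notin> spectrum T"
  shows "norm (resolvent \<mu> T z) \<le> onorm (resolvent \<mu> T) * norm z"
  by (rule bounded_clinearD(7)[OF bounded_clinear_resolvent[OF assms]])

lemma resolvent_identity:
  assumes T: "bounded_clinear T" and "\<mu> \<notin> spectrum T" "\<nu> \<notin> spectrum T"
  shows "resolvent \<mu> T z - resolvent \<nu> T z = (\<nu> - \<mu>) *\<^sub>C resolvent \<nu> T (resolvent \<mu> T z)"
proof -
  define y where "y = resolvent \<mu> T z"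
  have lin: "bounded_clinear (resolvent \<nu> T)" by (rule bounded_clinear_resolvent[OF assms(1,3)])
  have "z = (\<nu> *\<^sub>C y - T y) - (\<nu> - \<mu>) *\<^sub>C y"
  proof -
    have "(\<nu> *\<^sub>C y - T y) - (\<nu> - \<mu>) *\<^sub>C y = \<mu> *\<^sub>C y - T y"
      by (rule complexification.expand) (simp add: algebra_simps)
    then show ?thesis using resolvent_right[OF assms(1,2)] by (simp add: y_def)
  qed
  then have "resolvent \<nu> T z = resolvent \<nu> T (\<nu> *\<^sub>C y - T y) - (\<nu> - \<mu>) *\<^sub>C resolvent \<nu> T y"
    using bounded_clinearD(3,5)[OF lin] by metis
  then show ?thesis by (simp add: resolvent_left[OF assms(1,3)] y_def)
qed

text \<open>
  This makes the supremum in the definition of the spectral radius a genuine one. The equation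
  \<open>\<mu> z - T z = f\<close> is a fixed point equation for a contraction.
\<close>

lemma spectrum_bounded:
  fixes T :: "'a::banach_lattice operator"
  assumes T: "bounded_clinear T" and \<mu>: "onorm T < cmod \<mu>"
  shows "\<mu> \<notin> spectrum T"
proof -
  have pos: "0 < cmod \<mu>" "\<mu> \<noteq> 0" using \<mu> onorm_pos_le[OF bounded_clinearD(1)[OF T]] by auto
  have solve: "\<exists>!z. \<mu> *\<^sub>C z - T z = f" for f
  proof -
    let ?g = "\<lambda>z. inverse \<mu> *\<^sub>C (f + T z)"
    have "\<exists>!z. ?g z = z"
    proof (rule banach_fix_type[where c = "onorm T / cmod \<mu>"])
      show "0 \<le> onorm T / cmod \<mu>" "onorm T / cmod \<mu> < 1"
        using \<mu> pos onorm_pos_le[OF bounded_clinearD(1)[OF T]] by auto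
      show "\<forall>x y. dist (?g x) (?g y) \<le> onorm T / cmod \<mu> * dist x y"
      proof (intro allI)
        fix x y
        have "?g x - ?g y = inverse \<mu> *\<^sub>C T (x - y)"
          unfolding bounded_clinearD(5)[OF T] by (rule complexification.expand) (simp add: algebra_simps)
        then have "norm (?g x - ?g y) = norm (T (x - y)) / cmod \<mu>"
          by (simp only: norm_scaleC norm_inverse) (simp add: divide_inverse mult.commute)
        also have "\<dots> \<le> onorm T * norm (x - y) / cmod \<mu>"
          by (intro divide_right_mono bounded_clinearD(7)[OF T]) simp
        finally show "dist (?g x) (?g y) \<le> onorm T / cmod \<mu> * dist x y"
          by (simp add: dist_norm)
      qed
    qed
    moreover have "?g z = z \<longleftrightarrow> \<mu> *\<^sub>C z - T z = f" for z
    proof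
      assume "?g z = z"
      then have "\<mu> *\<^sub>C z = \<mu> *\<^sub>C ?g z" by simp
      also have "\<dots> = f + T z" using pos by (simp add: scaleC_vector_space)
      finally show "\<mu> *\<^sub>C z - T z = f" by simp
    next
      assume "\<mu> *\<^sub>C z - T z = f"
      then have "f + T z = \<mu> *\<^sub>C z" by auto
      then show "?g z = z" using pos by (simp add: scaleC_vector_space)
    qed
    ultimately show ?thesis by simp
  qed
  define S where "S f = (THE z. \<mu> *\<^sub>C z - T z = f)" for f
  have S_right: "\<mu> *\<^sub>C S f - T (S f) = f" for f
    unfolding S_def by (rule theI'[OF solve])
  have S_eq: "S f = z" if "\<mu> *\<^sub>C z - T z = f" for f z
    using solve[of f] S_right[of f] that by blast
  have S_add: "S (f + g) = S f + S g" for f g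
  proof (rule S_eq)
    have "\<mu> *\<^sub>C (S f + S g) - T (S f + S g) = (\<mu> *\<^sub>C S f - T (S f)) + (\<mu> *\<^sub>C S g - T (S g))"
      by (simp add: bounded_clinearD(4)[OF T] scaleC_vector_space)
    then show "\<mu> *\<^sub>C (S f + S g) - T (S f + S g) = f + g" by (simp only: S_right)
  qed
  have S_scale: "S (c *\<^sub>C f) = c *\<^sub>C S f" for c f
  proof (rule S_eq)
    have "\<mu> *\<^sub>C (c *\<^sub>C S f) - T (c *\<^sub>C S f) = c *\<^sub>C (\<mu> *\<^sub>C S f - T (S f))"
      unfolding bounded_clinearD(3)[OF T] by (rule complexification.expand) (simp add: algebra_simps)
    then show "\<mu> *\<^sub>C (c *\<^sub>C S f) - T (c *\<^sub>C S f) = c *\<^sub>C f" by (simp only: S_right)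
  qed
  have "bounded_linear S"
  proof (rule bounded_linear_intro[where K = "1 / (cmod \<mu> - onorm T)"])
    show "S (f + g) = S f + S g" for f g by (rule S_add)
    show "S (a *\<^sub>R f) = a *\<^sub>R S f" for a f
      using S_scale[of "of_real a" f] by (simp only: scaleC_of_real)
    fix f
    have "cmod \<mu> * norm (S f) = norm (f + T (S f))"
      using S_right[of f] by (metis add_diff_cancel_right' diff_add_cancel norm_scaleC)
    also have "\<dots> \<le> norm f + onorm T * norm (S f)"
      by (rule order_trans[OF norm_triangle_ineq]) (simp add: bounded_clinearD(7)[OF T])
    finally show "norm (S f) \<le> norm f * (1 / (cmod \<mu> - onorm T))"
      using \<mu> by (simp add: field_simps)
  qed
  then have "bounded_clinear S" by (simp add: bounded_clinear_def S_scale)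
  then show ?thesis using S_right S_eq by (auto simp: spectrum_def)
qed

lemma outside_spectral_radius:
  fixes T :: "'a::banach_lattice operator"
  assumes "bounded_clinear T" "spectral_radius T < cmod \<mu>"
  shows "\<mu> \<notin> spectrum T"
proof
  assume "\<mu> \<in> spectrum T"
  moreover have "bdd_above (cmod ` spectrum T)"
    using spectrum_bounded[OF assms(1)] by (auto simp: bdd_above_def not_less intro!: exI[of _ "onorm T"] leI)
  ultimately have "cmod \<mu> \<le> spectral_radius T"
    unfolding spectral_radius_def by (intro cSUP_upper)
  then show False using assms(2) by simp
qed

locale positive_operator_radius_one =
  fixes T :: "'a::banach_lattice operator"
  assumes bounded: "bounded_clinear T" and positive: "positive_operator T"
    and radius: "spectral_radius T = 1"
begin

text \<open>The operators that \<open>T\<close> and its resolvent at the real point \<open>r\<close> induce on the real Banach lattice.\<close>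

definition P :: "'a \<Rightarrow> 'a"
  where "P = real_restriction T"

definition Q :: "real \<Rightarrow> 'a \<Rightarrow> 'a"
  where "Q r = real_restriction (resolvent (of_real r) T)"

lemma T_eq: "T z = complexify_map P z"
  unfolding P_def by (rule positive_operator_eq_complexify_map[OF bounded positive])

lemma P_linear: "linear P"
  unfolding P_def by (rule bounded_linear.linear[OF bounded_linear_real_restriction[OF bounded]])

lemma P_nonneg: "0 \<le> x \<Longrightarrow> 0 \<le> P x"
  unfolding P_def by (rule real_restriction_nonneg(1)[OF positive])

lemma P_mono: "x \<le> y \<Longrightarrow> P x \<le> P y"
  by (rule positive_linear_mono[OF P_linear P_nonneg])

lemma norm_P_le: "norm (P x) \<le> onorm T * norm x"
  unfolding P_def by (rule norm_real_restriction_le[OF bounded])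

lemma modulus_T_le: "modulus (T z) \<le> P (modulus z)"
  unfolding T_eq[of z] by (rule modulus_complexify_map_le[OF P_linear P_nonneg])

lemma outside: "1 < cmod \<mu> \<Longrightarrow> \<mu> \<notin> spectrum T"
  by (rule outside_spectral_radius[OF bounded]) (simp add: radius)

lemma outside_real: "1 < r \<Longrightarrow> complex_of_real r \<notin> spectrum T"
  by (rule outside) simp

lemma Q_linear: "1 < r \<Longrightarrow> linear (Q r)"
  unfolding Q_def
  by (intro bounded_linear.linear bounded_linear_real_restriction bounded_clinear_resolvent bounded outside_real)

lemma norm_Q_le: "1 < r \<Longrightarrow> norm (Q r x) \<le> onorm (resolvent (of_real r) T) * norm x"
  unfolding Q_def by (intro norm_real_restriction_le bounded_clinear_resolvent bounded outside_real)

lemma Q_right: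
  assumes "1 < r"
  shows "r *\<^sub>R Q r x - P (Q r x) = x"
proof -
  have "re_part (of_real r *\<^sub>C resolvent (of_real r) T (embed_real x) - T (resolvent (of_real r) T (embed_real x))) = x"
    using resolvent_right[OF bounded outside_real[OF assms], of "embed_real x"] by simp
  then show ?thesis
    by (simp add: T_eq[of "resolvent (of_real r) T (embed_real x)"] complexify_map_re_part Q_def real_restriction_def)
qed

lemma Q_left:
  assumes "1 < r"
  shows "Q r (r *\<^sub>R x - P x) = x"
proof -
  have "embed_real (r *\<^sub>R x - P x) = of_real r *\<^sub>C embed_real x - T (embed_real x)"
    by (rule complexification.expand)
      (simp add: T_eq[of "embed_real x"] complexify_map_def linear_0[OF P_linear])
  then show ?thesis
    using resolvent_left[OF bounded outside_real[OF assms], of "embed_real x"]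
    by (simp add: Q_def real_restriction_def)
qed

text \<open>The negative part \<open>u\<close> of \<open>x\<close> satisfies \<open>r u \<le> P u\<close>.\<close>

lemma nonneg_if_no_growing_vector:
  assumes above: "\<And>x. 0 \<le> x \<Longrightarrow> r *\<^sub>R x \<le> P x \<Longrightarrow> x = 0" and r: "0 < r"
    and x: "P x \<le> r *\<^sub>R x"
  shows "0 \<le> x"
proof -
  define u where "u = sup (- x) 0"
  have u: "0 \<le> u" "- x \<le> u" by (auto simp: u_def)
  have "- P x \<le> P u" using P_mono[OF u(2)] by (simp add: linear_neg[OF P_linear])
  then have "- (r *\<^sub>R x) \<le> P u" using x by (meson neg_le_iff_le order_trans)
  moreover have "r *\<^sub>R u = sup (r *\<^sub>R (- x)) (r *\<^sub>R 0)"
    unfolding u_def by (rule scaleR_sup_distrib[OF r])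
  ultimately have "r *\<^sub>R u \<le> P u" using P_nonneg[OF u(1)] by simp
  from above[OF u(1) this] have "- x \<le> 0" using u(2) by simp
  then show ?thesis by simp
qed

text \<open>
  This replaces the expansion of the resolvent into powers of \<open>T\<close> outside the spectral radius. Let
  \<open>R\<close> be the supremum of all \<open>r > 1\<close> that violate the claim. To the right of \<open>R\<close> the resolvent is
  positive, and a vector \<open>y\<close> with \<open>t y \<le> P y\<close> satisfies \<open>y \<le> (s - t) Q s y\<close> for \<open>s > R\<close>. With \<open>t\<close> and
  \<open>s\<close> close to \<open>R\<close> the resolvent would blow up at \<open>R > 1\<close>, a point outside the spectrum.
\<close>

lemma no_growing_vector:
  assumes r: "1 < r" and x: "0 \<le> x" "r *\<^sub>R x \<le> P x"
  shows "x = 0"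
proof (rule ccontr)
  assume x0: "x \<noteq> 0"
  define A where "A = {r. 1 < r \<and> (\<exists>x\<ge>0. x \<noteq> 0 \<and> r *\<^sub>R x \<le> P x)}"
  have rA: "r \<in> A" using r x x0 by (auto simp: A_def)
  have "t \<le> onorm T" if "t \<in> A" for t
  proof -
    from that obtain y where y: "1 < t" "0 \<le> y" "y \<noteq> 0" "t *\<^sub>R y \<le> P y"
      unfolding A_def by blast
    have "norm (t *\<^sub>R y) \<le> norm (P y)"
      using y by (intro norm_mono_nonneg) (auto intro: scaleR_nonneg_nonneg)
    also have "\<dots> \<le> onorm T * norm y" by (rule norm_P_le)
    finally show ?thesis using y by simp
  qed
  then have bdd: "bdd_above A" by (auto simp: bdd_above_def)
  define R where "R = Sup A"
  have rR: "r \<le> R" unfolding R_def by (rule cSup_upper[OF rA bdd])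
  have R1: "1 < R" using r rR by simp
  define B where "B = onorm (resolvent (of_real R) T) + 1"
  have B1: "1 \<le> B" using onorm_pos_le[OF bounded_clinearD(1)[OF bounded_clinear_resolvent[OF bounded outside_real[OF R1]]]]
    by (simp add: B_def)
  define \<epsilon> where "\<epsilon> = 1 / (8 * B)"
  have \<epsilon>: "0 < \<epsilon>" "\<epsilon> * B = 1 / 8" using B1 by (simp_all add: \<epsilon>_def)
  have "R - \<epsilon> < Sup A" using \<epsilon> by (simp add: R_def)
  then obtain t where t: "t \<in> A" "R - \<epsilon> < t" using less_cSup_iff[OF _ bdd] rA by blast
  have tR: "t \<le> R" unfolding R_def by (rule cSup_upper[OF t(1) bdd])
  from t(1) obtain y where y: "1 < t" "0 \<le> y" "y \<noteq> 0" "t *\<^sub>R y \<le> P y"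
    unfolding A_def by blast
  define s where "s = R + \<epsilon>"
  have s1: "1 < s" using R1 \<epsilon> by (simp add: s_def)
  have st: "0 < s - t" "s - t \<le> 2 * \<epsilon>" using t tR \<epsilon> by (simp_all add: s_def)
  have above: "x = 0" if "0 \<le> x" "s *\<^sub>R x \<le> P x" for x
  proof (rule ccontr)
    assume "x \<noteq> 0"
    then have "s \<in> A" using that s1 by (auto simp: A_def)
    then have "s \<le> R" unfolding R_def by (rule cSup_upper[OF _ bdd])
    then show False using \<epsilon> by (simp add: s_def)
  qed
  define w where "w = Q s y"
  have "0 \<le> (s - t) *\<^sub>R w - y"
  proof (rule nonneg_if_no_growing_vector[OF above])
    have w: "s *\<^sub>R w - P w = y" unfolding w_def by (rule Q_right[OF s1])
    have gen: "s *\<^sub>R (c *\<^sub>R w - y) - P (c *\<^sub>R w - y) = c *\<^sub>R (s *\<^sub>R w - P w) - (s *\<^sub>R y - P y)" for c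
      by (simp add: linear_diff[OF P_linear] linear_scale[OF P_linear] algebra_simps)
    have "s *\<^sub>R ((s - t) *\<^sub>R w - y) - P ((s - t) *\<^sub>R w - y) = (s - t) *\<^sub>R y - (s *\<^sub>R y - P y)"
      unfolding gen w ..
    also have "\<dots> = P y - t *\<^sub>R y" by (simp add: algebra_simps)
    finally have "0 \<le> s *\<^sub>R ((s - t) *\<^sub>R w - y) - P ((s - t) *\<^sub>R w - y)" using y by simp
    then show "P ((s - t) *\<^sub>R w - y) \<le> s *\<^sub>R ((s - t) *\<^sub>R w - y)" by simp
  qed (use s1 in auto)
  then have "norm y \<le> norm ((s - t) *\<^sub>R w)" using y by (intro norm_mono_nonneg) auto
  then have 1: "norm y \<le> (s - t) * norm w" using st by simp
  have "norm w \<le> 2 * B * norm y"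
  proof -
    let ?f = "embed_real y" and ?Rs = "resolvent (of_real s) T" and ?RR = "resolvent (of_real R) T"
    have nR: "norm (?RR z) \<le> B * norm z" for z
      using norm_resolvent_le[OF bounded outside_real[OF R1], of z] norm_ge_zero[of z] 
      unfolding B_def distrib_right by linarith
    have "?Rs ?f - ?RR ?f = (of_real R - of_real s) *\<^sub>C ?RR (?Rs ?f)"
      by (rule resolvent_identity[OF bounded outside_real[OF s1] outside_real[OF R1]])
    then have "norm (?Rs ?f - ?RR ?f) = \<epsilon> * norm (?RR (?Rs ?f))"
      using \<epsilon> by (simp add: norm_scaleC s_def flip: of_real_diff)
    also have "\<dots> \<le> \<epsilon> * (B * norm (?Rs ?f))" using \<epsilon> nR by (intro mult_left_mono) auto
    also have "\<dots> = norm (?Rs ?f) / 8" using \<epsilon>(2) by (simp flip: mult.assoc)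
    finally have "norm (?Rs ?f - ?RR ?f) \<le> norm (?Rs ?f) / 8" .
    moreover have "norm (?Rs ?f) \<le> norm (?RR ?f) + norm (?Rs ?f - ?RR ?f)"
      by (rule norm_triangle_sub)
    ultimately have "norm (?Rs ?f) \<le> 2 * B * norm y"
      using nR[of ?f] norm_ge_zero[of "?Rs ?f"] unfolding norm_embed_real by linarith
    then show ?thesis using norm_parts_le(1)[of "?Rs ?f"]
      by (simp add: w_def Q_def real_restriction_def)
  qed
  then have "(s - t) * norm w \<le> (2 * \<epsilon>) * (2 * B * norm y)"
    using st \<epsilon> by (intro mult_mono) auto
  also have "\<dots> = norm y / 2" using \<epsilon>(2) by (simp add: algebra_simps)
  finally have "norm y \<le> norm y / 2" using 1 by linarith
  then show False using y by simp
qed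

lemma nonneg_if_P_le:
  assumes "1 < r" "P x \<le> r *\<^sub>R x"
  shows "0 \<le> x"
  using nonneg_if_no_growing_vector[OF no_growing_vector[OF assms(1)] _ assms(2)] assms(1) by simp

text \<open>
  Positivity of the resolvent in the form of a maximum principle; it yields the domination
  \<open>modulus_resolvent_le\<close> without any series.
\<close>

lemma Q_greatest:
  assumes r: "1 < r" and x: "r *\<^sub>R x - P x \<le> y"
  shows "x \<le> Q r y"
proof -
  have "0 \<le> Q r y - x"
  proof (rule nonneg_if_P_le[OF r])
    have "r *\<^sub>R (Q r y - x) - P (Q r y - x) = y - (r *\<^sub>R x - P x)"
      using Q_right[OF r, of y] by (simp add: linear_diff[OF P_linear] algebra_simps)
    also have "0 \<le> \<dots>" using x by simp
    finally show "P (Q r y - x) \<le> r *\<^sub>R (Q r y - x)" by simp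
  qed
  then show ?thesis by simp
qed

lemma Q_nonneg: "1 < r \<Longrightarrow> 0 \<le> x \<Longrightarrow> 0 \<le> Q r x"
  by (rule Q_greatest) (simp_all add: linear_0[OF P_linear])

lemma Q_mono: "1 < r \<Longrightarrow> x \<le> y \<Longrightarrow> Q r x \<le> Q r y"
  using positive_linear_mono[OF Q_linear Q_nonneg] by blast

lemma modulus_resolvent_le:
  assumes \<mu>: "1 < cmod \<mu>"
  shows "modulus (resolvent \<mu> T f) \<le> Q (cmod \<mu>) (modulus f)"
proof (rule Q_greatest[OF \<mu>])
  let ?x = "resolvent \<mu> T f"
  have "\<mu> *\<^sub>C ?x = f + T ?x"
    using resolvent_right[OF bounded outside[OF \<mu>], of f] by (metis diff_add_cancel)
  then have "modulus (\<mu> *\<^sub>C ?x) \<le> modulus f + modulus (T ?x)"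
    using modulus_add_le[of f "T ?x"] by (simp only:)
  also have "\<dots> \<le> modulus f + P (modulus ?x)"
    by (intro add_left_mono modulus_T_le)
  finally show "cmod \<mu> *\<^sub>R modulus ?x - P (modulus ?x) \<le> modulus f"
    by (simp add: modulus_scaleC diff_le_eq)
qed

lemma Q_identity:
  assumes "1 < r" "1 < s"
  shows "Q r x = Q s x + (s - r) *\<^sub>R Q r (Q s x)"
proof -
  define y where "y = Q s x"
  have "x = (r *\<^sub>R y - P y) + (s - r) *\<^sub>R y"
    using Q_right[OF assms(2), of x] by (simp add: y_def algebra_simps)
  then have "Q r x = Q r (r *\<^sub>R y - P y) + (s - r) *\<^sub>R Q r y"
    by (metis linear_add[OF Q_linear[OF assms(1)]] linear_scale[OF Q_linear[OF assms(1)]])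
  then show ?thesis by (simp add: Q_left[OF assms(1)] y_def)
qed

end

section \<open>The lattice seminorm of an operator\<close>

text \<open>
  For a functional \<open>B\<close> this is the value at \<open>u\<close> of the modulus of \<open>B\<close>. The supremum is over real
  vectors because the elementary Riesz decomposition, which gives subadditivity, is available
  for them; complex vectors then cost a factor 2.
\<close>

definition order_seminorm :: "('a::banach_lattice \<Rightarrow> 'b::real_normed_vector) \<Rightarrow> 'a \<Rightarrow> real"
  where "order_seminorm B u = (SUP x\<in>{x. \<bar>x\<bar> \<le> u}. norm (B x))"

lemma riesz_decomposition:
  fixes x u w :: "'a::banach_lattice"
  assumes "\<bar>x\<bar> \<le> u + w" "0 \<le> u" "0 \<le> w"
  obtains y y' where "x = y + y'" "\<bar>y\<bar> \<le> u" "\<bar>y'\<bar> \<le> w"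
proof
  define y where "y = sup (- u) (inf x u)"
  have x: "x \<le> u + w" "- x \<le> u + w"
    using assms(1) abs_ge_self[of x] abs_ge_minus_self[of x] by (auto intro: order_trans)
  show "x = y + (x - y)" by simp
  have "y \<le> u" unfolding y_def using assms by (intro sup_least) (auto intro: order_trans[of _ 0])
  moreover have "- u \<le> y" by (simp add: y_def)
  ultimately show "\<bar>y\<bar> \<le> u" by (intro abs_leI) (auto simp: minus_le_iff)
  show "\<bar>x - y\<bar> \<le> w"
  proof (rule abs_leI)
    have "x - w \<le> x" "x - w \<le> u" using assms(3) x(1) by (auto simp: diff_le_eq)
    then have "x - w \<le> y" unfolding y_def by (meson le_inf_iff sup.coboundedI2)
    then show "x - y \<le> w" by (simp add: diff_le_eq add.commute)
    have "0 \<le> x + (u + w)" using add_left_mono[OF x(2), of x] by (simp only: right_minus)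
    from add_left_mono[OF this, of "- u"] have "- u \<le> x + w" by (simp add: algebra_simps)
    moreover have "inf x u \<le> x + w" using assms(3) by (simp add: le_infI1)
    ultimately have "y \<le> x + w" unfolding y_def by (rule sup_least)
    then show "- (x - y) \<le> w" by (simp add: diff_le_eq add.commute)
  qed
qed

context
  fixes B :: "'a::banach_lattice \<Rightarrow> 'b::real_normed_vector" and C :: real
  assumes B: "bounded_linear B" and C: "\<And>x. norm (B x) \<le> C * norm x" and C0: "0 \<le> C"
begin

lemma order_seminorm_upper:
  assumes "\<bar>x\<bar> \<le> u"
  shows "norm (B x) \<le> order_seminorm B u"
  unfolding order_seminorm_def
proof (rule cSUP_upper)
  have "norm (B x) \<le> C * norm u" if "\<bar>x\<bar> \<le> u" for x
    using C[of x] mult_left_mono[OF norm_le_of_abs_le[OF that] C0] by linarith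
  then show "bdd_above ((\<lambda>x. norm (B x)) ` {x. \<bar>x\<bar> \<le> u})" by (auto simp: bdd_above_def)
qed (use assms in simp)

lemma order_seminorm_least:
  assumes "0 \<le> u" "\<And>x. \<bar>x\<bar> \<le> u \<Longrightarrow> norm (B x) \<le> b"
  shows "order_seminorm B u \<le> b"
  unfolding order_seminorm_def using assms by (intro cSUP_least) (auto intro: exI[of _ 0])

lemma order_seminorm_nonneg: "0 \<le> u \<Longrightarrow> 0 \<le> order_seminorm B u"
  using order_trans[OF norm_ge_zero order_seminorm_upper[of 0 u]] by simp

lemma order_seminorm_norm_le: "0 \<le> u \<Longrightarrow> order_seminorm B u \<le> C * norm u"
proof (rule order_seminorm_least)
  fix x assume "\<bar>x\<bar> \<le> u"
  then show "norm (B x) \<le> C * norm u"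
    using C[of x] mult_left_mono[OF norm_le_of_abs_le[of x u] C0] by linarith
qed

lemma order_seminorm_mono: "0 \<le> u \<Longrightarrow> u \<le> w \<Longrightarrow> order_seminorm B u \<le> order_seminorm B w"
  by (rule order_seminorm_least) (auto intro: order_seminorm_upper)

lemma order_seminorm_add:
  assumes "0 \<le> u" "0 \<le> w"
  shows "order_seminorm B (u + w) \<le> order_seminorm B u + order_seminorm B w"
proof (rule order_seminorm_least)
  show "0 \<le> u + w" using assms by (rule add_nonneg_nonneg)
  fix x assume "\<bar>x\<bar> \<le> u + w"
  then obtain y y' where *: "x = y + y'" "\<bar>y\<bar> \<le> u" "\<bar>y'\<bar> \<le> w"
    using riesz_decomposition assms by blast
  have "norm (B x) \<le> norm (B y) + norm (B y')"
    unfolding *(1) linear_add[OF bounded_linear.linear[OF B]] by (rule norm_triangle_ineq)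
  also have "\<dots> \<le> order_seminorm B u + order_seminorm B w"
    using * by (intro add_mono order_seminorm_upper)
  finally show "norm (B x) \<le> order_seminorm B u + order_seminorm B w" .
qed

lemma order_seminorm_scaleR_le:
  assumes u: "0 \<le> u" and c: "0 \<le> c"
  shows "order_seminorm B (c *\<^sub>R u) \<le> c * order_seminorm B u"
proof (rule order_seminorm_least)
  show "0 \<le> c *\<^sub>R u" using u c by (rule scaleR_nonneg_nonneg[rotated])
  fix x assume x: "\<bar>x\<bar> \<le> c *\<^sub>R u"
  show "norm (B x) \<le> c * order_seminorm B u"
  proof (cases "c = 0")
    case True
    then show ?thesis using x linear_0[OF bounded_linear.linear[OF B]] by simp
  next
    case False
    then have c: "0 < c" using c by simp
    have "\<bar>inverse c *\<^sub>R x\<bar> \<le> u"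
      using scaleR_left_mono[OF x, of "inverse c"] c by (simp add: abs_scaleR_lattice)
    then have "norm (B (inverse c *\<^sub>R x)) \<le> order_seminorm B u" by (rule order_seminorm_upper)
    then show ?thesis
      using c by (simp add: linear_scale[OF bounded_linear.linear[OF B]] field_simps)
  qed
qed

end

section \<open>The main estimate\<close>

text \<open>
  Here \<open>C\<close> and \<open>M\<close> are the constants of the growth conditions, \<open>\<delta>\<close> and \<open>\<delta>'\<close> bound the change of
  the resolvent from \<open>\<lambda>\<^sup>k\<close> to \<open>s \<lambda>\<^sup>k\<close> and to \<open>s' \<lambda>\<^sup>k\<close>, and \<open>\<eta>\<close> is the defect of the approximate
  eigenvector \<open>z\<close>. Two radii \<open>s\<close> and \<open>s'\<close> are needed: the bound on \<open>(r - 1) \<omega>(|z|)\<close> must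
  be small relative to \<open>s - 1\<close>, which is achieved by moving \<open>s'\<close> alone towards 1. The right-hand side tends
  to 0 if \<open>\<eta> \<rightarrow> 0\<close>, \<open>l \<rightarrow> 1\<close>, \<open>r \<rightarrow> 1\<close>, \<open>s' \<rightarrow> 1\<close>, \<open>s \<rightarrow> 1\<close> in this order.
\<close>

lemma (in positive_operator_radius_one) key_estimate:
  fixes r l s s' C M N D \<delta> \<delta>' \<eta> :: real and k :: int
  assumes lam: "cmod lam = 1" and mu: "lam powi k \<notin> spectrum T"
    and radii: "1 < r" "r < s" "r < s'" "1 < l"
    and C: "\<And>f. norm (resolvent (of_real l * lam) T f) \<le> C / (l - 1) * norm f"
      "\<And>f. norm (resolvent (of_real r * lam) T f) \<le> C / (r - 1) * norm f" "0 \<le> C"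
    and M: "\<And>x. norm (Q r x) \<le> M / (r - 1)\<^sup>2 * norm x" "0 \<le> M"
    and D: "\<And>x. norm (Q s x) \<le> D * norm x" "0 \<le> D"
    and \<delta>: "\<And>f. norm (resolvent (lam powi k) T f - resolvent (of_real s * lam powi k) T f) \<le> \<delta> * norm f"
    and \<delta>': "\<And>f. norm (resolvent (lam powi k) T f - resolvent (of_real s' * lam powi k) T f) \<le> \<delta>' * norm f"
    and \<delta>0: "0 \<le> \<delta>" "0 \<le> \<delta>'"
    and N: "\<And>f. norm (T f) \<le> N * norm f" "\<And>x. norm (P x) \<le> N * norm x" "0 \<le> N"
    and close: "phase_constant k / (s' - r) \<le> 1 / (2 * (r - 1))"
    and z: "norm z = 1" "norm (T z - lam *\<^sub>C z) \<le> \<eta>" "\<eta> \<le> 1"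
  shows "1 \<le> 2 * (phase_constant k * (2 * ((4 * (C * M * \<eta> / (r - 1)) + 2 * (C * M * (\<delta>' * (1 + N)))) / (s - r))
      + C * (C + 1) * (l - 1) / (r - 1) * (D * (N + 3)))) + 2 * (C * (\<delta> * (1 + N))) + C / (l - 1) * \<eta>"
proof -
  define K where "K = phase_constant k"
  define \<rho> where "\<rho> = r - 1"
  define \<sigma> where "\<sigma> = l - 1"
  have K0: "0 \<le> K" by (simp add: K_def phase_constant_nonneg)
  have \<rho>: "0 < \<rho>" and \<sigma>: "0 < \<sigma>" using radii by (simp_all add: \<rho>_def \<sigma>_def)
  have s: "1 < s" "1 < s'" using radii by auto
  have unit: "cmod (of_real t * lam) = t" if "1 < t" for t using that lam by (simp add: norm_mult)
  have unitk: "cmod (of_real t * lam powi k) = t" if "1 < t" for t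
    using that lam by (simp add: norm_mult norm_power_int)
  have out: "of_real t * lam \<notin> spectrum T" if "1 < t" for t
    using outside unit[OF that] that by simp
  have outk: "of_real t * lam powi k \<notin> spectrum T" if "1 < t" for t
    using outside unitk[OF that] that by simp
  define A where "A f = \<sigma> *\<^sub>R resolvent (of_real l * lam) T f" for f
  define B where "B x = A (embed_real x)" for x
  have Rl: "bounded_clinear (resolvent (of_real l * lam) T)"
    by (rule bounded_clinear_resolvent[OF bounded out[OF radii(4)]])
  have A_add: "A (f + g) = A f + A g" and A_diff: "A (f - g) = A f - A g"
    and A_scaleC: "A (c *\<^sub>C f) = c *\<^sub>C A f" for f g c
    unfolding A_def bounded_clinearD(3,4,5)[OF Rl]
    by (rule complexification.expand; simp add: algebra_simps)+
  have A_norm: "norm (A f) \<le> C * norm f" for f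
    using mult_left_mono[OF C(1)[of f], of \<sigma>] \<sigma> by (simp add: A_def \<sigma>_def)
  have B_lin: "bounded_linear B"
    unfolding B_def A_def
    by (intro bounded_linear_const_scaleR bounded_linear_compose[OF bounded_clinearD(1)[OF Rl] bounded_linear_embed_real])
  have B_norm: "norm (B x) \<le> C * norm x" for x
    using A_norm[of "embed_real x"] by (simp add: B_def norm_embed_real)
  note B = B_lin B_norm C(3)
  define \<kappa> where "\<kappa> = order_seminorm B"
  define \<omega> where "\<omega> u = \<rho> * \<kappa> (Q r u)" for u
  have A_le: "norm (A f) \<le> 2 * \<kappa> (modulus f)" for f
  proof -
    have "A f = B (re_part f) + \<i> *\<^sub>C B (im_part f)"
      unfolding B_def by (metis A_add A_scaleC embed_real_decomposition)
    then have "norm (A f) \<le> norm (B (re_part f)) + norm (B (im_part f))"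
      by (metis norm_ii norm_scaleC norm_triangle_ineq mult_1)
    also have "\<dots> \<le> \<kappa> (modulus f) + \<kappa> (modulus f)"
      unfolding \<kappa>_def by (intro add_mono order_seminorm_upper[OF B] abs_parts_le_modulus)
    finally show ?thesis by simp
  qed
  have \<kappa>_norm: "\<kappa> u \<le> C * norm u" if "0 \<le> u" for u
    unfolding \<kappa>_def by (rule order_seminorm_norm_le[OF B that])
  have \<omega>_norm: "\<omega> u \<le> C * M / \<rho> * norm u" if "0 \<le> u" for u
  proof -
    have "\<omega> u \<le> \<rho> * (C * (M / \<rho>\<^sup>2 * norm u))"
      unfolding \<omega>_def using \<rho> C(3) M(1)[of u] \<kappa>_norm[OF Q_nonneg[OF radii(1) that]]
      by (intro mult_left_mono order_trans[OF \<kappa>_norm[OF Q_nonneg[OF radii(1) that]]]) (auto simp: \<rho>_def)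
    also have "\<dots> = C * M / \<rho> * norm u" using \<rho> by (simp add: power2_eq_square)
    finally show ?thesis .
  qed
  have \<omega>_mono: "\<omega> u \<le> \<omega> w" if "0 \<le> u" "u \<le> w" for u w
    unfolding \<omega>_def \<kappa>_def using that \<rho> radii(1)
    by (intro mult_left_mono order_seminorm_mono[OF B] Q_nonneg Q_mono) auto
  have \<omega>_add: "\<omega> (u + w) \<le> \<omega> u + \<omega> w" if "0 \<le> u" "0 \<le> w" for u w
    using order_seminorm_add[OF B Q_nonneg[OF radii(1) that(1)] Q_nonneg[OF radii(1) that(2)]] \<rho>
    by (simp add: \<omega>_def \<kappa>_def linear_add[OF Q_linear[OF radii(1)]] flip: distrib_left)
  have \<omega>_scale: "\<omega> (c *\<^sub>R u) \<le> c * \<omega> u" if "0 \<le> u" "0 \<le> c" for c u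
    using mult_left_mono[OF order_seminorm_scaleR_le[OF B Q_nonneg[OF radii(1) that(1)] that(2)], of \<rho>] \<rho>
    by (simp add: \<omega>_def \<kappa>_def linear_scale[OF Q_linear[OF radii(1)]] mult.left_commute)

  \<comment> \<open>As \<open>A (T - \<lambda>)\<close> is of order \<open>l - 1\<close>, \<open>A\<close> is nearly equal to \<open>(r - 1) \<lambda> A R(r\<lambda>)\<close>.\<close>
  have \<kappa>_le_\<omega>: "\<kappa> u \<le> 2 * \<omega> u + C * (C + 1) * \<sigma> / \<rho> * norm u" if u: "0 \<le> u" for u
    unfolding \<kappa>_def
  proof (rule order_seminorm_least[OF B u])
    fix x assume x: "\<bar>x\<bar> \<le> u"
    define w where "w = resolvent (of_real r * lam) T (embed_real x)"
    have w_eq: "(of_real r * lam) *\<^sub>C w - T w = embed_real x"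
      unfolding w_def by (rule resolvent_right[OF bounded out[OF radii(1)]])
    have "norm w \<le> C / \<rho> * norm x"
      using C(2)[of "embed_real x"] by (simp add: w_def norm_embed_real \<rho>_def)
    also have "\<dots> \<le> C / \<rho> * norm u"
      using C(3) \<rho> norm_le_of_abs_le[OF x] by (intro mult_left_mono) auto
    finally have norm_w: "norm w \<le> C / \<rho> * norm u" .
    have "T w - lam *\<^sub>C w = \<sigma> *\<^sub>R (lam *\<^sub>C w) - ((of_real l * lam) *\<^sub>C w - T w)"
      by (rule complexification.expand) (simp add: \<sigma>_def algebra_simps)
    then have "A (T w - lam *\<^sub>C w) = A (\<sigma> *\<^sub>R (lam *\<^sub>C w)) - A ((of_real l * lam) *\<^sub>C w - T w)"
      by (simp only: A_diff)
    also have "A ((of_real l * lam) *\<^sub>C w - T w) = \<sigma> *\<^sub>R w"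
      unfolding A_def by (simp only: resolvent_left[OF bounded out[OF radii(4)]])
    also have "A (\<sigma> *\<^sub>R (lam *\<^sub>C w)) = \<sigma> *\<^sub>R A (lam *\<^sub>C w)"
      using A_scaleC[of "of_real \<sigma>" "lam *\<^sub>C w"] by (simp only: scaleC_of_real)
    finally have "norm (A (T w - lam *\<^sub>C w)) = \<sigma> * norm (A (lam *\<^sub>C w) - w)"
      using \<sigma> by (simp flip: scaleR_diff_right)
    also have "\<dots> \<le> \<sigma> * (C * norm w + norm w)"
      using \<sigma> A_norm[of "lam *\<^sub>C w"] lam norm_triangle_ineq4[of "A (lam *\<^sub>C w)" w]
      by (intro mult_left_mono) (auto simp: norm_scaleC)
    also have "\<dots> = \<sigma> * (C + 1) * norm w" by (simp add: algebra_simps)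
    also have "\<dots> \<le> \<sigma> * (C + 1) * (C / \<rho> * norm u)"
      using \<sigma> C(3) norm_w by (intro mult_left_mono) auto
    finally have 1: "norm (A (T w - lam *\<^sub>C w)) \<le> C * (C + 1) * \<sigma> / \<rho> * norm u"
      by (simp add: mult_ac)
    have "embed_real x = \<rho> *\<^sub>R (lam *\<^sub>C w) - (T w - lam *\<^sub>C w)"
      unfolding w_eq[symmetric] by (rule complexification.expand) (simp add: \<rho>_def algebra_simps)
    then have "B x = A (\<rho> *\<^sub>R (lam *\<^sub>C w)) - A (T w - lam *\<^sub>C w)"
      unfolding B_def by (simp only: A_diff)
    then have "norm (B x) \<le> norm (A (\<rho> *\<^sub>R (lam *\<^sub>C w))) + norm (A (T w - lam *\<^sub>C w))"
      using norm_triangle_ineq4 by metis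
    also have "norm (A (\<rho> *\<^sub>R (lam *\<^sub>C w))) = \<rho> * norm (A w)"
      using A_scaleC[of "of_real \<rho>" "lam *\<^sub>C w"] A_scaleC[of lam w] \<rho> lam
      by (simp add: scaleC_of_real norm_scaleC)
    also have "\<rho> * norm (A w) \<le> \<rho> * (2 * \<kappa> (Q r u))"
    proof (rule mult_left_mono[OF order_trans[OF A_le]])
      have "modulus w \<le> Q r \<bar>x\<bar>"
        using modulus_resolvent_le[of "of_real r * lam" "embed_real x"] radii(1)
        by (simp add: w_def unit modulus_embed_real)
      also have "\<dots> \<le> Q r u" by (rule Q_mono[OF radii(1) x])
      finally show "2 * \<kappa> (modulus w) \<le> 2 * \<kappa> (Q r u)"
        unfolding \<kappa>_def using order_seminorm_mono[OF B modulus_nonneg] by simp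
    qed (use \<rho> in simp)
    finally show "norm (B x) \<le> 2 * \<omega> u + C * (C + 1) * \<sigma> / \<rho> * norm u"
      using 1 by (simp add: \<omega>_def mult.left_commute)
  qed

  define m where "m = modulus z"
  define e where "e = modulus (T z - lam *\<^sub>C z)"
  have m0: "0 \<le> m" and e0: "0 \<le> e" by (simp_all add: m_def e_def modulus_nonneg)
  have norm_m: "norm m = 1" and norm_e: "norm e \<le> \<eta>" using z by (simp_all add: m_def e_def norm_modulus)
  have \<eta>0: "0 \<le> \<eta>" using norm_e norm_ge_zero order_trans by blast
  have lower: "1 \<le> 2 * \<kappa> m + C / \<sigma> * \<eta>"
  proof -
    have "\<sigma> *\<^sub>R (lam *\<^sub>C z) = ((of_real l * lam) *\<^sub>C z - T z) + (T z - lam *\<^sub>C z)"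
      by (rule complexification.expand) (simp add: \<sigma>_def algebra_simps)
    then have "resolvent (of_real l * lam) T (\<sigma> *\<^sub>R (lam *\<^sub>C z)) =
        z + resolvent (of_real l * lam) T (T z - lam *\<^sub>C z)"
      by (simp only: bounded_clinearD(4)[OF Rl] resolvent_left[OF bounded out[OF radii(4)]])
    then have "A (lam *\<^sub>C z) = z + resolvent (of_real l * lam) T (T z - lam *\<^sub>C z)"
      by (simp only: bounded_clinearD(6)[OF Rl] A_def)
    then have "norm z \<le> norm (A (lam *\<^sub>C z)) + norm (resolvent (of_real l * lam) T (T z - lam *\<^sub>C z))"
      by (metis add_diff_cancel_right' norm_triangle_ineq4)
    also have "norm (A (lam *\<^sub>C z)) \<le> 2 * \<kappa> m"
      using A_le[of "lam *\<^sub>C z"] lam by (simp add: m_def modulus_scaleC)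
    also have "norm (resolvent (of_real l * lam) T (T z - lam *\<^sub>C z)) \<le> C / \<sigma> * \<eta>"
      using C(1)[of "T z - lam *\<^sub>C z"] mult_left_mono[OF z(2), of "C / \<sigma>"] C(3) \<sigma>
      by (simp add: \<sigma>_def)
    finally show ?thesis using z by simp
  qed

  define g where "g = P m - m + 2 *\<^sub>R e"
  have g0: "0 \<le> g"
  proof -
    have "m = modulus (lam *\<^sub>C z)" using lam by (simp add: m_def modulus_scaleC)
    also have "lam *\<^sub>C z = T z + (lam *\<^sub>C z - T z)" by simp
    also have "modulus \<dots> \<le> modulus (T z) + modulus (lam *\<^sub>C z - T z)" by (rule modulus_add_le)
    also have "\<dots> \<le> P m + e"
      unfolding m_def e_def by (intro add_mono modulus_T_le) (simp add: modulus_minus_commute)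
    finally have "0 \<le> P m - m + e" by (simp add: algebra_simps)
    from add_nonneg_nonneg[OF this e0] show ?thesis
      by (simp add: g_def scaleR_2 add.assoc)
  qed
  have norm_g: "norm g \<le> N + 3"
  proof -
    have "norm g \<le> norm (P m) + norm m + norm (2 *\<^sub>R e)"
      unfolding g_def by (intro order_trans[OF norm_triangle_ineq] add_right_mono norm_triangle_ineq4)
    also have "\<dots> \<le> N + 1 + 2 * 1"
      using N(2)[of m] norm_m norm_e z(3) by (intro add_mono) auto
    finally show ?thesis by simp
  qed
  \<comment> \<open>The resolvent turns the defect into \<open>(r - 1) Q r m - m\<close>, and \<open>- m\<close> may be dropped.\<close>
  have \<omega>_g: "\<omega> g \<le> \<rho> * \<omega> m + 2 * (C * M * \<eta> / \<rho>)"
  proof -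
    have "Q r g = Q r (\<rho> *\<^sub>R m + 2 *\<^sub>R e - (r *\<^sub>R m - P m))"
      by (rule arg_cong[where f = "Q r"]) (simp add: g_def \<rho>_def algebra_simps)
    also have "\<dots> = Q r (\<rho> *\<^sub>R m + 2 *\<^sub>R e) - m"
      by (simp only: linear_diff[OF Q_linear[OF radii(1)], of "\<rho> *\<^sub>R m + 2 *\<^sub>R e"] Q_left[OF radii(1)])
    also have "\<dots> \<le> Q r (\<rho> *\<^sub>R m + 2 *\<^sub>R e)" using m0 by simp
    finally have "\<omega> g \<le> \<omega> (\<rho> *\<^sub>R m + 2 *\<^sub>R e)"
      unfolding \<omega>_def \<kappa>_def using \<rho>
      by (intro mult_left_mono order_seminorm_mono[OF B] Q_nonneg radii g0) auto
    also have "\<dots> \<le> \<rho> * \<omega> m + 2 * \<omega> e"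
      using m0 e0 \<rho> by (intro order_trans[OF \<omega>_add] add_mono \<omega>_scale) (auto intro: scaleR_nonneg_nonneg)
    also have "\<omega> e \<le> C * M / \<rho> * \<eta>"
      using \<omega>_norm[OF e0] mult_left_mono[OF norm_e, of "C * M / \<rho>"] C(3) M(2) \<rho> by simp
    finally show ?thesis by simp
  qed
  have \<omega>_Q: "\<omega> (Q t g) \<le> \<omega> g / (t - r)" if t: "r < t" for t
  proof -
    have t1: "1 < t" using t radii by simp
    have "(t - r) *\<^sub>R Q r (Q t g) \<le> Q r g"
      using Q_identity[OF radii(1) t1, of g] Q_nonneg[OF t1 g0] by simp
    then have "inverse (t - r) *\<^sub>R ((t - r) *\<^sub>R Q r (Q t g)) \<le> inverse (t - r) *\<^sub>R Q r g"
      using t by (intro scaleR_left_mono) auto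
    then have "Q r (Q t g) \<le> inverse (t - r) *\<^sub>R Q r g" using t by simp
    then have "\<kappa> (Q r (Q t g)) \<le> inverse (t - r) * \<kappa> (Q r g)"
      unfolding \<kappa>_def using t
      by (intro order_trans[OF order_seminorm_mono[OF B] order_seminorm_scaleR_le[OF B]] Q_nonneg radii t1 g0) auto
    then show ?thesis
      using mult_left_mono[of _ _ \<rho>] \<rho> t by (simp add: \<omega>_def divide_inverse mult_ac)
  qed

  obtain v where v: "is_phase_power k z v" using ex_phase_power by blast
  define f where "f = (lam powi k) *\<^sub>C v - T v"
  have modulus_v: "modulus v = m" unfolding m_def by (rule modulus_phase_power[OF v])
  have norm_v: "norm v = 1" using norm_m by (metis modulus_v norm_modulus)
  have norm_f: "norm f \<le> 1 + N"
  proof -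
    have "norm f \<le> norm ((lam powi k) *\<^sub>C v) + norm (T v)" unfolding f_def by (rule norm_triangle_ineq4)
    also have "\<dots> \<le> 1 + N" using N(1)[of v] lam by (simp add: norm_scaleC norm_power_int norm_v)
    finally show ?thesis .
  qed
  have f_le: "modulus f \<le> K *\<^sub>R g"
    using phase_power_defect_le[OF P_linear P_nonneg lam v]
    unfolding f_def K_def g_def m_def e_def modulus_minus_commute[of "(lam powi k) *\<^sub>C v"] T_eq[of v] T_eq[of z] .
  \<comment> \<open>\<open>modulus_resolvent_le\<close> needs \<open>|\<mu>| > 1\<close>, so \<open>R(\<lambda>\<^sup>k)\<close> is replaced by \<open>R(t \<lambda>\<^sup>k)\<close>.\<close>
  have split: "\<exists>d. 0 \<le> d \<and> norm d \<le> \<gamma> * (1 + N) \<and> m \<le> K *\<^sub>R Q t g + d"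
    if t: "1 < t" and \<gamma>: "\<And>f. norm (resolvent (lam powi k) T f - resolvent (of_real t * lam powi k) T f) \<le> \<gamma> * norm f"
      and \<gamma>0: "0 \<le> \<gamma>" for t \<gamma>
  proof (intro exI conjI)
    let ?d = "resolvent (lam powi k) T f - resolvent (of_real t * lam powi k) T f"
    show "0 \<le> modulus ?d" by (rule modulus_nonneg)
    show "norm (modulus ?d) \<le> \<gamma> * (1 + N)"
      using \<gamma>[of f] mult_left_mono[OF norm_f \<gamma>0] by (simp add: norm_modulus)
    have "v = resolvent (lam powi k) T f"
      unfolding f_def by (rule resolvent_left[OF bounded mu, symmetric])
    then have "v = resolvent (of_real t * lam powi k) T f + ?d" by simp
    then have "m \<le> modulus (resolvent (of_real t * lam powi k) T f) + modulus ?d"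
      using modulus_add_le modulus_v by metis
    also have "modulus (resolvent (of_real t * lam powi k) T f) \<le> Q t (modulus f)"
      using modulus_resolvent_le[of "of_real t * lam powi k" f] t by (simp add: unitk)
    also have "\<dots> \<le> Q t (K *\<^sub>R g)" by (rule Q_mono[OF t f_le])
    also have "\<dots> = K *\<^sub>R Q t g" by (rule linear_scale[OF Q_linear[OF t]])
    finally show "m \<le> K *\<^sub>R Q t g + modulus ?d" by simp
  qed

  define a where "a = \<omega> m"
  \<comment> \<open>First use of \<open>split\<close>: the assumption \<open>close\<close> lets half of \<open>a\<close> be absorbed on the left.\<close>
  have a_bound: "\<rho> * a \<le> 2 * (C * M * \<eta> / \<rho>) + 2 * (C * M * (\<delta>' * (1 + N)))"
  proof -
    obtain d where d: "0 \<le> d" "norm d \<le> \<delta>' * (1 + N)" "m \<le> K *\<^sub>R Q s' g + d"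
      using split[OF s(2) \<delta>' \<delta>0(2)] by blast
    have Qg: "0 \<le> Q s' g" by (rule Q_nonneg[OF s(2) g0])
    have KQg: "0 \<le> K *\<^sub>R Q s' g" using K0 Qg by (intro scaleR_nonneg_nonneg)
    have "a \<le> \<omega> (K *\<^sub>R Q s' g) + \<omega> d"
      unfolding a_def using \<omega>_mono[OF m0 d(3)] \<omega>_add[OF KQg d(1)] by linarith
    also have "\<omega> (K *\<^sub>R Q s' g) \<le> K * (\<omega> g / (s' - r))"
      using \<omega>_scale[OF Qg K0] mult_left_mono[OF \<omega>_Q[OF radii(3)] K0] by linarith
    also have "K * (\<omega> g / (s' - r)) \<le> K / (s' - r) * (\<rho> * a + 2 * (C * M * \<eta> / \<rho>))"
      using mult_left_mono[OF \<omega>_g, of "K / (s' - r)"] K0 radii by (simp add: a_def)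
    also have "\<dots> \<le> 1 / (2 * \<rho>) * (\<rho> * a + 2 * (C * M * \<eta> / \<rho>))"
    proof (rule mult_right_mono)
      show "K / (s' - r) \<le> 1 / (2 * \<rho>)" using close by (simp add: K_def \<rho>_def)
      have "0 \<le> a" unfolding a_def \<omega>_def \<kappa>_def
        using \<rho> by (intro mult_nonneg_nonneg order_seminorm_nonneg[OF B] Q_nonneg radii m0) simp
      then show "0 \<le> \<rho> * a + 2 * (C * M * \<eta> / \<rho>)" using \<rho> C(3) M(2) \<eta>0 by simp
    qed
    also have "\<omega> d \<le> C * M / \<rho> * (\<delta>' * (1 + N))"
      using \<omega>_norm[OF d(1)] mult_left_mono[OF d(2), of "C * M / \<rho>"] C(3) M(2) \<rho> by simp
    finally have "a \<le> 1 / (2 * \<rho>) * (\<rho> * a + 2 * (C * M * \<eta> / \<rho>)) + C * M / \<rho> * (\<delta>' * (1 + N))"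
      by simp
    then have "2 * \<rho> * a \<le> 2 * \<rho> * (1 / (2 * \<rho>) * (\<rho> * a + 2 * (C * M * \<eta> / \<rho>)) + C * M / \<rho> * (\<delta>' * (1 + N)))"
      using \<rho> by (intro mult_left_mono) auto
    also have "\<dots> = \<rho> * a + 2 * (C * M * \<eta> / \<rho>) + 2 * (C * M * (\<delta>' * (1 + N)))"
      using \<rho> by (simp add: distrib_left)
    finally show ?thesis by linarith
  qed

  \<comment> \<open>Second use of \<open>split\<close>, now measured by \<open>\<kappa>\<close>.\<close>
  obtain d where d: "0 \<le> d" "norm d \<le> \<delta> * (1 + N)" "m \<le> K *\<^sub>R Q s g + d"
    using split[OF s(1) \<delta> \<delta>0(1)] by blast
  have Qg: "0 \<le> Q s g" by (rule Q_nonneg[OF s(1) g0])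
  have KQg: "0 \<le> K *\<^sub>R Q s g" using K0 Qg by (intro scaleR_nonneg_nonneg)
  have "\<kappa> m \<le> \<kappa> (K *\<^sub>R Q s g) + \<kappa> d"
    using order_seminorm_mono[OF B m0 d(3)] order_seminorm_add[OF B KQg d(1)] unfolding \<kappa>_def by linarith
  also have "\<kappa> (K *\<^sub>R Q s g) \<le> K * \<kappa> (Q s g)"
    unfolding \<kappa>_def by (rule order_seminorm_scaleR_le[OF B Qg K0])
  also have "\<kappa> (Q s g) \<le> 2 * ((4 * (C * M * \<eta> / \<rho>) + 2 * (C * M * (\<delta>' * (1 + N)))) / (s - r))
      + C * (C + 1) * \<sigma> / \<rho> * (D * (N + 3))"
  proof (rule order_trans[OF \<kappa>_le_\<omega>[OF Qg]], intro add_mono mult_left_mono)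
    show "\<omega> (Q s g) \<le> (4 * (C * M * \<eta> / \<rho>) + 2 * (C * M * (\<delta>' * (1 + N)))) / (s - r)"
    proof (rule order_trans[OF \<omega>_Q[OF radii(2)]], rule divide_right_mono)
      show "\<omega> g \<le> 4 * (C * M * \<eta> / \<rho>) + 2 * (C * M * (\<delta>' * (1 + N)))"
        using \<omega>_g a_bound unfolding a_def by linarith
    qed (use radii in simp)
    show "norm (Q s g) \<le> D * (N + 3)"
      using D(1)[of g] mult_left_mono[OF norm_g D(2)] by linarith
  qed (use C(3) \<sigma> \<rho> in auto)
  also have "\<kappa> d \<le> C * (\<delta> * (1 + N))"
    using \<kappa>_norm[OF d(1)] mult_left_mono[OF d(2) C(3)] by linarith
  finally show ?thesis
    using lower K0 unfolding K_def[symmetric] \<rho>_def[symmetric] \<sigma>_def[symmetric]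
    by (simp add: mult_left_mono)
qed

section \<open>Passage to the limit\<close>

lemma norm_resolvent_near:
  fixes T :: "'a::banach_lattice operator"
  assumes T: "bounded_clinear T" and mu: "cmod mu = 1" "mu \<notin> spectrum T" and smu: "of_real s * mu \<notin> spectrum T"
    and s: "1 < s" "(s - 1) * onorm (resolvent mu T) \<le> 1 / 2"
  shows "norm (resolvent mu T f - resolvent (of_real s * mu) T f) \<le>
    2 * (s - 1) * (onorm (resolvent mu T))\<^sup>2 * norm f"
proof -
  let ?b = "onorm (resolvent mu T)"
  have b: "norm (resolvent mu T f) \<le> ?b * norm f" for f
    by (rule norm_resolvent_le[OF T mu(2)])
  have b0: "0 \<le> ?b" by (rule onorm_pos_le[OF bounded_clinearD(1)[OF bounded_clinear_resolvent[OF T mu(2)]]])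
  have shift: "cmod (mu - of_real s * mu) = s - 1"
  proof -
    have "mu - of_real s * mu = - of_real (s - 1) * mu" by (simp add: algebra_simps)
    then show ?thesis using s mu(1) by (simp only: norm_mult norm_minus_cancel norm_of_real) simp
  qed
  let ?x = "resolvent (of_real s * mu) T f"
  have diff: "norm (resolvent mu T f - ?x) \<le> (s - 1) * ?b * norm ?x"
  proof -
    have "norm (?x - resolvent mu T f) = (s - 1) * norm (resolvent mu T ?x)"
      unfolding resolvent_identity[OF T smu mu(2)] by (simp only: norm_scaleC shift)
    also have "\<dots> \<le> (s - 1) * (?b * norm ?x)" using s b by (intro mult_left_mono) auto
    finally show ?thesis by (simp add: norm_minus_commute mult.assoc)
  qed
  have "norm ?x \<le> norm (resolvent mu T f) + norm (resolvent mu T f - ?x)"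
    by (metis norm_minus_commute norm_triangle_sub)
  also have "\<dots> \<le> ?b * norm f + 1 / 2 * norm ?x"
    using b[of f] diff mult_right_mono[OF s(2), of "norm ?x"] by simp
  finally have x: "norm ?x \<le> 2 * (?b * norm f)" by simp
  have "(s - 1) * ?b * norm ?x \<le> (s - 1) * ?b * (2 * (?b * norm f))"
    using s b0 x by (intro mult_left_mono) auto
  also have "\<dots> = 2 * (s - 1) * ?b\<^sup>2 * norm f" by (simp add: power2_eq_square)
  finally show ?thesis using diff by linarith
qed

text \<open>Vectors at which the resolvent nearly attains its norm are mapped to approximate eigenvectors.\<close>

lemma approximate_eigenvector:
  fixes T :: "'a::banach_lattice operator"
  assumes T: "bounded_clinear T" and lam: "cmod lam = 1" and out: "of_real r * lam \<notin> spectrum T"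
    and r: "1 < r" and c: "0 < c" "1 / (r - 1) \<le> c * onorm (resolvent (of_real r * lam) T)"
  shows "\<exists>z. norm z = 1 \<and> norm (T z - lam *\<^sub>C z) \<le> (r - 1) * (1 + 2 * c)"
proof -
  let ?R = "resolvent (of_real r * lam) T"
  define b where "b = 1 / (2 * c * (r - 1))"
  have b: "0 < b" using c r by (simp add: b_def)
  have "b < onorm ?R"
  proof -
    have "b < 1 / (c * (r - 1))" using c r by (simp add: b_def field_simps)
    also have "\<dots> \<le> onorm ?R" using c r by (simp add: field_simps)
    finally show ?thesis .
  qed
  moreover have "onorm ?R \<le> b" if "\<And>x. norm (?R x) \<le> b * norm x"
    using b that by (intro onorm_bound) auto
  ultimately obtain x where x: "b * norm x < norm (?R x)" by (metis not_le)
  define y where "y = ?R x"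
  have y: "0 < norm y" "norm x \<le> 2 * c * (r - 1) * norm y"
  proof -
    show "0 < norm y" using x b unfolding y_def by (smt (verit) mult_nonneg_nonneg norm_ge_zero)
    show "norm x \<le> 2 * c * (r - 1) * norm y" using x c r by (simp add: y_def b_def field_simps)
  qed
  have "T y - lam *\<^sub>C y = (r - 1) *\<^sub>R (lam *\<^sub>C y) - ((of_real r * lam) *\<^sub>C y - T y)"
    by (rule complexification.expand) (simp add: algebra_simps)
  also have "(of_real r * lam) *\<^sub>C y - T y = x" unfolding y_def by (rule resolvent_right[OF T out])
  finally have "norm (T y - lam *\<^sub>C y) \<le> norm ((r - 1) *\<^sub>R (lam *\<^sub>C y)) + norm x"
    by (simp only: norm_triangle_ineq4)
  also have "\<dots> \<le> (r - 1) * norm y + 2 * c * (r - 1) * norm y"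
    using y r lam by (simp add: norm_scaleC)
  finally have 1: "norm (T y - lam *\<^sub>C y) \<le> (r - 1) * (1 + 2 * c) * norm y"
    by (simp add: algebra_simps)
  define z where "z = inverse (norm y) *\<^sub>R y"
  have "T z - lam *\<^sub>C z = inverse (norm y) *\<^sub>R (T y - lam *\<^sub>C y)"
    unfolding z_def bounded_clinearD(6)[OF T] by (rule complexification.expand) (simp add: algebra_simps)
  then have "norm (T z - lam *\<^sub>C z) = norm (T y - lam *\<^sub>C y) / norm y"
    by (simp add: divide_inverse mult.commute)
  also have "\<dots> \<le> (r - 1) * (1 + 2 * c)" using 1 y by (simp add: pos_divide_le_eq)
  finally show ?thesis using y by (auto simp: z_def intro!: exI[of _ z])
qed

theorem theorem4p1:
  fixes T :: "'a::banach_lattice complexification \<Rightarrow> 'a complexification"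
    and lam :: complex
    and r :: "nat \<Rightarrow> real"
  assumes "bounded_clinear T"
    and "positive_operator T"
    and "spectral_radius T = 1"
    and "lam \<in> peripheral_spectrum T"
    and "\<forall>n. 1 < r n"
    and "decseq r"
    and "r \<longlonglongrightarrow> 1"
    and "(\<lambda>n. onorm (resolvent (of_real (r n) * lam) T)) \<in> O(\<lambda>n. 1 / (r n - 1))"
    and "(\<lambda>n. 1 / (r n - 1)) \<in> O(\<lambda>n. onorm (resolvent (of_real (r n) * lam) T))"
    and "(\<lambda>n. onorm (resolvent (of_real (r n)) T)) \<in> O(\<lambda>n. 1 / (r n - 1)\<^sup>2)"
  shows "\<forall>k::int. lam powi k \<in> peripheral_spectrum T"
proof
  fix k :: int
  interpret positive_operator_radius_one T
    using assms(1-3) by unfold_locales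
  have lam: "cmod lam = 1" using assms(3,4) by (simp add: peripheral_spectrum_def)
  define mu where "mu = lam powi k"
  have mu1: "cmod mu = 1" using lam by (simp add: mu_def norm_power_int)
  have r1: "1 < r n" for n using assms(5) by blast
  have out: "of_real t * lam \<notin> spectrum T" "of_real t * mu \<notin> spectrum T" if "1 < t" for t
    using that lam mu1 by (auto intro!: outside simp: norm_mult)
  have on: "0 \<le> onorm (resolvent (of_real (r n) * lam) T)" "0 \<le> onorm (resolvent (of_real (r n)) T)" for n
    by (intro onorm_pos_le bounded_clinearD(1) bounded_clinear_resolvent bounded out outside_real r1)+
  obtain C where C: "0 < C" "\<forall>\<^sub>F n in sequentially. onorm (resolvent (of_real (r n) * lam) T) \<le> C / (r n - 1)"
    using assms(8) r1 on by (elim landau_o.bigE) (auto simp: abs_of_pos)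
  obtain c where c: "0 < c" "\<forall>\<^sub>F n in sequentially. 1 / (r n - 1) \<le> c * onorm (resolvent (of_real (r n) * lam) T)"
    using assms(9) r1 on by (elim landau_o.bigE) (auto simp: abs_of_pos)
  obtain M where M: "0 < M" "\<forall>\<^sub>F n in sequentially. onorm (resolvent (of_real (r n)) T) \<le> M / (r n - 1)\<^sup>2"
    using assms(10) r1 on by (elim landau_o.bigE) (auto simp: abs_of_pos)
  obtain n0 where n0: "\<And>n. n0 \<le> n \<Longrightarrow> onorm (resolvent (of_real (r n) * lam) T) \<le> C / (r n - 1)"
    "\<And>n. n0 \<le> n \<Longrightarrow> 1 / (r n - 1) \<le> c * onorm (resolvent (of_real (r n) * lam) T)"
    "\<And>n. n0 \<le> n \<Longrightarrow> onorm (resolvent (of_real (r n)) T) \<le> M / (r n - 1)\<^sup>2"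
    using eventually_conj[OF C(2) eventually_conj[OF c(2) M(2)]]
    unfolding eventually_sequentially by blast
  show "lam powi k \<in> peripheral_spectrum T"
  proof (rule ccontr)
    assume "lam powi k \<notin> peripheral_spectrum T"
    then have mu: "mu \<notin> spectrum T"
      using mu1 assms(3) by (simp add: peripheral_spectrum_def mu_def)
    define b where "b = onorm (resolvent mu T)"
    define N where "N = onorm T"
    define K where "K = phase_constant k"
    have N0: "0 \<le> N" unfolding N_def by (rule onorm_pos_le[OF bounded_clinearD(1)[OF bounded]])
    have r_lim: "(\<lambda>n. r n - 1) \<longlonglongrightarrow> 0"
      using tendsto_diff[OF assms(7) tendsto_const[of 1]] by simp
    define gap where "gap n = 2 * (inverse (real (Suc n))) * b\<^sup>2" for n
    define t where "t n = 1 + inverse (real (Suc n))" for n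
    have t1: "1 < t n" for n by (simp add: t_def)
    have inv0: "(\<lambda>n. inverse (real (Suc n))) \<longlonglongrightarrow> 0" by (rule LIMSEQ_inverse_real_of_nat)
    have "(\<lambda>n. 2 * inverse (real (Suc n)) * b\<^sup>2) \<longlonglongrightarrow> 2 * 0 * b\<^sup>2" by (intro tendsto_intros inv0)
    then have gap0: "gap \<longlonglongrightarrow> 0" unfolding gap_def[abs_def] by simp
    have gap_nonneg: "0 \<le> gap n" for n by (simp add: gap_def)
    have "(\<lambda>n. inverse (real (Suc n)) * b) \<longlonglongrightarrow> 0 * b" by (intro tendsto_intros inv0)
    then have "\<forall>\<^sub>F n in sequentially. inverse (real (Suc n)) * b < 1 / 2"
      by (intro order_tendstoD(2)) auto
    then obtain j0 where j0: "\<And>n. j0 \<le> n \<Longrightarrow> inverse (real (Suc n)) * b \<le> 1 / 2"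
      unfolding eventually_sequentially by (meson less_imp_le)
    have near: "norm (resolvent mu T f - resolvent (of_real (t n) * mu) T f) \<le> gap n * norm f" if "j0 \<le> n" for n f
      using norm_resolvent_near[OF bounded mu1 mu out(2)[OF t1[of n]] t1, of f] j0[OF that]
      by (simp add: t_def b_def gap_def)

    \<comment> \<open>The limit \<open>\<eta> \<rightarrow> 0\<close> of \<open>key_estimate\<close>, along approximate eigenvectors of increasing quality.\<close>
    have estimate_for_eigenvectors: "1 \<le> 2 * (K * (2 * ((4 * (C * M * 0 / (r n - 1)) + 2 * (C * M * (gap j' * (1 + N)))) / (t j - r n))
      + C * (C + 1) * (r l - 1) / (r n - 1) * (onorm (resolvent (of_real (t j)) T) * (N + 3))))
      + 2 * (C * (gap j * (1 + N))) + C / (r l - 1) * 0"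
      if idx: "n0 \<le> n" "n0 \<le> l" "j0 \<le> j" "j0 \<le> j'" "r n < t j" "r n < t j'" "K / (t j' - r n) \<le> 1 / (2 * (r n - 1))"
      for n l j j'
    proof -
      define \<eta> where "\<eta> m = (r m - 1) * (1 + 2 * c)" for m
      have "\<eta> \<longlonglongrightarrow> 0 * (1 + 2 * c)" unfolding \<eta>_def[abs_def] by (intro tendsto_intros r_lim)
      then have \<eta>0: "\<eta> \<longlonglongrightarrow> 0" by simp
      then have "\<forall>\<^sub>F m in sequentially. \<eta> m < 1" by (intro order_tendstoD(2)) auto
      then obtain m0 where m0: "\<And>m. m0 \<le> m \<Longrightarrow> \<eta> m < 1" unfolding eventually_sequentially by blast
      let ?X = "\<lambda>\<eta>. 2 * (K * (2 * ((4 * (C * M * \<eta> / (r n - 1)) + 2 * (C * M * (gap j' * (1 + N)))) / (t j - r n))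
        + C * (C + 1) * (r l - 1) / (r n - 1) * (onorm (resolvent (of_real (t j)) T) * (N + 3))))
        + 2 * (C * (gap j * (1 + N))) + C / (r l - 1) * \<eta>"
      have "1 \<le> ?X (\<eta> m)" if m: "max n0 m0 \<le> m" for m
      proof -
        obtain z where z: "norm z = 1" "norm (T z - lam *\<^sub>C z) \<le> \<eta> m"
          using approximate_eigenvector[OF bounded lam out(1)[OF r1] r1 c(1) n0(2)[of m]] m
          by (auto simp: \<eta>_def)
        have Rl: "norm (resolvent (of_real (r p) * lam) T f) \<le> C / (r p - 1) * norm f" if "n0 \<le> p" for p f
          using norm_resolvent_le[OF bounded out(1)[OF r1[of p]], of f] mult_right_mono[OF n0(1)[OF that] norm_ge_zero[of f]]
          by linarith
        have Qn: "norm (Q (r n) x) \<le> M / (r n - 1)\<^sup>2 * norm x" for x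
          using norm_Q_le[OF r1[of n], of x] mult_right_mono[OF n0(3)[OF \<open>n0 \<le> n\<close>] norm_ge_zero[of x]]
          by linarith
        show ?thesis
          unfolding K_def
        proof (rule key_estimate[where s' = "t j'" and z = z])
          show "lam powi k \<notin> spectrum T" using mu by (simp add: mu_def)
          show "norm (Q (t j) x) \<le> onorm (resolvent (of_real (t j)) T) * norm x" for x
            by (rule norm_Q_le[OF t1])
          show "0 \<le> onorm (resolvent (of_real (t j)) T)"
            by (intro onorm_pos_le bounded_clinearD(1) bounded_clinear_resolvent bounded outside_real t1)
          show "norm (T f) \<le> N * norm f" for f unfolding N_def by (rule bounded_clinearD(7)[OF bounded])
          show "norm (P x) \<le> N * norm x" for x unfolding N_def by (rule norm_P_le)
          show "phase_constant k / (t j' - r n) \<le> 1 / (2 * (r n - 1))" using idx(7) K_def by simp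
          show "\<eta> m \<le> 1" using m0[of m] m by simp
          show "norm (resolvent (lam powi k) T f - resolvent (of_real (t j) * lam powi k) T f) \<le> gap j * norm f" for f
            using near[OF \<open>j0 \<le> j\<close>] by (simp add: mu_def)
          show "norm (resolvent (lam powi k) T f - resolvent (of_real (t j') * lam powi k) T f) \<le> gap j' * norm f" for f
            using near[OF \<open>j0 \<le> j'\<close>] by (simp add: mu_def)
        qed (use lam r1 idx C M N0 gap_nonneg z Rl Qn in auto)
      qed
      moreover have "(\<lambda>m. ?X (\<eta> m)) \<longlonglongrightarrow> ?X 0" using r1[of n] r1[of l] idx by (intro tendsto_intros \<eta>0) auto
      ultimately show ?thesis by (intro LIMSEQ_le_const) blast+
    qed

    \<comment> \<open>Next, \<open>r l\<close> tends to 1 for fixed \<open>r n\<close>.\<close>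
    have estimate_after_l: "1 \<le> 2 * (K * (2 * ((4 * (C * M * 0 / (r n - 1)) + 2 * (C * M * (gap j' * (1 + N)))) / (t j - r n))
      + C * (C + 1) * 0 / (r n - 1) * (onorm (resolvent (of_real (t j)) T) * (N + 3))))
      + 2 * (C * (gap j * (1 + N)))"
      if "n0 \<le> n" "j0 \<le> j" "j0 \<le> j'" "r n < t j" "r n < t j'" "K / (t j' - r n) \<le> 1 / (2 * (r n - 1))"
      for n j j'
    proof -
      let ?X = "\<lambda>\<sigma>. 2 * (K * (2 * ((4 * (C * M * 0 / (r n - 1)) + 2 * (C * M * (gap j' * (1 + N)))) / (t j - r n))
        + C * (C + 1) * \<sigma> / (r n - 1) * (onorm (resolvent (of_real (t j)) T) * (N + 3))))
        + 2 * (C * (gap j * (1 + N)))"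
      have "1 \<le> ?X (r l - 1)" if "n0 \<le> l" for l
        using estimate_for_eigenvectors[OF \<open>n0 \<le> n\<close> that \<open>j0 \<le> j\<close> \<open>j0 \<le> j'\<close> \<open>r n < t j\<close> \<open>r n < t j'\<close> \<open>K / _ \<le> _\<close>] by simp
      moreover have "(\<lambda>l. ?X (r l - 1)) \<longlonglongrightarrow> ?X 0" using r1[of n] that by (intro tendsto_intros r_lim) auto
      ultimately show ?thesis by (intro LIMSEQ_le_const) blast+
    qed

    \<comment> \<open>Next, \<open>r n\<close> tends to 1; the condition \<open>close\<close> of \<open>key_estimate\<close> holds eventually.\<close>
    have estimate_after_r: "1 \<le> 2 * (K * (2 * (2 * (C * M * (gap j' * (1 + N))) / (t j - 1)))) + 2 * (C * (gap j * (1 + N)))"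
      if j: "j0 \<le> j" "j0 \<le> j'" for j j'
    proof -
      let ?X = "\<lambda>r. 2 * (K * (2 * (2 * (C * M * (gap j' * (1 + N))) / (t j - r)))) + 2 * (C * (gap j * (1 + N)))"
      have "(\<lambda>n. K / (t j' - r n) * (2 * (r n - 1))) \<longlonglongrightarrow> K / (t j' - 1) * (2 * 0)"
        using t1[of j'] by (intro tendsto_intros r_lim assms(7)) auto
      then have "\<forall>\<^sub>F n in sequentially. K / (t j' - r n) * (2 * (r n - 1)) < 1"
        by (intro order_tendstoD(2)) auto
      moreover have "\<forall>\<^sub>F n in sequentially. r n < t j" "\<forall>\<^sub>F n in sequentially. r n < t j'"
        using t1 by (auto intro!: order_tendstoD(2)[OF assms(7)])
      moreover have "\<forall>\<^sub>F n in sequentially. n0 \<le> n" by (rule eventually_ge_at_top)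
      ultimately have "\<forall>\<^sub>F n in sequentially. 1 \<le> ?X (r n)"
      proof eventually_elim
        case (elim n)
        have "K / (t j' - r n) \<le> 1 / (2 * (r n - 1))"
          using elim(1) r1[of n] by (simp add: pos_le_divide_eq)
        from estimate_after_l[OF elim(4) j elim(2,3) this] show ?case by simp
      qed
      moreover have "(\<lambda>n. ?X (r n)) \<longlonglongrightarrow> ?X 1" using t1[of j] by (intro tendsto_intros assms(7)) auto
      ultimately show ?thesis by (intro tendsto_lowerbound[of _ "?X 1"]) auto
    qed

    \<comment> \<open>Next, \<open>t j'\<close> tends to 1; \<open>t j\<close> does so last, because it occurs in a denominator.\<close>
    have estimate_after_t: "1 \<le> 2 * (K * (2 * (2 * (C * M * (0 * (1 + N))) / (t j - 1)))) + 2 * (C * (gap j * (1 + N)))"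
      if j: "j0 \<le> j" for j
    proof (rule LIMSEQ_le_const)
      show "(\<lambda>j'. 2 * (K * (2 * (2 * (C * M * (gap j' * (1 + N))) / (t j - 1)))) + 2 * (C * (gap j * (1 + N))))
        \<longlonglongrightarrow> 2 * (K * (2 * (2 * (C * M * (0 * (1 + N))) / (t j - 1)))) + 2 * (C * (gap j * (1 + N)))"
        using t1[of j] by (intro tendsto_intros gap0) auto
    qed (use estimate_after_r[OF j] in blast)
    have "1 \<le> 2 * (C * (0 * (1 + N)))"
    proof (rule LIMSEQ_le_const)
      show "(\<lambda>j. 2 * (C * (gap j * (1 + N)))) \<longlonglongrightarrow> 2 * (C * (0 * (1 + N)))" by (intro tendsto_intros gap0)
      show "\<exists>j0. \<forall>j\<ge>j0. 1 \<le> 2 * (C * (gap j * (1 + N)))" using estimate_after_t by auto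
    qed
    then show False by simp
  qed
qed

end
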